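(* Let $m\in\mathbb N$, $0<\delta_0<1$, $A>0$ and $0<\delta<\sqrt{\delta_0/(2-\delta_0)}$. For $t_0>0$ and $t_1,t_2\in\mathbb C$ with $2|t_2|<1$ let $K_n$ be the normalized reproducing kernel and $R_n^{(m)}$ the $m$-point correlation function for the potential $V(z)=\frac1{t_0}\left(|z|^2-2\,\mathrm{Re}(t_1z+t_2z^2)\right)$. Then $$\lim_{n\to\infty}\ \sup_{\substack{0\le 2|t_2|\le 1-\delta_0\\ t_1\in\mathbb C,\ t_0>0}}\ \sup_{\substack{z_0\in E_{t_0,t_1,t_2,-\delta}\\ a_1,\dots,a_m\in\overline{B}_A(0)}}\left|\frac{R_n^{(m)}\left(z_0+\frac{a_1}{\sqrt{K_n(z_0,z_0)}},\dots,z_0+\frac{a_m}{\sqrt{K_n(z_0,z_0)}}\right)}{K_n(z_0,z_0)^m}-\det\left(e^{-\frac{\pi}{2}|a_k-a_l|^2+i\pi\,\mathrm{Im}(\overline{a_k}a_l)}\right)_{k,l=1}^m\right|=0,$$ and $$\lim_{n\to\infty}\ \sup_{\substack{0\le 2|t_2|\le 1-\delta_0\\ t_1\in\mathbb C,\ t_0>0}}\ \sup_{\substack{z_0\in \partial E_{t_0,t_1,t_2}\\ a_1,\dots,a_m\in\overline{B}_A(0)}}\left|\frac{R_n^{(m)}\left(z_0+\frac{a_1e^{i\psi(z_0)}}{\sqrt{K_n(z_0,z_0)}},\dots,z_0+\frac{a_me^{i\psi(z_0)}}{\sqrt{K_n(z_0,z_0)}}\right)}{K_n(z_0,z_0)^m}-\det\left(\mathrm{erfc}\left(\sqrt\pi(\overline{a_k}+a_l)\right)e^{-\pi|a_k-a_l|^2+2i\pi\,\mathrm{Im}(\overline{a_k}a_l)}\right)_{k,l=1}^m\right|=0.$$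 Here, for $z_0\in\partial E_{t_0,t_1,t_2}$, the angle $\psi(z_0)$ is as follows. If $t_2\ne0$, let $\phi\in(-\pi,\pi]$ be such that $\sqrt{t_2/|t_2|}\,(z_0-v)=a_{t_0,t_2}\cos\phi+i\,b_{t_0,t_2}\sin\phi$; then $$\psi(z_0)=-\frac{\arg t_2}{2}+\begin{cases}\arctan\left(\frac{1+2|t_2|}{1-2|t_2|}\tan\phi\right)&\phi\in(-\frac\pi2,\frac\pi2),\\ \arctan\left(\frac{1+2|t_2|}{1-2|t_2|}\tan\phi\right)+\mathrm{sign}(\phi)\pi&\phi\notin[-\frac\pi2,\frac\pi2],\\ \phi&\phi=\pm\frac\pi2.\end{cases}$$ If $t_2=0$, $\psi(z_0)=\phi$ where $z_0-v=\sqrt{t_0}\,e^{i\phi}$.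
   Context: For $n\in\mathbb N$ and a potential $V:\mathbb C\to\mathbb R$, let $(p_{k,n})_{k\ge0}$ be the polynomials with $\deg p_{k,n}=k$ and positive leading coefficient satisfying $\int_{\mathbb C}\overline{p_{k,n}(z)}p_{l,n}(z)e^{-nV(z)}\,d^2z=\delta_{kl}$ ($d^2z$ is Lebesgue measure). The normalized reproducing kernel is $K_n(w,z)=e^{-\frac n2(V(w)+V(z))}\sum_{k=0}^{n-1}\overline{p_{k,n}(w)}\,p_{k,n}(z)$, and for $1\le m\le n$ the $m$-point correlation function is $R_n^{(m)}(z_1,\dots,z_m)=\det(K_n(z_k,z_l))_{k,l=1}^m$. For $t_0>0$, $t_1,t_2\in\mathbb C$, $2|t_2|<1$ put $v=v(t_1,t_2)=\frac{\overline{t_1}+2t_1\overline{t_2}}{1-4|t_2|^2}$, $a_{t_0,t_2}=\sqrt{t_0\frac{1+2|t_2|}{1-2|t_2|}}$, $b_{t_0,t_2}=\sqrt{t_0\frac{1-2|t_2|}{1+2|t_2|}}$. If $t_2\neq0$: $\partial E_{t_0,t_1,t_2}=\left\{z\in\mathbb C:\frac{(\mathrm{Re}(\sqrt{t_2}(z-v)))^2}{a_{t_0,t_2}^2}+\frac{(\mathrm{Im}(\sqrt{t_2}(z-v)))^2}{b_{t_0,t_2}^2}=|t_2|\right\}$ and $E_{t_0,t_1,t_2,\pm\delta}=\left\{z\in\mathbb C:\frac{(\mathrm{Re}(\sqrt{t_2}(z-v)))^2}{(a_{t_0,t_2}\pm\delta\sqrt{t_0})^2}+\frac{(\mathrm{Im}(\sqrt{t_2}(z-v)))^2}{(b_{t_0,t_2}\pm\delta\sqrt{t_0})^2}<|t_2|\right\}$.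 If $t_2=0$: $\partial E_{t_0,t_1,0}=\{z:|z-v|^2=t_0\}$ and $E_{t_0,t_1,0,\pm\delta}=\{z:|z-v|^2<t_0(1\pm\delta)^2\}$. $\arg$ takes values in $(-\pi,\pi]$, square roots are principal ($\sqrt{e^{i\theta}}=e^{i\theta/2}$ for $\theta\in(-\pi,\pi]$), $\overline B_A(0)$ is the closed disc of radius $A$ around $0$, and $\mathrm{erfc}(z)=\frac{2}{\sqrt\pi}\int_z^\infty e^{-w^2}dw$ (entire function). *)

theory Defs
  imports
    "HOL-Analysis.Analysis"
    "HOL-Computational_Algebra.Polynomial"
begin

section \<open>Orthonormal polynomials, reproducing kernel, correlation functions\<close>

text \<open>
  Using \<open>has_bochner_integral\<close> makes the orthonormality relations include the integrability of
  the integrands, so they cannot hold through the convention that a non-existent integral is zero.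
\<close>

definition orthonormal_polys ::
    "nat \<Rightarrow> (complex \<Rightarrow> real) \<Rightarrow> (nat \<Rightarrow> complex poly) \<Rightarrow> bool" where
  "orthonormal_polys n V p \<longleftrightarrow>
     (\<forall>k. degree (p k) = k \<and> lead_coeff (p k) \<in> \<real> \<and> 0 < Re (lead_coeff (p k))) \<and>
     (\<forall>k l. has_bochner_integral lborel
        (\<lambda>z. cnj (poly (p k) z) * poly (p l) z * complex_of_real (exp (- (real n * V z))))
        (if k = l then 1 else 0))"

text \<open>
  A family satisfying \<open>orthonormal_polys n V\<close> is unique if it exists. It exists for \<open>n \<ge> 1\<close> and the
  potentials considered here, since then all moments of the weight are finite.
\<close>

definition orthonormal_poly :: "nat \<Rightarrow> (complex \<Rightarrow> real) \<Rightarrow> nat \<Rightarrow> complex poly" where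
  "orthonormal_poly n V = (THE p. orthonormal_polys n V p)"

definition repr_kernel :: "nat \<Rightarrow> (complex \<Rightarrow> real) \<Rightarrow> complex \<Rightarrow> complex \<Rightarrow> complex" where
  "repr_kernel n V w z =
     complex_of_real (exp (- (real n / 2) * (V w + V z))) *
     (\<Sum>k<n. cnj (poly (orthonormal_poly n V k) w) * poly (orthonormal_poly n V k) z)"

text \<open>The number \<open>m\<close> of points is the cardinality of the index type \<open>'m\<close>.\<close>

definition correlation :: "nat \<Rightarrow> (complex \<Rightarrow> real) \<Rightarrow> complex ^ 'm \<Rightarrow> complex" where
  "correlation n V z = det (\<chi> k l. repr_kernel n V (z $ k) (z $ l))"


section \<open>The elliptic potential and its droplet\<close>

definition elliptic_potential :: "real \<Rightarrow> complex \<Rightarrow> complex \<Rightarrow> complex \<Rightarrow> real" where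
  "elliptic_potential t0 t1 t2 z = (1 / t0) * ((cmod z)\<^sup>2 - 2 * Re (t1 * z + t2 * z\<^sup>2))"

definition centre :: "complex \<Rightarrow> complex \<Rightarrow> complex" where
  "centre t1 t2 = (cnj t1 + 2 * t1 * cnj t2) / complex_of_real (1 - 4 * (cmod t2)\<^sup>2)"

definition semi_a :: "real \<Rightarrow> complex \<Rightarrow> real" where
  "semi_a t0 t2 = sqrt (t0 * ((1 + 2 * cmod t2) / (1 - 2 * cmod t2)))"

definition semi_b :: "real \<Rightarrow> complex \<Rightarrow> real" where
  "semi_b t0 t2 = sqrt (t0 * ((1 - 2 * cmod t2) / (1 + 2 * cmod t2)))"

definition ellipse_boundary :: "real \<Rightarrow> complex \<Rightarrow> complex \<Rightarrow> complex set" where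
  "ellipse_boundary t0 t1 t2 =
     (if t2 = 0 then {z. (cmod (z - centre t1 t2))\<^sup>2 = t0}
      else {z. (Re (csqrt t2 * (z - centre t1 t2)))\<^sup>2 / (semi_a t0 t2)\<^sup>2 +
               (Im (csqrt t2 * (z - centre t1 t2)))\<^sup>2 / (semi_b t0 t2)\<^sup>2 = cmod t2})"

text \<open>
  The last argument \<open>s\<close> is signed: \<open>s = \<delta>\<close> and \<open>s = -\<delta>\<close> give the ellipse with both semi-axes
  lengthened, respectively shortened, by \<open>\<delta> * sqrt t0\<close>.
\<close>

definition ellipse_region :: "real \<Rightarrow> complex \<Rightarrow> complex \<Rightarrow> real \<Rightarrow> complex set" where
  "ellipse_region t0 t1 t2 s =
     (if t2 = 0 then {z. (cmod (z - centre t1 t2))\<^sup>2 < t0 * (1 + s)\<^sup>2}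
      else {z. (Re (csqrt t2 * (z - centre t1 t2)))\<^sup>2 / (semi_a t0 t2 + s * sqrt t0)\<^sup>2 +
               (Im (csqrt t2 * (z - centre t1 t2)))\<^sup>2 / (semi_b t0 t2 + s * sqrt t0)\<^sup>2 < cmod t2})"

text \<open>
  For a point \<open>z0\<close> of \<open>ellipse_boundary t0 t1 t2\<close> there is exactly one such angle. For \<open>t2 = 0\<close> the
  range \<open>{-pi<..pi}\<close> only fixes a representative modulo \<open>2 * pi\<close>.
\<close>

definition ellipse_angle :: "real \<Rightarrow> complex \<Rightarrow> complex \<Rightarrow> complex \<Rightarrow> real" where
  "ellipse_angle t0 t1 t2 z0 =
     (THE \<phi>. \<phi> \<in> {-pi<..pi} \<and>
        (if t2 = 0 then z0 - centre t1 t2 = complex_of_real (sqrt t0) * cis \<phi>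
         else csqrt (t2 / complex_of_real (cmod t2)) * (z0 - centre t1 t2) =
              Complex (semi_a t0 t2 * cos \<phi>) (semi_b t0 t2 * sin \<phi>)))"

definition normal_angle :: "real \<Rightarrow> complex \<Rightarrow> complex \<Rightarrow> complex \<Rightarrow> real" where
  "normal_angle t0 t1 t2 z0 =
     (let \<phi> = ellipse_angle t0 t1 t2 z0;
          \<theta> = arctan ((1 + 2 * cmod t2) / (1 - 2 * cmod t2) * tan \<phi>)
      in if t2 = 0 then \<phi>
         else - (Arg t2 / 2) +
           (if \<phi> = pi / 2 \<or> \<phi> = - (pi / 2) then \<phi>
            else if \<phi> \<in> {- (pi / 2)<..<pi / 2} then \<theta>
            else \<theta> + sgn \<phi> * pi))"


section \<open>Complementary error function\<close>

text \<open>
  The integral from \<open>z\<close> to \<open>\<infinity>\<close> is taken along the horizontal ray \<open>z + x\<close>, \<open>x \<ge> 0\<close>, on which it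
  converges absolutely for every complex \<open>z\<close>.
\<close>

definition erfc :: "complex \<Rightarrow> complex" where
  "erfc z = complex_of_real (2 / sqrt pi) *
     (LBINT x:{0..}. exp (- (z + complex_of_real x)\<^sup>2))"

end

theory Submission
  imports Defs "HOL-Probability.Probability"
begin

text \<open>
  An affine change of variables turns the potential into \<open>|z|\<^sup>2 - t * Re (z\<^sup>2)\<close> with \<open>t = 2|t2|\<close>, whose
  orthogonal polynomials are rescaled Hermite polynomials: integration by parts shows that
  differentiation has an explicit adjoint for the Gaussian inner product, and this adjoint generates
  them from \<open>1\<close>. Mehler's formula sums the corresponding kernel over all degrees in closed form, so up
  to unimodular factors, which cancel in the determinants, the kernel is an explicit Gaussian times the
  ratio of the partial sum over \<open>k < n\<close> to the full series. It remains to find the limit of this ratio.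

  In the bulk, inserting \<open>r\<^sup>k\<close> with \<open>r > 1\<close> slightly larger than one into the series on the diagonal gives
  a Chernoff bound for its tail, so the ratio tends to \<open>1\<close> exponentially fast. On the boundary, the
  partial sum is a contour integral of Mehler's generating function over a circle \<open>|r| = exp (- q)\<close>.
  With \<open>q\<close> of order \<open>1 / sqrt n\<close> the circle passes close to the point \<open>r = 1\<close>, where the pole \<open>1 / (1 - r)\<close>
  meets the saddle point of the phase, and dominated convergence produces the complementary error function.

  All these limits hold along arbitrary convergent sequences of the reduced parameters, which range over a
  bounded set. Uniformity therefore follows by extracting a convergent subsequence from
  a sequence of hypothetical counterexamples.
\<close>

section \<open>Gaussian integrals over the plane\<close>

text \<open>Everything turns on the phase \<open>(r - 1) * B r - ln r\<close>, where
  \<open>B r\<close> is \<open>exponent_factor\<close>. On the diagonal its derivative at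
  \<open>r = 1\<close> is \<open>ellipse_form - 1\<close>. Inside the ellipse this is negative, so
  moving \<open>r\<close> slightly beyond 1 gains an exponential factor. On the ellipse it vanishes,
  which puts the saddle point at \<open>r = 1\<close>. The pole at the same point comes from the sum
  of \<open>inverse r ^ j\<close> over \<open>j < n\<close>, the factor that selects the terms
  \<open>k < n\<close>. As a function of \<open>ln r\<close> the phase has second derivative
  \<open>ellipse_gradient\<close> squared there, whence
  \<open>q = 1 / (ellipse_gradient * sqrt n)\<close>. Off the diagonal the terms of the series have
  no sign. In the bulk a Cauchy-Schwarz argument reduces them to the diagonal at the price
  \<open>exp (n * |z - w|^2 / 2)\<close>, harmless at distances of order \<open>1 / sqrt n\<close>.
  At the edge the two points enter through \<open>(z + cnj w) / 2\<close> and
  \<open>(z - cnj w) / (2 * \<i>)\<close>, so the perturbation is complex and needs its own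
  estimate. On the diagonal the ratio tends to 1 in the bulk but to 1/2 at the edge. Since lengths
  are measured by the kernel itself, this halving doubles the exponents in the second limit.\<close>

lemma lborel_complex_eq_distr:
  "(lborel :: complex measure) = distr (lborel \<Otimes>\<^sub>M lborel) borel (\<lambda>(x, y). Complex x y)"
proof (rule lborel_eqI)
  have [measurable]: "(\<lambda>(x, y). Complex x y) \<in> borel_measurable (lborel \<Otimes>\<^sub>M lborel)"
    unfolding Complex_eq by measurable
  show "sets (distr (lborel \<Otimes>\<^sub>M lborel) borel (\<lambda>(x, y). Complex x y)) = sets borel"
    by simp
  fix l u :: complex
  assume le: "\<And>b. b \<in> Basis \<Longrightarrow> l \<bullet> b \<le> u \<bullet> b"
  have lu: "Re l \<le> Re u" "Im l \<le> Im u"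
    using le[of 1] le[of \<i>] by (auto simp: Basis_complex_def)
  have "(\<lambda>(x, y). Complex x y) -` box l u \<inter> space (lborel \<Otimes>\<^sub>M lborel)
      = {Re l<..<Re u} \<times> {Im l<..<Im u}"
    by (auto simp: box_def Basis_complex_def space_pair_measure)
  then have "emeasure (distr (lborel \<Otimes>\<^sub>M lborel) borel (\<lambda>(x, y). Complex x y)) (box l u)
      = emeasure (lborel \<Otimes>\<^sub>M lborel) ({Re l<..<Re u} \<times> {Im l<..<Im u})"
    by (subst emeasure_distr) auto
  also have "\<dots> = ennreal (Re u - Re l) * ennreal (Im u - Im l)"
    using lu by (subst lborel.emeasure_pair_measure_Times) auto
  also have "\<dots> = (\<Prod>b\<in>Basis. (u - l) \<bullet> b)"
    using lu by (simp add: Basis_complex_def ennreal_mult)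
  finally show "emeasure (distr (lborel \<Otimes>\<^sub>M lborel) borel (\<lambda>(x, y). Complex x y)) (box l u)
      = (\<Prod>b\<in>Basis. (u - l) \<bullet> b)" .
qed

text \<open>A multiple of the normal density with variance \<open>1 / (2 * a)\<close>, whose total
  mass is known.\<close>

lemma has_bochner_integral_gaussian:
  assumes "a > (0::real)"
  shows "has_bochner_integral lborel (\<lambda>x. exp (- a * (x - b)\<^sup>2)) (sqrt (pi / a))"
proof -
  define s where "s = sqrt (1 / (2 * a))"
  have s: "s > 0" "s\<^sup>2 = 1 / (2 * a)"
    using assms by (auto simp: s_def)
  have "has_bochner_integral lborel (normal_density b s) 1"
    using s by (simp add: has_bochner_integral_iff)
  then have "has_bochner_integral lborel (\<lambda>x. sqrt (2 * pi * s\<^sup>2) * normal_density b s x) (sqrt (2 * pi * s\<^sup>2) * 1)"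
    by (intro has_bochner_integral_mult_right) auto
  moreover have "sqrt (2 * pi * s\<^sup>2) * normal_density b s x = exp (- a * (x - b)\<^sup>2)" for x
    using s assms by (simp add: normal_density_def)
  moreover have "sqrt (2 * pi * s\<^sup>2) * 1 = sqrt (pi / a)"
    using s by simp
  ultimately show ?thesis by simp
qed

text \<open>Completing the square in the real part separates the variables; the remaining
  coefficient \<open>d\<close> satisfies \<open>a * d = a * c - b\<^sup>2\<close>. The integrand is
  positive, so the nonnegative integral yields integrability and value together.\<close>

lemma has_bochner_integral_gaussian_complex:
  fixes a b c :: real
  assumes "a > 0" "a * c - b\<^sup>2 > 0"
  shows "has_bochner_integral lborel
     (\<lambda>z. exp (- (a * (Re z)\<^sup>2 + 2 * b * Re z * Im z + c * (Im z)\<^sup>2))) (pi / sqrt (a * c - b\<^sup>2))"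
proof (rule has_bochner_integral_nn_integral)
  define d where "d = c - b\<^sup>2 / a"
  have d: "d > 0" "a * d = a * c - b\<^sup>2"
    using assms by (auto simp: d_def field_simps)
  have [measurable]: "(\<lambda>(x, y). Complex x y) \<in> borel_measurable (lborel \<Otimes>\<^sub>M lborel)"
    unfolding Complex_eq by measurable
  let ?q = "\<lambda>x y. a * x\<^sup>2 + 2 * b * x * y + c * y\<^sup>2"
  have *: "exp (- ?q x y) = exp (- a * (x - (- b * y / a))\<^sup>2) * exp (- d * (y - 0)\<^sup>2)" for x y
    using assms(1) by (simp add: d_def exp_add[symmetric] field_simps power2_eq_square)
  have g: "(\<integral>\<^sup>+x. ennreal (exp (- k * (x - m)\<^sup>2)) \<partial>lborel) = ennreal (sqrt (pi / k))" if "k > 0" for k m :: real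
    using has_bochner_integral_gaussian[OF that, of m]
    by (subst nn_integral_eq_integral) (auto simp: has_bochner_integral_iff)
  have "(\<integral>\<^sup>+z. ennreal (exp (- ?q (Re z) (Im z))) \<partial>lborel)
      = (\<integral>\<^sup>+(x, y). ennreal (exp (- ?q x y)) \<partial>(lborel \<Otimes>\<^sub>M lborel))"
    by (subst lborel_complex_eq_distr, subst nn_integral_distr) (auto simp: case_prod_unfold)
  also have "\<dots> = (\<integral>\<^sup>+y. \<integral>\<^sup>+x. ennreal (exp (- ?q x y)) \<partial>lborel \<partial>lborel)"
    by (subst lborel_pair.nn_integral_snd[symmetric]) auto
  also have "\<dots> = (\<integral>\<^sup>+y. ennreal (sqrt (pi / a)) * ennreal (exp (- d * (y - 0)\<^sup>2)) \<partial>lborel)"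
  proof (rule nn_integral_cong)
    fix y :: real
    have "(\<integral>\<^sup>+x. ennreal (exp (- ?q x y)) \<partial>lborel)
        = (\<integral>\<^sup>+x. ennreal (exp (- a * (x - (- b * y / a))\<^sup>2)) * ennreal (exp (- d * (y - 0)\<^sup>2)) \<partial>lborel)"
      unfolding * by (simp add: ennreal_mult)
    also have "\<dots> = (\<integral>\<^sup>+x. ennreal (exp (- a * (x - (- b * y / a))\<^sup>2)) \<partial>lborel) * ennreal (exp (- d * (y - 0)\<^sup>2))"
      by (rule nn_integral_multc) measurable
    also have "\<dots> = ennreal (sqrt (pi / a)) * ennreal (exp (- d * (y - 0)\<^sup>2))"
      by (simp only: g[OF assms(1)])
    finally show "(\<integral>\<^sup>+x. ennreal (exp (- ?q x y)) \<partial>lborel) = \<dots>" .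
  qed
  also have "\<dots> = ennreal (sqrt (pi / a)) * (\<integral>\<^sup>+y. ennreal (exp (- d * (y - 0)\<^sup>2)) \<partial>lborel)"
    by (rule nn_integral_cmult) measurable
  also have "\<dots> = ennreal (sqrt (pi / a)) * ennreal (sqrt (pi / d))"
    by (simp only: g[OF d(1)])
  also have "\<dots> = ennreal (pi / sqrt (a * c - b\<^sup>2))"
    using d assms by (simp add: ennreal_mult'[symmetric] real_sqrt_mult[symmetric] real_sqrt_divide d(2)[symmetric])
  finally show "(\<integral>\<^sup>+z. ennreal (exp (- ?q (Re z) (Im z))) \<partial>lborel) = ennreal (pi / sqrt (a * c - b\<^sup>2))" .
qed (use assms in auto)

lemma lborel_has_bochner_integral_translate:
  fixes f :: "'a::euclidean_space \<Rightarrow> 'b::{banach, second_countable_topology}"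
  assumes "has_bochner_integral lborel f x"
  shows "has_bochner_integral lborel (\<lambda>z. f (c + z)) x"
proof -
  have "f \<in> borel_measurable lborel"
    using assms by (auto simp: has_bochner_integral_iff)
  then have [measurable]: "f \<in> borel_measurable borel"
    by simp
  have "has_bochner_integral (distr lborel borel ((+) c)) f x"
    using assms by (simp add: lborel_distr_plus)
  then show ?thesis
    by (simp add: has_bochner_integral_iff integral_distr integrable_distr_eq)
qed

text \<open>Integrate \<open>F' (z + s *\<^sub>R v)\<close> over \<open>s\<close> in the unit
  interval and over all \<open>z\<close>. Taking \<open>s\<close> first gives the integral of
  \<open>F (z + v) - F z\<close>, which is 0 by translation invariance; taking \<open>z\<close>
  first gives the integral of \<open>F'\<close>. Translation invariance thus replaces boundary terms
  in the integration by parts.\<close>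

lemma integral_directional_derivative_eq_0:
  fixes F F' :: "'a::euclidean_space \<Rightarrow> 'b::euclidean_space"
  assumes F: "integrable lborel F" and F': "integrable lborel F'" and cont: "continuous_on UNIV F'"
    and deriv0: "\<And>z. ((\<lambda>s. F (z + s *\<^sub>R v)) has_vector_derivative F' z) (at 0)"
  shows "integral\<^sup>L lborel F' = 0"
proof -
  have deriv: "((\<lambda>s. F (z + s *\<^sub>R v)) has_vector_derivative F' (z + s *\<^sub>R v)) (at s)" for z s
  proof -
    have "((\<lambda>x. F (z + s *\<^sub>R v + x *\<^sub>R v)) \<circ> (\<lambda>x. x - s) has_vector_derivative 1 *\<^sub>R F' (z + s *\<^sub>R v)) (at s)"
    proof (rule vector_diff_chain_at)
      show "((\<lambda>x. x - s) has_vector_derivative 1) (at s)"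
        by (auto intro!: derivative_eq_intros)
      show "((\<lambda>x. F (z + s *\<^sub>R v + x *\<^sub>R v)) has_vector_derivative F' (z + s *\<^sub>R v)) (at (s - s))"
        using deriv0[of "z + s *\<^sub>R v"] by simp
    qed
    moreover have "(\<lambda>x. F (z + s *\<^sub>R v + x *\<^sub>R v)) \<circ> (\<lambda>x. x - s) = (\<lambda>x. F (z + x *\<^sub>R v))"
      by (rule ext) (simp add: scaleR_left_diff_distrib)
    ultimately show ?thesis by simp
  qed
  have tr: "integrable lborel (\<lambda>z. G (z + c))" "integral\<^sup>L lborel (\<lambda>z. G (z + c)) = integral\<^sup>L lborel G"
    if "integrable lborel G" for G :: "'a \<Rightarrow> 'c::{banach, second_countable_topology}" and c
    using lborel_has_bochner_integral_translate[of G _ c] that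
    by (auto simp: has_bochner_integral_iff add.commute)
  let ?G = "\<lambda>(s::real) z. indicator {0..1} s *\<^sub>R F' (z + s *\<^sub>R v)"
  have int: "integrable (lborel \<Otimes>\<^sub>M lborel) (case_prod ?G)"
  proof (rule lborel_pair.Fubini_integrable)
    \<comment> \<open>By translation invariance this norm integral is the same for every
      \<open>s\<close> in the unit interval.\<close>
    have eq: "(\<integral>z. norm (case (s, z) of (s, z) \<Rightarrow> ?G s z) \<partial>lborel) = indicator {0..1} s * (\<integral>z. norm (F' z) \<partial>lborel)" for s :: real
      using tr(2)[OF integrable_norm[OF F'], of "s *\<^sub>R v"] by simp
    show "integrable lborel (\<lambda>s::real. \<integral>z. norm (case (s, z) of (s, z) \<Rightarrow> ?G s z) \<partial>lborel)"
      unfolding eq by (intro integrable_mult_left integrable_real_indicator) simp_all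
    show "AE s in lborel. integrable lborel (\<lambda>z. case (s, z) of (s, z) \<Rightarrow> ?G s z)"
      using tr(1)[of F'] F' by auto
    have "continuous_on UNIV (\<lambda>p. F' (snd p + fst p *\<^sub>R v))"
      by (intro continuous_on_compose2[OF cont] continuous_intros) auto
    then have "(\<lambda>p. F' (snd p + fst p *\<^sub>R v)) \<in> borel_measurable (borel \<Otimes>\<^sub>M borel)"
      unfolding borel_prod by (rule borel_measurable_continuous_onI)
    moreover have "(\<lambda>p. indicator {0..1} (fst p)) \<in> borel_measurable (borel \<Otimes>\<^sub>M borel :: (real \<times> 'a) measure)"
      by (rule measurable_compose[OF measurable_fst]) simp
    ultimately have "(\<lambda>p. indicator {0..1} (fst p) *\<^sub>R F' (snd p + fst p *\<^sub>R v)) \<in> borel_measurable (borel \<Otimes>\<^sub>M borel)"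
      by (intro borel_measurable_scaleR)
    then show "case_prod ?G \<in> borel_measurable (lborel \<Otimes>\<^sub>M lborel)"
      unfolding case_prod_unfold by (subst measurable_cong_sets[OF sets_pair_measure_cong refl]) simp_all
  qed
  have "(\<integral>s. ?G s z \<partial>lborel) = F (z + v) - F z" for z
  proof -
    have "(\<integral>s. indicator {0..1} s *\<^sub>R F' (z + s *\<^sub>R v) \<partial>lborel) = F (z + 1 *\<^sub>R v) - F (z + 0 *\<^sub>R v)"
    proof (rule integral_FTC_atLeastAtMost)
      show "((\<lambda>s. F (z + s *\<^sub>R v)) has_vector_derivative F' (z + s *\<^sub>R v)) (at s within {0..1})" for s
        by (rule has_vector_derivative_at_within[OF deriv])
      show "continuous_on {0..1} (\<lambda>s. F' (z + s *\<^sub>R v))"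
        by (rule continuous_on_compose2[OF cont]) (auto intro!: continuous_intros)
    qed simp
    then show ?thesis by simp
  qed
  then have "(\<integral>z. \<integral>s. ?G s z \<partial>lborel \<partial>lborel) = (\<integral>z. F (z + v) - F z \<partial>lborel)"
    by simp
  also have "\<dots> = 0"
    using tr[of F v] F by simp
  finally have "(\<integral>s. \<integral>z. ?G s z \<partial>lborel \<partial>lborel) = 0"
    using lborel_pair.Fubini_integral[OF int] by simp
  moreover have "(\<integral>s. \<integral>z. ?G s z \<partial>lborel \<partial>lborel) = (\<integral>s. indicator {0..1::real} s *\<^sub>R integral\<^sup>L lborel F' \<partial>lborel)"
    using tr(2)[OF F'] by simp
  ultimately show ?thesis
    by simp
qed

section \<open>Polynomials against a Gaussian weight\<close>

lemma poly_le_exp_square: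
  fixes p :: "complex poly"
  assumes "e > 0"
  shows "\<exists>C\<ge>0. \<forall>z. norm (poly p z) \<le> C * exp (e * (norm z)\<^sup>2)"
  using assms
proof (induction p arbitrary: e)
  case 0
  then show ?case by (auto intro: exI[of _ 0])
next
  case (pCons a p)
  obtain C where C: "C \<ge> 0" "\<And>z. norm (poly p z) \<le> C * exp (e / 2 * (norm z)\<^sup>2)"
    using pCons.IH[of "e / 2"] pCons.prems by auto
  \<comment> \<open>Half of the exponent is kept for the inductive bound, the other half pays for
    the extra factor \<open>z\<close>; \<open>K\<close> is large enough for
    \<open>1 + x\<^sup>2 \<le> K * (1 + e / 2 * x\<^sup>2)\<close>.\<close>
  define K where "K = 1 + 2 / e"
  have *: "norm z \<le> K * exp (e / 2 * (norm z)\<^sup>2)" for z :: complex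
  proof -
    have "2 * norm z \<le> 1 + (norm z)\<^sup>2"
      using sum_squares_bound[of 1 "norm z"] by simp
    then have "norm z \<le> 1 + (norm z)\<^sup>2"
      using norm_ge_zero[of z] by linarith
    also have "\<dots> \<le> K * (1 + e / 2 * (norm z)\<^sup>2)"
      using pCons.prems by (simp add: K_def field_simps)
    also have "\<dots> \<le> K * exp (e / 2 * (norm z)\<^sup>2)"
      using pCons.prems by (intro mult_left_mono exp_ge_add_one_self) (auto simp: K_def)
    finally show ?thesis .
  qed
  have "norm (poly (pCons a p) z) \<le> (norm a + K * C) * exp (e * (norm z)\<^sup>2)" for z
  proof -
    have "norm (poly (pCons a p) z) \<le> norm a + norm z * norm (poly p z)"
      by (simp add: norm_triangle_le norm_mult)
    also have "\<dots> \<le> norm a * exp (e * (norm z)\<^sup>2)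
        + (K * exp (e / 2 * (norm z)\<^sup>2)) * (C * exp (e / 2 * (norm z)\<^sup>2))"
      using pCons.prems C *[of z] by (intro add_mono mult_mono order_trans[OF norm_ge_zero *[of z]])
        (auto simp: mult_le_cancel_left1)
    also have "\<dots> = (norm a + K * C) * exp (e * (norm z)\<^sup>2)"
      by (simp add: algebra_simps flip: exp_add)
    finally show ?thesis .
  qed
  moreover have "norm a + K * C \<ge> 0"
    using C pCons.prems by (auto simp: K_def)
  ultimately show ?case by blast
qed

text \<open>With \<open>N = n / t0\<close> and \<open>T = 2 * t2\<close> this is
  \<open>exp (- n * V)\<close> around the centre of the ellipse, up to a constant factor.\<close>

definition gaussian_weight :: "real \<Rightarrow> complex \<Rightarrow> complex \<Rightarrow> real" where
  "gaussian_weight N T u = exp (- N * ((cmod u)\<^sup>2 - Re (T * u\<^sup>2)))"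

lemma gaussian_weight_quadratic_form:
  "gaussian_weight N T u =
     exp (- (N * (1 - Re T) * (Re u)\<^sup>2 + 2 * (N * Im T) * Re u * Im u + N * (1 + Re T) * (Im u)\<^sup>2))"
  unfolding gaussian_weight_def cmod_power2 by (simp add: power2_eq_square algebra_simps)

lemma has_bochner_integral_gaussian_weight:
  assumes "N > 0" "cmod T < 1"
  shows "has_bochner_integral lborel (gaussian_weight N T) (pi / (N * sqrt (1 - (cmod T)\<^sup>2)))"
proof -
  have "\<bar>Re T\<bar> < 1"
    using abs_Re_le_cmod[of T] assms by linarith
  then have 1: "N * (1 - Re T) > 0"
    using assms by simp
  have eq: "N * (1 - Re T) * (N * (1 + Re T)) - (N * Im T)\<^sup>2 = N\<^sup>2 * (1 - (cmod T)\<^sup>2)"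
    unfolding cmod_power2 by (simp add: power2_eq_square algebra_simps)
  have "(cmod T)\<^sup>2 < 1"
    using assms by (simp add: abs_square_less_1)
  then have 2: "N * (1 - Re T) * (N * (1 + Re T)) - (N * Im T)\<^sup>2 > 0"
    unfolding eq using assms by simp
  from has_bochner_integral_gaussian_complex[OF 1 2] show ?thesis
    unfolding eq gaussian_weight_quadratic_form[abs_def] using assms
    by (simp add: real_sqrt_mult)
qed

lemma gaussian_weight_bound:
  assumes "N > 0"
  shows "gaussian_weight N T u \<le> exp (- (N * (1 - cmod T)) * (cmod u)\<^sup>2)"
proof -
  have "Re (T * u\<^sup>2) \<le> cmod T * (cmod u)\<^sup>2"
    using complex_Re_le_cmod[of "T * u\<^sup>2"] by (simp add: norm_mult norm_power)
  then show ?thesis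
    using mult_left_mono[of "(1 - cmod T) * (cmod u)\<^sup>2" "(cmod u)\<^sup>2 - Re (T * u\<^sup>2)" N] assms
    by (simp add: gaussian_weight_def left_diff_distrib mult.assoc)
qed

lemma continuous_on_gaussian_weight: "continuous_on A (gaussian_weight N T)"
  unfolding gaussian_weight_def by (intro continuous_intros)

text \<open>The weight decays at rate \<open>c = N * (1 - cmod T)\<close>. Each polynomial consumes
  a quarter of it, which leaves an integrable Gaussian of rate \<open>c / 2\<close>.\<close>

lemma integrable_poly_gaussian_weight:
  fixes f g :: "complex poly"
  assumes "N > 0" "cmod T < 1"
  shows "integrable lborel (\<lambda>u. cnj (poly f u) * poly g u * complex_of_real (gaussian_weight N T u))"
proof -
  define c where "c = N * (1 - cmod T)"
  have c: "c > 0" using assms by (simp add: c_def)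
  obtain C1 where C1: "C1 \<ge> 0" "\<And>u. cmod (poly f u) \<le> C1 * exp (c / 4 * (cmod u)\<^sup>2)"
    using poly_le_exp_square[of "c / 4" f] c by auto
  obtain C2 where C2: "C2 \<ge> 0" "\<And>u. cmod (poly g u) \<le> C2 * exp (c / 4 * (cmod u)\<^sup>2)"
    using poly_le_exp_square[of "c / 4" g] c by auto
  have dom: "integrable lborel (\<lambda>u. C1 * C2 * gaussian_weight (c / 2) 0 u)"
    using has_bochner_integral_gaussian_weight[of "c / 2" 0] c by (auto simp: has_bochner_integral_iff)
  show ?thesis
  proof (rule Bochner_Integration.integrable_bound[OF dom])
    have "continuous_on UNIV (\<lambda>u. cnj (poly f u) * poly g u * complex_of_real (gaussian_weight N T u))"
      by (intro continuous_intros continuous_on_gaussian_weight)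
    then show "(\<lambda>u. cnj (poly f u) * poly g u * complex_of_real (gaussian_weight N T u)) \<in> borel_measurable lborel"
      by (auto intro: borel_measurable_continuous_onI)
    have "cmod (cnj (poly f u) * poly g u * complex_of_real (gaussian_weight N T u))
        \<le> cmod (C1 * C2 * gaussian_weight (c / 2) 0 u)" for u
    proof -
      have "cmod (cnj (poly f u) * poly g u * complex_of_real (gaussian_weight N T u))
          = cmod (poly f u) * cmod (poly g u) * gaussian_weight N T u"
        by (simp add: norm_mult gaussian_weight_def)
      also have "\<dots> \<le> (C1 * exp (c / 4 * (cmod u)\<^sup>2)) * (C2 * exp (c / 4 * (cmod u)\<^sup>2)) * exp (- c * (cmod u)\<^sup>2)"
        using C1 C2 gaussian_weight_bound[OF assms(1), of T u]
        by (intro mult_mono) (auto simp: c_def gaussian_weight_def)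
      also have "\<dots> = C1 * C2 * (exp (c / 4 * (cmod u)\<^sup>2) * exp (c / 4 * (cmod u)\<^sup>2) * exp (- c * (cmod u)\<^sup>2))"
        by simp
      also have "\<dots> = C1 * C2 * gaussian_weight (c / 2) 0 u"
        unfolding exp_add[symmetric] by (simp add: gaussian_weight_def)
      also have "\<dots> = cmod (C1 * C2 * gaussian_weight (c / 2) 0 u)"
        using C1 C2 by (simp add: norm_mult gaussian_weight_def)
      finally show ?thesis .
    qed
    then show "AE u in lborel. cmod (cnj (poly f u) * poly g u * complex_of_real (gaussian_weight N T u))
        \<le> norm (C1 * C2 * gaussian_weight (c / 2) 0 u)"
      by (intro AE_I2) (simp only: real_norm_def norm_of_real)
  qed
qed

definition gaussian_inner :: "real \<Rightarrow> complex \<Rightarrow> complex poly \<Rightarrow> complex poly \<Rightarrow> complex" where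
  "gaussian_inner N T f g = (\<integral>u. cnj (poly f u) * poly g u * complex_of_real (gaussian_weight N T u) \<partial>lborel)"

lemma gaussian_inner_cnj: "cnj (gaussian_inner N T f g) = gaussian_inner N T g f"
  unfolding gaussian_inner_def Bochner_Integration.integral_cnj[symmetric]
  by (rule Bochner_Integration.integral_cong) (auto simp: mult_ac)

lemma gaussian_inner_diff_right:
  assumes "N > 0" "cmod T < 1"
  shows "gaussian_inner N T f (g - h) = gaussian_inner N T f g - gaussian_inner N T f h"
  unfolding gaussian_inner_def poly_diff ring_distribs
  by (intro Bochner_Integration.integral_diff integrable_poly_gaussian_weight assms)+

lemma gaussian_inner_smult_right: "gaussian_inner N T f (smult c g) = c * gaussian_inner N T f g"
  unfolding gaussian_inner_def integral_mult_right_zero[symmetric]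
  by (rule Bochner_Integration.integral_cong) auto

lemma gaussian_inner_smult_left: "gaussian_inner N T (smult c f) g = cnj c * gaussian_inner N T f g"
  unfolding gaussian_inner_def integral_mult_right_zero[symmetric]
  by (rule Bochner_Integration.integral_cong) auto

section \<open>Hermite polynomials for the Gaussian weight\<close>

text \<open>The integral of the \<open>\<partial>/\<partial>\<zbar>\<close>-derivative of \<open>cnj g * f * weight\<close> vanishes.\<close>

lemma gaussian_inner_pderiv_left:
  assumes "N > 0" "cmod T < 1"
  shows "gaussian_inner N T (pderiv g) f =
     N * (gaussian_inner N T g (pCons 0 f) - cnj T * gaussian_inner N T (pCons 0 g) f)"
proof -
  note int = integrable_poly_gaussian_weight[OF assms]
  define W where "W = (\<lambda>u. complex_of_real (gaussian_weight N T u))"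
  \<comment> \<open>\<open>q v u\<close> is the derivative of
    \<open>(cmod u)\<^sup>2 - Re (T * u\<^sup>2)\<close> in direction \<open>v\<close>;
    \<open>F'\<close> is the resulting derivative of \<open>F\<close>.\<close>
  define q where "q = (\<lambda>v u. 2 * Re (u * cnj v) - 2 * Re (T * u * v))"
  define F where "F = (\<lambda>u. cnj (poly g u) * poly f u * W u)"
  define F' where "F' = (\<lambda>v u. cnj (poly (pderiv g) u * v) * poly f u * W u + cnj (poly g u) * (poly (pderiv f) u * v) * W u
     + cnj (poly g u) * poly f u * (complex_of_real (- N * q v u) * W u))"
  have W: "((\<lambda>s. W (u + s *\<^sub>R v)) has_vector_derivative complex_of_real (- N * q v u) * W u) (at 0)" for u v
  proof -
    have eq: "gaussian_weight N T (u + s *\<^sub>R v)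
        = exp (- N * ((cmod u)\<^sup>2 - Re (T * u\<^sup>2) + q v u * s + ((cmod v)\<^sup>2 - Re (T * v\<^sup>2)) * s\<^sup>2))" for s
      unfolding gaussian_weight_def q_def cmod_power2 by (simp add: power2_eq_square algebra_simps)
    have "((\<lambda>s. gaussian_weight N T (u + s *\<^sub>R v)) has_real_derivative (- N * q v u) * gaussian_weight N T u) (at 0)"
      unfolding eq by (auto intro!: derivative_eq_intros simp: gaussian_weight_def)
    then show ?thesis
      unfolding W_def of_real_mult[symmetric]
      by (intro has_vector_derivative_of_real) (simp add: has_real_derivative_iff_has_vector_derivative)
  qed
  have P: "((\<lambda>s. poly p (u + s *\<^sub>R v)) has_vector_derivative poly (pderiv p) u * v) (at 0)" for p and u v :: complex
  proof -
    have "((\<lambda>s::real. u + s *\<^sub>R v) has_vector_derivative v) (at 0)"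
      by (auto intro!: derivative_eq_intros)
    moreover have "(poly p has_field_derivative poly (pderiv p) (u + 0 *\<^sub>R v)) (at (u + (0::real) *\<^sub>R v))"
      by (rule poly_DERIV)
    ultimately have "((poly p \<circ> (\<lambda>s::real. u + s *\<^sub>R v)) has_vector_derivative v * poly (pderiv p) (u + 0 *\<^sub>R v)) (at 0)"
      by (rule field_vector_diff_chain_at)
    then show ?thesis by (simp add: o_def mult.commute)
  qed
  have cP: "((\<lambda>s. cnj (poly p (u + s *\<^sub>R v))) has_vector_derivative cnj (poly (pderiv p) u * v)) (at 0)" for p and u v :: complex
    using bounded_linear.has_vector_derivative[OF bounded_linear_cnj P] .
  have F: "((\<lambda>s. F (u + s *\<^sub>R v)) has_vector_derivative F' v u) (at 0)" for u v
    using has_vector_derivative_mult[OF has_vector_derivative_mult[OF cP[of g u v] P[of f u v]] W[of u v]]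
    unfolding F_def F'_def by (simp add: algebra_simps)
  let ?X = "\<lambda>p. pCons 0 p"
  have F'_eq: "F' v u = cnj v * (cnj (poly (pderiv g) u) * poly f u * W u) + v * (cnj (poly g u) * poly (pderiv f) u * W u)
     - N * (cnj v * (cnj (poly g u) * poly (?X f) u * W u) + v * (cnj (poly (?X g) u) * poly f u * W u)
     - T * v * (cnj (poly g u) * poly (?X f) u * W u) - cnj (T * v) * (cnj (poly (?X g) u) * poly f u * W u))" for v u
  proof -
    have "complex_of_real (q v u) = u * cnj v + cnj u * v - T * u * v - cnj (T * u * v)"
      unfolding q_def using complex_add_cnj[of "u * cnj v"] complex_add_cnj[of "T * u * v"]
      by (simp add: algebra_simps)
    then have Nq: "complex_of_real (- N * q v u) = - of_real N * (u * cnj v + cnj u * v - T * u * v - cnj (T * u * v))"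
      by simp
    show ?thesis unfolding F'_def Nq by (simp add: algebra_simps)
  qed
  have "integral\<^sup>L lborel (F' v) = 0" for v
  proof (rule integral_directional_derivative_eq_0[OF _ _ _ F])
    show "integrable lborel F"
      unfolding F_def W_def by (rule int)
    show "integrable lborel (F' v)"
      unfolding F'_eq W_def by (intro Bochner_Integration.integrable_add Bochner_Integration.integrable_diff integrable_mult_right int)
    show "continuous_on UNIV (F' v)"
      unfolding F'_eq W_def by (intro continuous_intros continuous_on_gaussian_weight)
  qed
  moreover have "integral\<^sup>L lborel (F' v) = cnj v * gaussian_inner N T (pderiv g) f + v * gaussian_inner N T g (pderiv f)
     - N * (cnj v * gaussian_inner N T g (?X f) + v * gaussian_inner N T (?X g) f
       - T * v * gaussian_inner N T g (?X f) - cnj (T * v) * gaussian_inner N T (?X g) f)" for v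
    unfolding F'_eq W_def gaussian_inner_def
    by (simp only: Bochner_Integration.integral_add Bochner_Integration.integral_diff integral_mult_right_zero
        Bochner_Integration.integrable_add Bochner_Integration.integrable_diff integrable_mult_right int)
  ultimately have eq: "cnj v * gaussian_inner N T (pderiv g) f + v * gaussian_inner N T g (pderiv f)
     - N * (cnj v * gaussian_inner N T g (?X f) + v * gaussian_inner N T (?X g) f
       - T * v * gaussian_inner N T g (?X f) - cnj (T * v) * gaussian_inner N T (?X g) f) = 0" for v
    by metis
  define A B G P where "A = gaussian_inner N T g (?X f)" and "B = gaussian_inner N T (?X g) f"
    and "G = gaussian_inner N T (pderiv g) f" and "P = gaussian_inner N T g (pderiv f)"
  have "G + P - N * (A + B - T * A - cnj T * B) = 0"
    using eq[of 1] by (simp add: A_def B_def G_def P_def)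
  moreover have "G - P - N * (A - B + T * A - cnj T * B) = 0"
  proof -
    \<comment> \<open>Multiplying the identity for direction \<open>\<i>\<close> by
      \<open>\<i>\<close> reverses the sign of \<open>P\<close>. Adding the identity for direction 1
      then eliminates \<open>P\<close>, which is the passage from two real derivatives to the
      antiholomorphic one.\<close>
    have *: "G - P - M * (A - B + T * A - T' * B) = 0"
      if "(- j) * G + j * P - M * ((- j) * A + j * B - T * j * A - (T' * (- j)) * B) = 0" "j * j = - 1" for j M T'
      using that by algebra
    show ?thesis
      using eq[of \<i>] by (intro *[of \<i>]) (simp_all add: A_def B_def G_def P_def)
  qed
  ultimately have "2 * G = 2 * (N * (A - cnj T * B))"
    by algebra
  then show ?thesis by (simp add: A_def B_def G_def)
qed

definition raise_op :: "real \<Rightarrow> complex \<Rightarrow> complex poly \<Rightarrow> complex poly" where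
  "raise_op N T f = smult (of_real (N * (1 - (cmod T)\<^sup>2))) (pCons 0 f) - smult (cnj T) (pderiv f)"

text \<open>The formula for \<open>pderiv\<close> on the left still contains \<open>g\<close>
  multiplied by the variable. Its conjugate with \<open>f\<close> and \<open>g\<close> exchanged
  expresses that term through \<open>pderiv f\<close>; eliminating it produces the factor
  \<open>1 - (cmod T)\<^sup>2\<close>.\<close>

lemma gaussian_inner_raise_op:
  assumes "N > 0" "cmod T < 1"
  shows "gaussian_inner N T g (raise_op N T f) = gaussian_inner N T (pderiv g) f"
proof -
  define A B G P where "A = gaussian_inner N T g (pCons 0 f)" and "B = gaussian_inner N T (pCons 0 g) f"
    and "G = gaussian_inner N T (pderiv g) f" and "P = gaussian_inner N T g (pderiv f)"
  have "G = N * (A - cnj T * B)"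
    using gaussian_inner_pderiv_left[OF assms] by (simp add: A_def B_def G_def)
  moreover have "P = N * (B - T * A)"
    using arg_cong[OF gaussian_inner_pderiv_left[OF assms, of f g], of cnj]
    by (simp add: gaussian_inner_cnj A_def B_def P_def)
  ultimately have "N * (1 - cnj T * T) * A - cnj T * P = G"
    by algebra
  moreover have "of_real (N * (1 - (cmod T)\<^sup>2)) = of_real N * (1 - cnj T * T)"
    unfolding of_real_mult of_real_diff complex_norm_square by (simp add: mult.commute)
  ultimately show ?thesis
    unfolding raise_op_def gaussian_inner_diff_right[OF assms] gaussian_inner_smult_right
    by (simp only: A_def G_def P_def)
qed

primrec hermite_poly :: "real \<Rightarrow> complex \<Rightarrow> nat \<Rightarrow> complex poly" where
  "hermite_poly N T 0 = 1"
| "hermite_poly N T (Suc k) = raise_op N T (hermite_poly N T k)"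

text \<open>The commutator of differentiation and \<open>raise_op\<close> is multiplication by
  \<open>N * (1 - (cmod T)\<^sup>2)\<close>, so each application of \<open>raise_op\<close> adds one
  to the factor, as for creation and annihilation operators.\<close>

lemma pderiv_hermite_poly:
  "pderiv (hermite_poly N T (Suc k)) = smult (of_real (N * (1 - (cmod T)\<^sup>2)) * of_nat (Suc k)) (hermite_poly N T k)"
proof (induction k)
  case 0
  show ?case by (simp add: raise_op_def pderiv_pCons)
next
  case (Suc k)
  define b where "b = complex_of_real (N * (1 - (cmod T)\<^sup>2))"
  define Q where "Q = hermite_poly N T (Suc k)"
  have IH: "pderiv Q = smult (b * of_nat (Suc k)) (hermite_poly N T k)"
    using Suc by (simp add: b_def Q_def)
  have Q: "Q = smult b (pCons 0 (hermite_poly N T k)) - smult (cnj T) (pderiv (hermite_poly N T k))"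
    by (simp add: Q_def raise_op_def b_def)
  have ro: "raise_op N T f = smult b (pCons 0 f) - smult (cnj T) (pderiv f)" for f
    by (simp only: raise_op_def b_def)
  have "pderiv (raise_op N T Q) = smult b Q + (smult b (pCons 0 (pderiv Q)) - smult (cnj T) (pderiv (pderiv Q)))"
    by (simp add: ro pderiv_diff pderiv_smult pderiv_pCons smult_add_right)
  also have "\<dots> = smult b Q + smult (b * of_nat (Suc k)) Q"
    unfolding IH pderiv_smult by (subst (3) Q) (simp add: smult_diff_right mult_ac)
  also have "\<dots> = smult (b * of_nat (Suc (Suc k))) Q"
    by (simp add: algebra_simps flip: smult_add_left)
  finally show ?case by (simp add: b_def Q_def)
qed

lemma degree_hermite_poly_coeff:
  assumes "N > 0" "cmod T < 1"
  shows "degree (hermite_poly N T k) = k \<and>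
    lead_coeff (hermite_poly N T k) = of_real ((N * (1 - (cmod T)\<^sup>2)) ^ k)"
proof (induction k)
  case (Suc k)
  define b where "b = N * (1 - (cmod T)\<^sup>2)"
  define Q where "Q = hermite_poly N T k"
  have "(cmod T)\<^sup>2 < 1" using assms by (simp add: abs_square_less_1)
  then have b: "b \<noteq> 0" using assms by (simp add: b_def)
  have dQ: "degree Q = k" and lc: "coeff Q k = of_real (b ^ k)"
    using Suc by (auto simp: Q_def b_def)
  have "Q \<noteq> 0" using lc b by auto
  have d1: "degree (smult (of_real b) (pCons 0 Q)) = Suc k"
    using b \<open>Q \<noteq> 0\<close> dQ by simp
  have d2: "degree (smult (cnj T) (pderiv Q)) < Suc k"
    using degree_pderiv[of Q] degree_smult_le[of "cnj T" "pderiv Q"] dQ by linarith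
  have eq: "hermite_poly N T (Suc k) = smult (of_real b) (pCons 0 Q) + (- smult (cnj T) (pderiv Q))"
    by (simp add: raise_op_def b_def Q_def)
  have deg: "degree (hermite_poly N T (Suc k)) = Suc k"
    unfolding eq by (subst degree_add_eq_left) (use d1 d2 in \<open>simp_all add: degree_minus\<close>)
  have "coeff (smult (cnj T) (pderiv Q)) (Suc k) = 0"
    using d2 by (rule coeff_eq_0)
  then have "coeff (hermite_poly N T (Suc k)) (Suc k) = of_real (b ^ Suc k)"
    unfolding eq by (simp add: lc)
  then show ?case using deg by (simp add: b_def)
qed simp

text \<open>Moving one \<open>raise_op\<close> to the other side lowers both indices by one.
  Induction ends at the total mass of the weight, or at an inner product with the constant
  1.\<close>

lemma gaussian_inner_hermite_poly:
  assumes "N > 0" "cmod T < 1"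
  shows "gaussian_inner N T (hermite_poly N T j) (hermite_poly N T k) =
    (if j = k then of_real (fact k * (N * (1 - (cmod T)\<^sup>2)) ^ k * (pi / (N * sqrt (1 - (cmod T)\<^sup>2)))) else 0)"
proof -
  define b where "b = N * (1 - (cmod T)\<^sup>2)"
  define c where "c = pi / (N * sqrt (1 - (cmod T)\<^sup>2))"
  have c: "gaussian_inner N T 1 1 = of_real c"
    using has_bochner_integral_of_real[OF has_bochner_integral_gaussian_weight[OF assms], where 'a = complex]
    by (simp add: gaussian_inner_def c_def has_bochner_integral_iff)
  \<comment> \<open>The adjoint turns this into an inner product with the derivative of a
    constant.\<close>
  have r0: "gaussian_inner N T 1 (hermite_poly N T (Suc k)) = 0" for k
    by (simp add: gaussian_inner_raise_op[OF assms]) (simp add: gaussian_inner_def)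
  have l0: "gaussian_inner N T (hermite_poly N T (Suc k)) 1 = 0" for k
    using arg_cong[OF r0[of k], of cnj] unfolding gaussian_inner_cnj by simp
  have "gaussian_inner N T (hermite_poly N T j) (hermite_poly N T k) = (if j = k then of_real (fact k * b ^ k * c) else 0)"
  proof (induction k arbitrary: j)
    case 0
    then show ?case using c l0 by (cases j) auto
  next
    case (Suc k)
    show ?case
    proof (cases j)
      case (Suc i)
      have "gaussian_inner N T (hermite_poly N T j) (hermite_poly N T (Suc k))
          = gaussian_inner N T (pderiv (hermite_poly N T (Suc i))) (hermite_poly N T k)"
        unfolding Suc hermite_poly.simps(2)[of N T k] gaussian_inner_raise_op[OF assms] ..
      also have "\<dots> = of_real b * of_nat (Suc i) * gaussian_inner N T (hermite_poly N T i) (hermite_poly N T k)"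
        unfolding pderiv_hermite_poly gaussian_inner_smult_left by (simp add: b_def)
      finally show ?thesis
        using Suc.IH[of i] Suc by (auto simp: mult_ac simp del: hermite_poly.simps)
    qed (use r0 in auto)
  qed
  then show ?thesis by (simp add: b_def c_def)
qed

section \<open>Uniqueness of orthonormal polynomials\<close>

lemma degree_eq_basis:
  fixes p :: "nat \<Rightarrow> 'a::field poly"
  assumes "\<And>k. degree (p k) = k" "\<And>k. p k \<noteq> 0" "degree f \<le> k"
  shows "\<exists>c. f = (\<Sum>j\<le>k. smult (c j) (p j))"
  using assms(3)
proof (induction k arbitrary: f)
  case 0
  obtain a b where "f = [:a:]" "p 0 = [:b:]" "b \<noteq> 0"
    using 0 assms(1,2)[of 0] by (metis degree_0_id le_zero_eq pCons_0_0 coeff_pCons_0)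
  then have "f = smult (a / b) (p 0)" by simp
  then show ?case by auto
next
  case (Suc k)
  define a where "a = coeff f (Suc k) / coeff (p (Suc k)) (Suc k)"
  have nz: "coeff (p (Suc k)) (Suc k) \<noteq> 0"
    using assms(1,2)[of "Suc k"] by (metis leading_coeff_0_iff)
  have "degree (f - smult a (p (Suc k))) \<le> k"
  proof (rule degree_le, intro allI impI)
    fix i assume "i > k"
    show "coeff (f - smult a (p (Suc k))) i = 0"
    proof (cases "i = Suc k")
      case False
      then have "i > Suc k" using \<open>i > k\<close> by simp
      then have "coeff f i = 0" "coeff (p (Suc k)) i = 0"
        using Suc.prems assms(1)[of "Suc k"] by (auto intro!: coeff_eq_0)
      then show ?thesis by simp
    qed (use nz in \<open>simp add: a_def\<close>)
  qed
  from Suc.IH[OF this] obtain c where c: "f - smult a (p (Suc k)) = (\<Sum>j\<le>k. smult (c j) (p j))" ..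
  have "f = (\<Sum>j\<le>Suc k. smult ((c(Suc k := a)) j) (p j))"
    using c by (simp add: algebra_simps)
  then show ?case by blast
qed

text \<open>This is what gives meaning to the definite description in
  \<open>orthonormal_poly\<close>. The argument works with linear combinations of the prescribed
  integrals only, because for a general \<open>V\<close> these are the only ones known to
  exist.\<close>

lemma orthonormal_polys_unique:
  assumes p: "orthonormal_polys n V p" and q: "orthonormal_polys n V q"
  shows "p = q"
proof
  fix k
  define I where "I = (\<lambda>f g :: complex poly. \<lambda>x. has_bochner_integral lborel
        (\<lambda>z. cnj (poly f z) * poly g z * complex_of_real (exp (- (real n * V z)))) x)"
  have deg: "degree (p k) = k" "degree (q k) = k"
    and lc: "0 < Re (lead_coeff (p k))" "0 < Re (lead_coeff (q k))"
    and re: "lead_coeff (p k) \<in> \<real>" "lead_coeff (q k) \<in> \<real>"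
    and I: "I (p j) (p k) (if j = k then 1 else 0)" "I (q j) (q k) (if j = k then 1 else 0)" for j k
    using p q unfolding orthonormal_polys_def I_def by (blast, blast, blast, blast, blast, blast, blast, blast)
  have nz: "p k \<noteq> 0" "q k \<noteq> 0" for k
    using lc[of k] by auto
  have sum_r: "I f (\<Sum>j\<in>A. smult (c j) (g j)) (\<Sum>j\<in>A. c j * x j)"
    if "\<And>j. j \<in> A \<Longrightarrow> I f (g j) (x j)" for f g c x and A :: "nat set"
  proof -
    have "has_bochner_integral lborel (\<lambda>z. \<Sum>j\<in>A. c j * (cnj (poly f z) * poly (g j) z * complex_of_real (exp (- (real n * V z)))))
       (\<Sum>j\<in>A. c j * x j)"
      using that by (intro has_bochner_integral_sum has_bochner_integral_mult_right) (auto simp: I_def)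
    then show ?thesis
      by (simp add: I_def poly_sum sum_distrib_left sum_distrib_right mult_ac)
  qed
  have cnj_I: "I g f (cnj x)" if "I f g x" for f g x
    using has_bochner_integral_cnj[OF that[unfolded I_def]] by (simp add: I_def mult_ac)
  have uniq: "x = y" if "I f g x" "I f g y" for f g x y
    using that has_bochner_integral_eq unfolding I_def by blast
  obtain c where c: "q k = (\<Sum>j\<le>k. smult (c j) (p j))"
    using degree_eq_basis[of p "q k" k] deg nz by auto
  \<comment> \<open>\<open>p j\<close> lies in the span of \<open>q 0\<close>, ...,
    \<open>q j\<close>, all orthogonal to \<open>q k\<close>; on the other hand its product with
    \<open>q k\<close> is the coefficient \<open>c j\<close>.\<close>
  have "c j = 0" if "j < k" for j
  proof -
    obtain d where d: "p j = (\<Sum>i\<le>j. smult (d i) (q i))"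
      using degree_eq_basis[of q "p j" j] deg nz by auto
    have "I (q k) (p j) (\<Sum>i\<le>j. d i * (if k = i then 1 else 0))"
      unfolding d using I by (intro sum_r)
    then have "I (q k) (p j) 0"
      using that by (simp add: sum.neutral)
    from cnj_I[OF this] have "I (p j) (q k) 0" by simp
    moreover have "I (p j) (q k) (\<Sum>i\<le>k. c i * (if j = i then 1 else 0))"
      unfolding c using I by (intro sum_r)
    ultimately have "(\<Sum>i\<le>k. c i * (if j = i then 1 else 0)) = 0"
      using uniq by blast
    then show ?thesis using that by (simp add: if_distrib cong: if_cong)
  qed
  then have qk: "q k = smult (c k) (p k)"
    unfolding c by (subst sum.remove[of _ k]) (auto intro!: sum.neutral)
  have "I (q k) (q k) (c k * cnj (c k))"
  proof -
    have "I (p k) (q k) (c k)"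
      using sum_r[of "{k}" "p k" p "\<lambda>_. 1" c] I[of k k] by (simp add: qk)
    from cnj_I[OF this] have "I (q k) (p k) (cnj (c k))" .
    then have "I (q k) (\<Sum>j\<in>{k}. smult (c j) (p j)) (\<Sum>j\<in>{k}. c j * cnj (c j))"
      by (intro sum_r) simp
    then show ?thesis by (simp add: qk[symmetric])
  qed
  \<comment> \<open>Equal norms make \<open>c k\<close> unimodular, positive leading coefficients
    make it positive, hence it is 1.\<close>
  then have "c k * cnj (c k) = 1"
    using uniq I(2)[of k k] by simp
  then have cm: "cmod (c k) = 1"
    by (metis complex_mod_cnj complex_norm_square norm_one norm_mult of_real_1 of_real_eq_iff power2_eq_square real_sqrt_abs2 real_sqrt_eq_1_iff abs_norm_cancel)
  have "lead_coeff (q k) = c k * lead_coeff (p k)"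
    by (simp add: qk)
  moreover obtain x y where "lead_coeff (p k) = of_real x" "lead_coeff (q k) = of_real y"
    using re[of k] by (auto elim!: Reals_cases)
  moreover from this have "x > 0" "y > 0"
    using lc[of k] by simp_all
  ultimately have "c k = of_real (y / x)" "x > 0" "y > 0"
    by (simp_all add: nonzero_eq_divide_eq mult.commute)
  then have "c k = 1"
    using cm by (simp add: norm_divide)
  then show "p k = q k" by (simp add: qk)
qed

section \<open>The kernel in standard coordinates\<close>

text \<open>\<open>centre\<close> solves the critical point equation
  \<open>cnj v = t1 + 2 * t2 * v\<close>, so the expansion of the potential around it has no linear
  term.\<close>

lemma elliptic_potential_shift:
  assumes "2 * cmod t2 < 1"
  shows "elliptic_potential t0 t1 t2 (centre t1 t2 + u) = elliptic_potential t0 t1 t2 (centre t1 t2)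
     + (1 / t0) * ((cmod u)\<^sup>2 - Re (2 * t2 * u\<^sup>2))"
proof -
  define v where "v = centre t1 t2"
  have "4 * (cmod t2)\<^sup>2 = (2 * cmod t2)\<^sup>2"
    by (simp add: power2_eq_square)
  also have "\<dots> < 1"
    unfolding abs_square_less_1 using assms by simp
  finally have nz: "1 - 4 * (cmod t2)\<^sup>2 \<noteq> 0"
    by simp
  define d where "d = complex_of_real (1 - 4 * (cmod t2)\<^sup>2)"
  have d: "d \<noteq> 0"
    unfolding d_def of_real_eq_0_iff by (rule nz)
  have d2: "d = 1 - 4 * (t2 * cnj t2)"
    unfolding d_def of_real_diff of_real_mult complex_norm_square by simp
  have "v = (cnj t1 + 2 * t1 * cnj t2) / d" "cnj d = d"
    by (simp_all add: v_def centre_def d_def)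
  then have vd: "v * d = cnj t1 + 2 * t1 * cnj t2" "cnj v * d = t1 + 2 * cnj t1 * t2"
    using d by simp_all
  have "(cnj v - t1 - 2 * t2 * v) * d = cnj v * d - t1 * d - 2 * t2 * (v * d)"
    by (simp add: algebra_simps)
  also have "\<dots> = 0"
    unfolding vd unfolding d2 by (simp add: algebra_simps)
  finally have "(cnj v - t1 - 2 * t2 * v) * d = 0" .
  then have crit: "cnj v - t1 - 2 * t2 * v = 0"
    using d by simp
  have "Re (u * (cnj v - t1 - 2 * t2 * v)) = 0"
    by (simp add: crit)
  then have "(cmod (v + u))\<^sup>2 - 2 * Re (t1 * (v + u) + t2 * (v + u)\<^sup>2) =
      (cmod v)\<^sup>2 - 2 * Re (t1 * v + t2 * v\<^sup>2) + ((cmod u)\<^sup>2 - Re (2 * t2 * u\<^sup>2))"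
    unfolding cmod_power2 by (simp add: power2_eq_square algebra_simps)
  then show ?thesis
    by (simp only: elliptic_potential_def v_def distrib_left[of "1 / t0"])
qed

text \<open>\<open>c k\<close> is the squared norm of the shifted Hermite polynomial; its last
  factor is the constant \<open>exp (- n * V)\<close> at the centre. Leading coefficients are
  already positive, so only the normalisation has to be adjusted.\<close>

lemma orthonormal_poly_elliptic_potential:
  fixes t0 :: real and t1 t2 :: complex
  assumes "n > 0" "t0 > 0" "2 * cmod t2 < 1"
  defines "N \<equiv> real n / t0" and "T \<equiv> 2 * t2" and "v \<equiv> centre t1 t2"
  defines "c \<equiv> \<lambda>k. fact k * (N * (1 - (cmod T)\<^sup>2)) ^ k * (pi / (N * sqrt (1 - (cmod T)\<^sup>2)))
     * exp (- (real n * elliptic_potential t0 t1 t2 v))"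
  shows "orthonormal_poly n (elliptic_potential t0 t1 t2) =
     (\<lambda>k. smult (of_real (1 / sqrt (c k))) (pcompose (hermite_poly N T k) [:- v, 1:]))"
proof -
  have NT: "N > 0" "cmod T < 1"
    using assms(1-3) by (auto simp: N_def T_def norm_mult)
  then have "(cmod T)\<^sup>2 < 1"
    by (simp add: abs_square_less_1)
  then have b: "N * (1 - (cmod T)\<^sup>2) > 0" and c: "c k > 0" for k
    using NT by (auto simp: c_def)
  define p where "p = (\<lambda>k. smult (of_real (1 / sqrt (c k))) (pcompose (hermite_poly N T k) [:- v, 1:]))"
  have "orthonormal_polys n (elliptic_potential t0 t1 t2) p"
    unfolding orthonormal_polys_def
  proof (intro conjI allI)
    fix k
    have "degree (p k) = k"
      using c[of k] degree_hermite_poly_coeff[OF NT, of k] by (simp add: p_def degree_pcompose)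
    moreover have "lead_coeff (p k) = of_real (1 / sqrt (c k) * (N * (1 - (cmod T)\<^sup>2)) ^ k)"
      using conjunct2[OF degree_hermite_poly_coeff[OF NT, of k]] unfolding p_def lead_coeff_smult
      by (subst lead_coeff_comp) simp_all
    ultimately show "degree (p k) = k" "lead_coeff (p k) \<in> \<real>" "0 < Re (lead_coeff (p k))"
      using b c[of k] by (simp_all del: of_real_mult of_real_divide of_real_power of_real_diff)
  next
    fix j k
    define E where "E = exp (- (real n * elliptic_potential t0 t1 t2 v))"
    have W: "exp (- (real n * elliptic_potential t0 t1 t2 (v + u))) = E * gaussian_weight N T u" for u
      using elliptic_potential_shift[OF assms(3), of t0 t1 u]
      by (simp add: E_def gaussian_weight_def exp_add[symmetric] v_def N_def T_def field_simps)
    let ?f = "\<lambda>z. cnj (poly (p j) z) * poly (p k) z * complex_of_real (exp (- (real n * elliptic_potential t0 t1 t2 z)))"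
    have f: "?f (v + u) = of_real (E / (sqrt (c j) * sqrt (c k)))
        * (cnj (poly (hermite_poly N T j) u) * poly (hermite_poly N T k) u * complex_of_real (gaussian_weight N T u))" for u
      unfolding W p_def by (simp add: poly_pcompose)
    have "has_bochner_integral lborel (\<lambda>u. ?f (v + u))
       (of_real (E / (sqrt (c j) * sqrt (c k))) * gaussian_inner N T (hermite_poly N T j) (hermite_poly N T k))"
      unfolding f gaussian_inner_def
      by (intro has_bochner_integral_mult_right has_bochner_integral_integrable integrable_poly_gaussian_weight NT)
    also have "of_real (E / (sqrt (c j) * sqrt (c k))) * gaussian_inner N T (hermite_poly N T j) (hermite_poly N T k)
        = (if j = k then 1 else 0)"
    proof (cases "j = k")
      case True
      have "c k = E * (fact k * (N * (1 - (cmod T)\<^sup>2)) ^ k * (pi / (N * sqrt (1 - (cmod T)\<^sup>2))))"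
        by (simp add: c_def E_def)
      moreover have "sqrt (c k) * sqrt (c k) = c k"
        using c[of k] by simp
      moreover have "E / (E * Z) * Z = 1" if "E * Z > 0" for Z
        using that by auto
      ultimately have "E / (sqrt (c k) * sqrt (c k)) * (fact k * (N * (1 - (cmod T)\<^sup>2)) ^ k * (pi / (N * sqrt (1 - (cmod T)\<^sup>2)))) = 1"
        using c[of k] by metis
      then show ?thesis
        using True unfolding gaussian_inner_hermite_poly[OF NT] if_P[OF True] of_real_mult[symmetric]
        by (simp only: of_real_eq_1_iff if_True)
    qed (simp add: gaussian_inner_hermite_poly[OF NT])
    finally have "has_bochner_integral lborel (\<lambda>u. ?f (v + (- v + u))) (if j = k then 1 else 0)"
      by (rule lborel_has_bochner_integral_translate)
    then show "has_bochner_integral lborel ?f (if j = k then 1 else 0)"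
      by simp
  qed
  then show ?thesis
    unfolding orthonormal_poly_def p_def[symmetric]
    by (intro the_equality) (auto intro: orthonormal_polys_unique)
qed

text \<open>
  In terms of the classical polynomials \<open>He\<^sub>k\<close> this is \<open>t\<^bsup>k/2\<^esup> He\<^sub>k(a z / sqrt t)\<close>. The recursion also covers
  \<open>t = 0\<close>, where it gives \<open>(a z)\<^sup>k\<close>.
\<close>

fun herm :: "real \<Rightarrow> real \<Rightarrow> nat \<Rightarrow> complex \<Rightarrow> complex" where
  "herm t a 0 z = 1"
| "herm t a (Suc 0) z = of_real a * z"
| "herm t a (Suc (Suc k)) z = of_real a * z * herm t a (Suc k) z - of_real (t * real (Suc k)) * herm t a k z"

lemma cnj_herm: "cnj (herm t a k z) = herm t a k (cnj z)"
  by (induction t a k z rule: herm.induct) simp_all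

text \<open>Rotating by half the argument of \<open>T\<close> makes the parameter real, since
  \<open>cnj T\<close> is \<open>cmod T\<close> times the square of
  \<open>cis (- Arg T / 2)\<close>. The modulus of the extracted power cancels against the norms and
  its phase cancels in the kernel.\<close>

lemma poly_hermite_poly:
  assumes "t0 > 0" "n > 0" "cmod T < 1"
  shows "poly (hermite_poly (real n / t0) T k) u =
     (of_real (sqrt (real n / t0 * (1 - (cmod T)\<^sup>2))) * cis (- Arg T / 2)) ^ k *
     herm (cmod T) (sqrt (real n * (1 - (cmod T)\<^sup>2))) k (cis (Arg T / 2) * u / of_real (sqrt t0))"
proof -
  define N a e s z where "N = real n / t0" and "a = sqrt (real n * (1 - (cmod T)\<^sup>2))" and "e = cis (- Arg T / 2)"
    and "s = sqrt (real n / t0 * (1 - (cmod T)\<^sup>2))" and "z = cis (Arg T / 2) * u / of_real (sqrt t0)"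
  have "(cmod T)\<^sup>2 < 1"
    using assms by (simp add: abs_square_less_1)
  then have b: "N * (1 - (cmod T)\<^sup>2) = s * s"
    using assms by (simp add: s_def N_def)
  have sa: "a / sqrt t0 = s"
    using assms by (simp add: s_def a_def real_sqrt_divide[symmetric])
  have "e * (a * z) = (e * cis (Arg T / 2)) * of_real (a / sqrt t0) * u"
    by (simp add: z_def)
  also have "e * cis (Arg T / 2) = 1"
    by (simp add: e_def cis_mult)
  finally have az: "e * (a * z) = of_real s * u"
    by (simp add: sa)
  have "T = of_real (cmod T) * cis (Arg T)"
    using rcis_cmod_Arg[of T] by (simp add: rcis_def)
  then have "cnj T = of_real (cmod T) * cis (- Arg T)"
    by (metis cis_cnj complex_cnj_complex_of_real complex_cnj_mult)
  then have cT: "cnj T = of_real (cmod T) * (e * e)"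
    by (simp add: e_def cis_mult)
  have "poly (hermite_poly N T k) u = (of_real s * e) ^ k * herm (cmod T) a k z"
  proof (induction k rule: induct_nat_012)
    case 0
    show ?case by simp
  next
    case 1
    have "poly (hermite_poly N T (Suc 0)) u = of_real s * (of_real s * u)"
      by (simp add: raise_op_def b)
    then show ?case by (simp add: az[symmetric])
  next
    case (ge2 k)
    have "poly (hermite_poly N T (Suc (Suc k))) u = of_real (s * s) * (u * poly (hermite_poly N T (Suc k)) u)
        - cnj T * poly (pderiv (hermite_poly N T (Suc k))) u"
      by (simp add: raise_op_def b)
    also have "\<dots> = of_real s * (of_real s * u) * poly (hermite_poly N T (Suc k)) u
        - cnj T * (of_real (s * s) * of_nat (Suc k) * poly (hermite_poly N T k) u)"
      unfolding pderiv_hermite_poly b by simp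
    also have "\<dots> = (of_real s * e) ^ Suc (Suc k) * herm (cmod T) a (Suc (Suc k)) z"
      unfolding ge2 cT az[symmetric] herm.simps by (simp add: algebra_simps)
    finally show ?case .
  qed
  then show ?thesis by (simp add: N_def s_def e_def a_def z_def)
qed

section \<open>Reduction to one real parameter\<close>

definition std_potential :: "real \<Rightarrow> complex \<Rightarrow> real" where
  "std_potential t z = (cmod z)\<^sup>2 - t * Re (z\<^sup>2)"

text \<open>The reproducing kernel for \<open>t0 = 1\<close>, \<open>t1 = 0\<close> and the real
  value \<open>t2 = t / 2\<close>. The conjugation is moved onto the argument \<open>w\<close>,
  because \<open>herm\<close> has real coefficients and Mehler's formula is bilinear.\<close>

definition std_kernel :: "nat \<Rightarrow> real \<Rightarrow> complex \<Rightarrow> complex \<Rightarrow> complex" where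
  "std_kernel n t w z =
     of_real (real n / pi * sqrt (1 - t\<^sup>2) * exp (- (real n / 2) * (std_potential t w + std_potential t z))) *
     (\<Sum>k<n. herm t (sqrt (real n * (1 - t\<^sup>2))) k (cnj w) * herm t (sqrt (real n * (1 - t\<^sup>2))) k z / fact k)"

definition std_point :: "real \<Rightarrow> complex \<Rightarrow> complex \<Rightarrow> complex \<Rightarrow> complex" where
  "std_point t0 t1 t2 z = cis (Arg t2 / 2) * (z - centre t1 t2) / of_real (sqrt t0)"

text \<open>\<open>1 / t0\<close> is the Jacobian of the change of variables
  \<open>std_point\<close>. Apart from it, only the constant value of the potential at the centre
  appears, and it cancels against the norms of the polynomials.\<close>

lemma repr_kernel_elliptic_potential:
  assumes "n > 0" "t0 > 0" "2 * cmod t2 < 1"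
  shows "repr_kernel n (elliptic_potential t0 t1 t2) w z =
    of_real (1 / t0) * std_kernel n (2 * cmod t2) (std_point t0 t1 t2 w) (std_point t0 t1 t2 z)"
proof -
  define N T t v where "N = real n / t0" and "T = 2 * t2" and "t = 2 * cmod t2" and "v = centre t1 t2"
  define V where "V = elliptic_potential t0 t1 t2"
  define w' z' where "w' = std_point t0 t1 t2 w" and "z' = std_point t0 t1 t2 z"
  define a where "a = sqrt (real n * (1 - t\<^sup>2))"
  define b where "b = N * (1 - t\<^sup>2)"
  define C where "C = pi / (N * sqrt (1 - t\<^sup>2)) * exp (- (real n * V v))"
  have T: "cmod T = t" "Arg T = Arg t2"
    using Arg_times_of_real[of 2 t2] by (simp_all add: T_def t_def norm_mult)
  have t: "0 \<le> t" "t < 1"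
    using assms by (simp_all add: t_def)
  then have t2: "t\<^sup>2 < 1"
    by (simp add: abs_square_less_1)
  have pos: "N > 0" "b > 0" "C > 0"
    using assms t2 by (simp_all add: N_def b_def C_def)
  have V: "V x = V v + std_potential t (std_point t0 t1 t2 x)" for x
  proof -
    define u where "u = x - v"
    have "T = of_real t * cis (Arg t2)"
      using rcis_cmod_Arg[of T] T by (simp add: rcis_def)
    moreover have cc: "(cis (Arg t2 / 2))\<^sup>2 = cis (Arg t2)"
      by (simp add: power2_eq_square cis_mult)
    ultimately have "T * u\<^sup>2 / t0 = of_real t * (cis (Arg t2 / 2) * u / of_real (sqrt t0))\<^sup>2"
      using assms(2) by (simp add: power_divide power_mult_distrib cc flip: of_real_power)
    also have "cis (Arg t2 / 2) * u / of_real (sqrt t0) = std_point t0 t1 t2 x"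
      by (simp add: std_point_def u_def v_def)
    finally have "Re (T * u\<^sup>2 / t0) = Re (of_real t * (std_point t0 t1 t2 x)\<^sup>2)"
      by (rule arg_cong)
    then have "Re (T * u\<^sup>2) / t0 = t * Re ((std_point t0 t1 t2 x)\<^sup>2)"
      unfolding Re_divide_of_real by simp
    moreover have "(cmod u)\<^sup>2 / t0 = (cmod (std_point t0 t1 t2 x))\<^sup>2"
      using assms(2) by (simp add: std_point_def u_def v_def norm_mult norm_divide power_divide)
    moreover have "V x = V v + (1 / t0) * ((cmod u)\<^sup>2 - Re (T * u\<^sup>2))"
      using elliptic_potential_shift[OF assms(3), of t0 t1 u] by (simp add: V_def T_def v_def u_def)
    ultimately show ?thesis
      by (simp add: std_potential_def diff_divide_distrib)
  qed
  have herm: "poly (hermite_poly N T k) (x - v) =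
      (of_real (sqrt b) * cis (- Arg t2 / 2)) ^ k * herm t a k (std_point t0 t1 t2 x)" for k x
    using poly_hermite_poly[of t0 n T k "x - v"] assms(1,2) t
    by (simp only: T N_def b_def a_def std_point_def v_def)
  have summand: "cnj (poly (orthonormal_poly n V k) w) * poly (orthonormal_poly n V k) z =
      of_real (1 / C) * (herm t a k (cnj w') * herm t a k z' / fact k)" for k
  proof -
    define c where "c = fact k * b ^ k * C"
    have c: "c > 0" using pos by (simp add: c_def)
    have "orthonormal_poly n V k = smult (of_real (1 / sqrt c)) (pcompose (hermite_poly N T k) [:- v, 1:])"
      using fun_cong[OF orthonormal_poly_elliptic_potential[OF assms, of t1], of k]
      by (simp only: V_def N_def[symmetric] T_def[symmetric] v_def[symmetric] T(1) b_def C_def c_def mult.assoc)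
    then have p: "poly (orthonormal_poly n V k) x = of_real (1 / sqrt c) * poly (hermite_poly N T k) (x - v)" for x
      by (simp add: poly_pcompose)
    define q where "q = complex_of_real (1 / sqrt c)"
    have q: "cnj q = q" "q * q = 1 / of_real c"
      using c by (simp_all add: q_def flip: of_real_mult)
    define r where "r = complex_of_real (sqrt b)"
    have r: "cnj r = r" "r * r = of_real b"
      using pos by (simp_all add: r_def flip: of_real_mult)
    \<comment> \<open>The rotation enters the two factors with conjugate powers and drops
      out.\<close>
    define e where "e = cis (- Arg t2 / 2)"
    have e: "cnj e * e = 1"
      by (simp add: e_def cis_cnj cis_mult)
    have "cnj (poly (orthonormal_poly n V k) w) * poly (orthonormal_poly n V k) z
        = (q * q) * ((r * r) * (cnj e * e)) ^ k * (herm t a k (cnj w') * herm t a k z')"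
      unfolding p herm q_def[symmetric] r_def[symmetric] e_def[symmetric]
      by (simp add: q(1) r(1) power_mult_distrib w'_def z'_def cnj_herm)
    also have "(q * q) * ((r * r) * (cnj e * e)) ^ k = (of_real (1 / C) / fact k :: complex)"
      unfolding q r e using pos by (simp add: c_def flip: of_real_power)
    finally show ?thesis by simp
  qed
  have "exp (- (real n / 2) * (V w + V z)) * (1 / C)
      = 1 / t0 * (real n / pi * sqrt (1 - t\<^sup>2) * exp (- (real n / 2) * (std_potential t w' + std_potential t z')))"
  proof -
    have "exp (- (real n / 2) * (V w + V z)) = exp (- (real n * V v)) * exp (- (real n / 2) * (std_potential t w' + std_potential t z'))"
      unfolding V[of w] V[of z] w'_def z'_def exp_add[symmetric] by (simp add: field_simps)
    then show ?thesis
      using pos assms(2) by (simp add: C_def N_def mult_ac)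
  qed
  then have "of_real (exp (- (real n / 2) * (V w + V z))) * of_real (1 / C) = of_real (1 / t0) *
     complex_of_real (real n / pi * sqrt (1 - t\<^sup>2) * exp (- (real n / 2) * (std_potential t w' + std_potential t z')))"
    unfolding of_real_mult[symmetric] of_real_eq_iff .
  then show ?thesis
    unfolding repr_kernel_def V_def[symmetric] summand sum_distrib_left[symmetric] std_kernel_def t_def[symmetric]
      w'_def[symmetric] z'_def[symmetric] a_def[symmetric] mult.assoc[symmetric] by (simp only:)
qed

section \<open>Mehler's formula\<close>

lemma herm_Suc: "herm t a (Suc k) z = of_real a * z * herm t a k z - of_real (t * real k) * herm t a (k - 1) z"
  by (cases k) simp_all

lemma has_field_derivative_herm:
  "(herm t a k has_field_derivative of_real a * of_nat k * herm t a (k - 1) z) (at z)"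
proof (induction k rule: induct_nat_012)
  case 0
  have "herm t a 0 = (\<lambda>z. 1)" by (rule ext) simp
  then show ?case by simp
next
  case 1
  have "herm t a (Suc 0) = (\<lambda>z. of_real a * z)" by (rule ext) simp
  then show ?case by (auto intro!: derivative_eq_intros)
next
  case (ge2 k)
  have eq: "herm t a (Suc (Suc k)) = (\<lambda>z. of_real a * z * herm t a (Suc k) z - of_real (t * real (Suc k)) * herm t a k z)"
    by (rule ext) simp
  have "((\<lambda>z. of_real a * z * herm t a (Suc k) z - of_real (t * real (Suc k)) * herm t a k z) has_field_derivative
      of_real a * herm t a (Suc k) z + of_real a * of_nat (Suc k) * (of_real a * z * herm t a k z - of_real (t * real k) * herm t a (k - 1) z)) (at z)"
    by (rule derivative_eq_intros ge2 refl)+ (simp add: algebra_simps)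
  then show ?case
    unfolding eq herm_Suc[of t a k, symmetric] by (simp add: algebra_simps)
qed

text \<open>A crude bound; it supplies the first finitely many values in the sharper estimate
  \<open>norm_herm_le\<close>.\<close>

lemma norm_herm_le_fact:
  assumes "0 \<le> t" "cmod z \<le> R"
  shows "cmod (herm t a k z) \<le> (\<bar>a\<bar> * R + t + 1) ^ k * fact k"
proof (induction k rule: induct_nat_012)
  case (ge2 k)
  define M where "M = \<bar>a\<bar> * R + t + 1"
  have "0 \<le> R" using assms(2) norm_ge_zero order_trans by blast
  then have M: "M \<ge> 1" using assms by (simp add: M_def)
  have "cmod (herm t a (Suc (Suc k)) z) \<le> \<bar>a\<bar> * cmod z * cmod (herm t a (Suc k) z) + t * real (Suc k) * cmod (herm t a k z)"
    unfolding herm.simps using assms(1) by (intro order_trans[OF norm_triangle_ineq4]) (simp add: norm_mult del: of_nat_Suc)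
  also have "\<dots> \<le> \<bar>a\<bar> * R * (M ^ Suc k * fact (Suc k)) + t * real (Suc k) * (M ^ k * fact k)"
    using assms ge2 \<open>0 \<le> R\<close> unfolding M_def[symmetric] by (intro add_mono mult_mono mult_nonneg_nonneg) auto
  also have "t * real (Suc k) * (M ^ k * fact k) \<le> t * (M ^ Suc k * fact (Suc k))"
  proof -
    have "M ^ k \<le> M ^ Suc k" using M by (intro power_increasing) auto
    then have "t * (M ^ k * fact (Suc k)) \<le> t * (M ^ Suc k * fact (Suc k))"
      using assms(1) by (intro mult_left_mono mult_right_mono) auto
    then show ?thesis by (simp add: mult_ac)
  qed
  also have "\<bar>a\<bar> * R * (M ^ Suc k * fact (Suc k)) + t * (M ^ Suc k * fact (Suc k)) \<le> M * (M ^ Suc k * fact (Suc k))"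
    using M by (simp add: M_def flip: distrib_right)
  also have "\<dots> \<le> M ^ Suc (Suc k) * fact (Suc (Suc k))"
    using M by (simp add: mult_ac mult_left_mono)
  finally show ?case by (simp add: M_def)
next
  case 1
  have "\<bar>a\<bar> * cmod z \<le> \<bar>a\<bar> * R" using assms by (intro mult_left_mono) auto
  then show ?case using assms by (simp add: norm_mult)
qed simp

text \<open>The growth rate is essentially that of \<open>t^(k/2) * sqrt (k!)\<close>; any
  \<open>l\<close> with \<open>l\<^sup>2 > t\<close> leaves room for the linear term of the
  recursion, which for large \<open>k\<close> is small compared with \<open>sqrt k\<close>. This
  makes Mehler's series converge on the whole disc \<open>t * cmod r < 1\<close>.\<close>

lemma norm_herm_le:
  assumes t: "0 \<le> t" "t < l\<^sup>2" "0 < l"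
  shows "\<exists>C\<ge>0. \<forall>k z. cmod z \<le> R \<longrightarrow> cmod (herm t a k z) \<le> C * l ^ k * sqrt (fact k)"
proof (cases "R \<ge> 0")
  case R: True
  \<comment> \<open>Chosen so that \<open>d * l + t = l\<^sup>2\<close>: once
    \<open>\<bar>a\<bar> * R \<le> d * sqrt k\<close>, the two terms of the recursion add up exactly
    to the claimed bound.\<close>
  define d where "d = (l\<^sup>2 - t) / l"
  have d: "d > 0" "d * l + t = l\<^sup>2" using t by (auto simp: d_def)
  obtain K where "(\<bar>a\<bar> * R / d)\<^sup>2 < real K"
    using reals_Archimedean2 by blast
  then have "\<bar>a\<bar> * R / d \<le> sqrt (real K)"
    by (intro real_le_rsqrt) simp
  then have K: "\<bar>a\<bar> * R \<le> d * sqrt (real K)"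
    using d by (simp add: field_simps)
  define M where "M = \<bar>a\<bar> * R + t + 1"
  have M: "M \<ge> 0" using t R by (simp add: M_def)
  define u where "u = (\<lambda>k. M ^ k * fact k / (l ^ k * sqrt (fact k)))"
  \<comment> \<open>Dominates the bound for every \<open>k \<le> K + 1\<close>; beyond that the
    recursion takes over with the same constant.\<close>
  define C where "C = (\<Sum>k\<le>K + 1. u k)"
  have u: "u k \<ge> 0" for k using M t by (simp add: u_def)
  then have C: "C \<ge> 0" by (simp add: C_def sum_nonneg)
  have "cmod (herm t a k z) \<le> C * l ^ k * sqrt (fact k)" if z: "cmod z \<le> R" for k z
  proof (induction k rule: less_induct)
    case (less k)
    show ?case
    proof (cases "k \<le> K + 1")
      case True
      have "cmod (herm t a k z) \<le> M ^ k * fact k"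
        unfolding M_def by (rule norm_herm_le_fact[OF t(1) z])
      also have "\<dots> = u k * (l ^ k * sqrt (fact k))"
        using t by (simp add: u_def)
      also have "\<dots> \<le> C * (l ^ k * sqrt (fact k))"
        using True u t unfolding C_def by (intro mult_right_mono member_le_sum) auto
      finally show ?thesis by (simp add: mult_ac)
    next
      case False
      then obtain j where j: "k = Suc (Suc j)" "K \<le> j"
        by (cases k; cases "k - 1") auto
      define s where "s = sqrt (real (Suc (Suc j)))"
      define s' where "s' = sqrt (real (Suc j))"
      have s: "s' \<le> s" "s' > 0" "s > 0" "s' * s' = real (Suc j)"
        by (simp_all add: s_def s'_def)
      have "sqrt (real K) \<le> s" using j by (simp add: s_def)
      then have as: "\<bar>a\<bar> * R \<le> d * s"
        using K d by (meson mult_left_mono less_imp_le order_trans)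
      have f1: "sqrt (fact (Suc j)) = s' * sqrt (fact j)"
        by (simp add: s'_def real_sqrt_mult)
      have f2: "sqrt (fact (Suc (Suc j))) = s * (s' * sqrt (fact j))"
        by (simp only: fact_Suc[of "Suc j"] real_sqrt_mult of_nat_fact s_def f1[symmetric])
      define F where "F = sqrt (fact j :: real)"
      have F: "F \<ge> 0" by (simp add: F_def)
      have IH: "cmod (herm t a (Suc j) z) \<le> C * l ^ Suc j * (s' * F)" "cmod (herm t a j z) \<le> C * l ^ j * F"
        using less[of "Suc j"] less[of j] j unfolding f1 F_def by auto
      have "cmod (herm t a k z) \<le> \<bar>a\<bar> * cmod z * cmod (herm t a (Suc j) z) + t * real (Suc j) * cmod (herm t a j z)"
        unfolding herm.simps j(1) using t(1) by (intro order_trans[OF norm_triangle_ineq4]) (simp add: norm_mult del: of_nat_Suc)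
      also have "\<dots> \<le> \<bar>a\<bar> * R * (C * l ^ Suc j * (s' * F)) + t * real (Suc j) * (C * l ^ j * F)"
        using IH t(1) z R by (intro add_mono mult_mono mult_nonneg_nonneg) auto
      also have "\<dots> \<le> (d * s) * (C * l ^ Suc j * (s' * F)) + t * (s * s') * (C * l ^ j * F)"
        using as s t C F unfolding s(4)[symmetric]
        by (intro add_mono mult_right_mono mult_left_mono mult_nonneg_nonneg) auto
      also have "\<dots> = C * (l ^ j * (d * l + t)) * (s * (s' * F))"
        by (simp add: algebra_simps)
      also have "\<dots> = C * l ^ k * sqrt (fact k)"
        unfolding d(2) j(1) f2 F_def by (simp add: power2_eq_square)
      finally show ?thesis .
    qed
  qed
  with C show ?thesis by blast
next
  case False
  then have "\<not> cmod z \<le> R" for z using norm_ge_zero[of z] by linarith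
  then show ?thesis by (intro exI[of _ 0]) simp
qed

lemma summable_of_nat_mult_power:
  assumes "0 \<le> q" "q < (1::real)"
  shows "summable (\<lambda>k. real k * q ^ k)"
proof (rule summable_comparison_test')
  show "summable (\<lambda>k. of_nat (Suc k) * q ^ k)"
    using geometric_deriv_sums[of q] assms by (auto simp: sums_iff)
  show "norm (real k * q ^ k) \<le> of_nat (Suc k) * q ^ k" if "k \<ge> 0" for k
    using assms by (auto simp: abs_mult intro!: mult_right_mono)
qed

section \<open>Summation of the generating series\<close>

definition mehler_term :: "real \<Rightarrow> real \<Rightarrow> complex \<Rightarrow> complex \<Rightarrow> complex \<Rightarrow> nat \<Rightarrow> complex" where
  "mehler_term t a r w z k = herm t a k w * herm t a k z * r ^ k / fact k"

text \<open>For \<open>t * cmod r < 1\<close> the base of the power has positive real part, so the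
  principal branch is analytic in \<open>r\<close> there.\<close>

definition mehler_fun :: "real \<Rightarrow> real \<Rightarrow> complex \<Rightarrow> complex \<Rightarrow> complex \<Rightarrow> complex" where
  "mehler_fun t a r w z = (1 - (of_real t * r)\<^sup>2) powr (- (1 / 2)) *
     exp ((of_real a)\<^sup>2 * (r * w * z - of_real t * r\<^sup>2 * (w\<^sup>2 + z\<^sup>2) / 2) / (1 - (of_real t * r)\<^sup>2))"

text \<open>Geometric majorants for the terms and for their derivatives in \<open>z\<close>, uniform
  on discs. They come from the growth bound with \<open>l\<^sup>2\<close> strictly between
  \<open>t\<close> and \<open>1 / cmod r\<close>.\<close>

lemma mehler_term_bounds:
  assumes "0 \<le> t" "t * cmod r < 1"
  obtains q C where "0 \<le> q" "q < 1" "0 \<le> C"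
    "\<And>z k. cmod z \<le> R \<Longrightarrow> cmod (mehler_term t a r w z k) \<le> C * q ^ k"
    "\<And>z k. cmod z \<le> R \<Longrightarrow>
       cmod (herm t a k w * (of_real a * of_nat k * herm t a (k - 1) z) * r ^ k / fact k) \<le> C * (real k * q ^ k)"
proof -
  obtain m where m: "t < m" "m * cmod r < 1"
  proof (cases "r = 0")
    case True
    then show thesis using that[of "t + 1"] by simp
  next
    case False
    then have "t < 1 / cmod r" using assms by (simp add: field_simps)
    then obtain m where "t < m" "m < 1 / cmod r" using dense by blast
    then show thesis using that[of m] False by (simp add: field_simps)
  qed
  define l where "l = sqrt m"
  have l: "t < l\<^sup>2" "0 < l" "l\<^sup>2 = m"
    using m assms by (auto simp: l_def)
  define q where "q = l\<^sup>2 * cmod r"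
  have q: "0 \<le> q" "q < 1" using m l assms(1) by (simp_all add: q_def)
  obtain C1 where C1: "C1 \<ge> 0" "\<And>k z. cmod z \<le> R \<Longrightarrow> cmod (herm t a k z) \<le> C1 * l ^ k * sqrt (fact k)"
    using norm_herm_le[OF assms(1) l(1,2)] by blast
  obtain C2 where C2: "C2 \<ge> 0" "\<And>k. cmod (herm t a k w) \<le> C2 * l ^ k * sqrt (fact k)"
    using norm_herm_le[OF assms(1) l(1,2), of "cmod w" a] by blast
  define C where "C = C1 * C2 * (1 + \<bar>a\<bar> / l)"
  have C: "C1 * C2 \<le> C" "C1 * C2 * (\<bar>a\<bar> / l) \<le> C" "0 \<le> C"
    using C1(1) C2(1) l by (simp_all add: C_def algebra_simps)
  show thesis
  proof (rule that[OF q C(3)])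
    fix z k assume z: "cmod z \<le> R"
    define F where "F = sqrt (fact k :: real)"
    have FF: "F * F / fact k = 1" by (simp add: F_def)
    have "cmod (mehler_term t a r w z k) = cmod (herm t a k w) * cmod (herm t a k z) * cmod r ^ k / fact k"
      by (simp add: mehler_term_def norm_mult norm_divide norm_power)
    also have "\<dots> \<le> (C2 * l ^ k * F) * (C1 * l ^ k * F) * cmod r ^ k / fact k"
      using C1 C2 z l unfolding F_def by (intro divide_right_mono mult_right_mono mult_mono) auto
    also have "\<dots> = C1 * C2 * q ^ k * (F * F / fact k)"
      by (simp add: q_def power_mult_distrib power2_eq_square mult_ac)
    also have "\<dots> = C1 * C2 * q ^ k"
      by (simp add: FF)
    also have "\<dots> \<le> C * q ^ k"
      using C q by (intro mult_right_mono) auto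
    finally show "cmod (mehler_term t a r w z k) \<le> C * q ^ k" .
    show "cmod (herm t a k w * (of_real a * of_nat k * herm t a (k - 1) z) * r ^ k / fact k) \<le> C * (real k * q ^ k)"
    proof (cases k)
      case (Suc j)
      have "cmod (herm t a k w * (of_real a * of_nat k * herm t a (k - 1) z) * r ^ k / fact k)
          = cmod (herm t a k w) * (\<bar>a\<bar> * real k * cmod (herm t a j z)) * cmod r ^ k / fact k"
        using Suc by (simp add: norm_mult norm_divide norm_power del: of_nat_Suc)
      also have "\<dots> \<le> (C2 * l ^ k * F) * (\<bar>a\<bar> * real k * (C1 * l ^ j * sqrt (fact j))) * cmod r ^ k / fact k"
        using C1 C2 z l unfolding F_def by (intro divide_right_mono mult_right_mono mult_mono mult_left_mono mult_nonneg_nonneg) auto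
      also have "\<dots> \<le> (C2 * l ^ k * F) * (\<bar>a\<bar> * real k * (C1 * l ^ j * F)) * cmod r ^ k / fact k"
        using C1 C2 l Suc unfolding F_def by (intro divide_right_mono mult_right_mono mult_left_mono mult_nonneg_nonneg) (auto intro!: fact_mono)
      also have "\<dots> = C1 * C2 * (\<bar>a\<bar> / l) * (real k * q ^ k) * (F * F / fact k)"
        using l(2) Suc unfolding q_def by (simp add: power_mult_distrib power2_eq_square mult_ac del: of_nat_Suc fact_Suc)
      also have "\<dots> = C1 * C2 * (\<bar>a\<bar> / l) * (real k * q ^ k)"
        by (simp only: FF mult_1_right)
      also have "\<dots> \<le> C * (real k * q ^ k)"
        using C q by (intro mult_right_mono) auto
      finally show ?thesis .
    qed simp
  qed
qed

lemma summable_mehler_term: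
  assumes "0 \<le> t" "t * cmod r < 1"
  shows "summable (\<lambda>k. norm (mehler_term t a r w z k))"
proof -
  obtain q C where q: "0 \<le> q" "q < 1" "\<And>k. cmod (mehler_term t a r w z k) \<le> C * q ^ k"
    using mehler_term_bounds[OF assms, of "cmod z" a w] by (metis order_refl)
  show ?thesis
    by (rule summable_comparison_test'[of "\<lambda>k. C * q ^ k"]) (use q in \<open>auto intro!: summable_mult summable_geometric\<close>)
qed

text \<open>Termwise differentiation in \<open>z\<close> and the three-term recursions in both
  variables turn the series into a solution of a first-order linear equation, which fixes its
  dependence on \<open>z\<close>.\<close>

lemma mehler_ode:
  fixes r w z :: complex and a t :: real
  assumes "0 \<le> t" "t * cmod r < 1"
  defines "\<Phi> \<equiv> \<lambda>z. suminf (mehler_term t a r w z)"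
  shows "(\<Phi> has_field_derivative
    (of_real a)\<^sup>2 * (r * w - of_real t * r\<^sup>2 * z) / (1 - (of_real t * r)\<^sup>2) * \<Phi> z) (at z)"
proof -
  define R where "R = cmod z + 1"
  obtain q C where q: "0 \<le> q" "q < 1" "0 \<le> C"
    and b: "\<And>z k. cmod z \<le> R \<Longrightarrow>
       cmod (herm t a k w * (of_real a * of_nat k * herm t a (k - 1) z) * r ^ k / fact k) \<le> C * (real k * q ^ k)"
    using mehler_term_bounds[OF assms(1,2), of R a w] by metis
  define d where "d = (\<lambda>k z. herm t a k w * (of_real a * of_nat k * herm t a (k - 1) z) * r ^ k / fact k)"
  have sC: "summable (\<lambda>k. C * (real k * q ^ k))"
    using q by (intro summable_mult summable_of_nat_mult_power)
  have b': "cmod (d k z) \<le> C * (real k * q ^ k)" if "z \<in> cball 0 R" for k z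
    using b[of z k] that by (simp add: d_def)
  have der: "(\<Phi> has_field_derivative (\<Sum>k. d k z)) (at z)"
    unfolding \<Phi>_def
  proof (rule has_field_derivative_series'(2)[of "cball 0 R" _ d z])
    show "(( \<lambda>z. mehler_term t a r w z k) has_field_derivative d k z) (at z within cball 0 R)" for k z
      unfolding mehler_term_def d_def
      by (rule has_field_derivative_at_within, (rule derivative_eq_intros has_field_derivative_herm refl)+) simp_all
    show "uniformly_convergent_on (cball 0 R) (\<lambda>n z. \<Sum>i<n. d i z)"
      by (rule Weierstrass_m_test'[OF _ sC]) (use b' in auto)
    show "summable (mehler_term t a r w z)"
      using summable_mehler_term[OF assms(1,2)] by (rule summable_norm_cancel)
  qed (auto simp: R_def interior_cball)
  have sd: "summable (\<lambda>k. d k z)"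
    by (rule summable_comparison_test'[OF sC]) (use b' in \<open>auto simp: R_def\<close>)
  have sA: "summable (mehler_term t a r w z)"
    using summable_mehler_term[OF assms(1,2)] by (rule summable_norm_cancel)
  \<comment> \<open>The recursion in \<open>w\<close> lowers the index of the
    \<open>w\<close>-factor, that in \<open>z\<close> removes the derivative. In the combination
    with weight \<open>(t * r)\<^sup>2\<close> all other products cancel and only Mehler terms
    remain.\<close>
  have rec: "d (Suc (Suc k)) z - (of_real t * r)\<^sup>2 * d k z
      = (of_real a)\<^sup>2 * (r * w * mehler_term t a r w z (Suc k) - of_real t * r\<^sup>2 * z * mehler_term t a r w z k)" for k
  proof -
    define h where "h = herm t a k w / fact k"
    define H where "H = herm t a (Suc k) w / fact (Suc k)"
    define e where "e = complex_of_real t * of_nat k * herm t a (k - 1) z"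
    have nf: "of_nat (Suc k) / fact (Suc k) = (1 / fact k :: complex)" for k
      by (simp del: of_nat_Suc)
    have dS: "d (Suc k) z = of_real a * (herm t a (Suc k) w * (of_nat (Suc k) / fact (Suc k))) * herm t a k z * r ^ Suc k" for k
      by (simp add: d_def del: of_nat_Suc fact_Suc)
    have dd: "of_real t * d k z = of_real a * h * e * r ^ k"
      by (simp add: d_def h_def e_def mult_ac)
    have e: "e = of_real a * z * herm t a k z - herm t a (Suc k) z"
      by (simp add: herm_Suc e_def)
    have "herm t a (Suc (Suc k)) w / fact (Suc k)
        = of_real a * w * H - of_real t * (of_nat (Suc k) / fact (Suc k)) * herm t a k w"
      by (simp add: H_def diff_divide_distrib del: of_nat_Suc fact_Suc)
    then have "d (Suc (Suc k)) z = of_real a * (of_real a * w * H - of_real t * h) * herm t a (Suc k) z * r ^ Suc (Suc k)"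
      unfolding dS[of "Suc k"] nf by (simp add: h_def del: of_nat_Suc fact_Suc herm.simps)
    moreover have "(of_real t * r)\<^sup>2 * d k z = of_real t * r\<^sup>2 * (of_real a * h * e * r ^ k)"
      unfolding dd[symmetric] by (simp add: power2_eq_square)
    moreover have "mehler_term t a r w z (Suc k) = H * herm t a (Suc k) z * r ^ Suc k" "mehler_term t a r w z k = h * herm t a k z * r ^ k"
      by (simp_all add: mehler_term_def H_def h_def del: fact_Suc)
    ultimately show ?thesis
      unfolding e by (simp only:) (simp add: power2_eq_square algebra_simps)
  qed
  \<comment> \<open>The shift by two splits off \<open>d 0\<close> and \<open>d 1\<close>;
    \<open>d 0\<close> vanishes and \<open>d 1\<close> compensates the missing zeroth Mehler
    term.\<close>
  have sd2: "(\<lambda>k. d (Suc (Suc k)) z) sums ((\<Sum>k. d k z) - d 0 z - d 1 z)"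
    using summable_ignore_initial_segment[OF sd, of 2] suminf_split_initial_segment[OF sd, of 2]
    by (simp add: sums_iff numeral_2_eq_2)
  have "(\<lambda>k. d (Suc (Suc k)) z - (of_real t * r)\<^sup>2 * d k z) sums
      ((\<Sum>k. d k z) - d 0 z - d 1 z - (of_real t * r)\<^sup>2 * (\<Sum>k. d k z))"
    using sd sd2 by (intro sums_diff sums_mult summable_sums)
  moreover have "(\<lambda>k. d (Suc (Suc k)) z - (of_real t * r)\<^sup>2 * d k z) sums
      ((of_real a)\<^sup>2 * (r * w * (\<Phi> z - mehler_term t a r w z 0) - of_real t * r\<^sup>2 * z * \<Phi> z))"
    unfolding rec \<Phi>_def using sA
    by (intro sums_diff sums_mult summable_sums) (auto simp: sums_iff summable_Suc_iff suminf_split_head)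
  ultimately have "(\<Sum>k. d k z) - d 0 z - d 1 z - (of_real t * r)\<^sup>2 * (\<Sum>k. d k z) =
      (of_real a)\<^sup>2 * (r * w * (\<Phi> z - mehler_term t a r w z 0) - of_real t * r\<^sup>2 * z * \<Phi> z)"
    by (rule sums_unique2)
  moreover have "d 0 z = 0" "d 1 z = (of_real a)\<^sup>2 * r * w" "mehler_term t a r w z 0 = 1"
    by (simp_all add: d_def mehler_term_def power2_eq_square)
  ultimately have "(1 - (of_real t * r)\<^sup>2) * (\<Sum>k. d k z) = (of_real a)\<^sup>2 * (r * w - of_real t * r\<^sup>2 * z) * \<Phi> z"
    by (simp add: algebra_simps)
  moreover have "1 - (of_real t * r)\<^sup>2 \<noteq> 0"
  proof
    assume "1 - (of_real t * r)\<^sup>2 = 0"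
    then have "(t * cmod r)\<^sup>2 = 1"
      using assms(1) by (metis abs_of_nonneg eq_iff_diff_eq_0 norm_mult norm_of_real norm_one norm_power)
    then show False
      using assms by (simp add: power2_eq_1_iff) (metis assms(1) less_irrefl mult_nonneg_nonneg neg_0_le_iff_le norm_ge_zero not_one_le_zero)
  qed
  ultimately have "(\<Sum>k. d k z) = (of_real a)\<^sup>2 * (r * w - of_real t * r\<^sup>2 * z) / (1 - (of_real t * r)\<^sup>2) * \<Phi> z"
    by (simp add: field_simps)
  with der show ?thesis by simp
qed

lemma one_minus_square_nonzero:
  assumes "0 \<le> t" "t * cmod r < 1"
  shows "1 - (of_real t * r)\<^sup>2 \<noteq> (0 :: complex)"
proof
  assume "1 - (of_real t * r)\<^sup>2 = 0"
  then have "cmod ((of_real t * r)\<^sup>2) = 1"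
    by (metis eq_iff_diff_eq_0 norm_one)
  then have "(t * cmod r)\<^sup>2 = 1"
    using assms(1) by (simp add: norm_mult norm_power)
  moreover have "(t * cmod r)\<^sup>2 < 1"
    unfolding abs_square_less_1 using assms by (simp add: abs_mult)
  ultimately show False by simp
qed

text \<open>Multiplication by the integrating factor \<open>exp (- Q z)\<close> leaves a function
  with derivative 0.\<close>

lemma suminf_mehler_term_eq:
  assumes "0 \<le> t" "t * cmod r < 1"
  shows "suminf (mehler_term t a r w z) = suminf (mehler_term t a r w 0) *
    exp ((of_real a)\<^sup>2 * (r * w * z - of_real t * r\<^sup>2 * z\<^sup>2 / 2) / (1 - (of_real t * r)\<^sup>2))"
proof -
  define \<Phi> where "\<Phi> = (\<lambda>z. suminf (mehler_term t a r w z))"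
  define b where "b = (of_real a)\<^sup>2 / (1 - (of_real t * r)\<^sup>2 :: complex)"
  define Q where "Q = (\<lambda>z. b * (r * w * z - of_real t * r\<^sup>2 * z\<^sup>2 / 2))"
  have 1: "(\<Phi> has_field_derivative (b * (r * w - of_real t * r\<^sup>2 * z)) * \<Phi> z) (at z)" for z
    using mehler_ode[OF assms, of a w z] by (simp add: \<Phi>_def b_def)
  have 2: "((\<lambda>z. exp (- Q z)) has_field_derivative exp (- Q z) * (- (b * (r * w - of_real t * r\<^sup>2 * z)))) (at z)" for z
    unfolding Q_def by (auto intro!: derivative_eq_intros)
  have "((\<lambda>z. \<Phi> z * exp (- Q z)) has_field_derivative 0) (at z)" for z
    by (rule DERIV_cong[OF DERIV_mult[OF 1 2]]) (simp add: algebra_simps)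
  then obtain c where c: "\<And>z. \<Phi> z * exp (- Q z) = c"
    using has_field_derivative_zero_constant[of UNIV "\<lambda>z. \<Phi> z * exp (- Q z)"] by auto
  have "\<Phi> z = (\<Phi> z * exp (- Q z)) * exp (Q z)"
    by (simp add: exp_minus)
  also have "\<Phi> z * exp (- Q z) = \<Phi> 0 * exp (- Q 0)"
    using c by simp
  finally show ?thesis
    by (simp add: \<Phi>_def Q_def b_def)
qed

text \<open>At the origin the odd terms vanish and the even ones are the binomial series with
  exponent -1/2 in \<open>- (t * r)\<^sup>2\<close>.\<close>

lemma suminf_mehler_term_0:
  assumes "0 \<le> t" "t * cmod r < 1"
  shows "suminf (mehler_term t a r 0 0) = (1 - (of_real t * r)\<^sup>2) powr (- (1 / 2))"
proof -
  define x where "x = - (of_real t * r)\<^sup>2"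
  have even: "mehler_term t a r 0 0 (2 * j) = ((- (1 / 2)) gchoose j) * x ^ j
      \<and> herm t a (Suc (2 * j)) 0 = 0" for j
  proof (induction j)
    case 0
    then show ?case by (simp add: mehler_term_def)
  next
    case (Suc j)
    have h: "herm t a (Suc (Suc (2 * j))) 0 = - of_real t * of_nat (Suc (2 * j)) * herm t a (2 * j) 0"
      by simp
    have nz: "(of_nat (Suc (Suc (2 * j))) :: complex) \<noteq> 0" "(of_nat (Suc (2 * j)) :: complex) \<noteq> 0"
      by (simp_all only: of_nat_eq_0_iff)
    have "mehler_term t a r 0 0 (Suc (Suc (2 * j))) = mehler_term t a r 0 0 (2 * j) *
        ((of_real t * r)\<^sup>2 * (of_nat (Suc (2 * j)) * of_nat (Suc (2 * j)) / (of_nat (Suc (Suc (2 * j))) * of_nat (Suc (2 * j)))))"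
      unfolding mehler_term_def h by (simp add: power2_eq_square mult_ac del: of_nat_Suc)
    also have "of_nat (Suc (2 * j)) * of_nat (Suc (2 * j)) / (of_nat (Suc (Suc (2 * j))) * of_nat (Suc (2 * j)))
        = (of_nat (Suc (2 * j)) / of_nat (Suc (Suc (2 * j))) :: complex)"
      using nz by (simp del: of_nat_Suc)
    finally have "mehler_term t a r 0 0 (2 * Suc j) = ((- (1 / 2)) gchoose j) * x ^ j *
        ((of_real t * r)\<^sup>2 * (of_nat (Suc (2 * j)) / of_nat (Suc (Suc (2 * j)))))"
      using Suc by simp
    also have "\<dots> = ((- (1 / 2)) gchoose j) * (- (1 / 2) - of_nat j) / of_nat (Suc j) * x ^ Suc j"
    proof -
      have "(of_nat (Suc (2 * j)) / of_nat (Suc (Suc (2 * j))) :: complex) = - ((- (1 / 2) - of_nat j) / of_nat (Suc j))"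
        using nz(1) by (simp add: divide_simps)
      then show ?thesis by (simp add: x_def)
    qed
    also have "((- (1 / 2)) gchoose j) * (- (1 / 2) - of_nat j) / of_nat (Suc j) = ((- (1 / 2)) gchoose (Suc j) :: complex)"
      using gbinomial_mult_1[of "- (1 / 2) :: complex" j] by (simp add: field_simps del: of_nat_Suc)
    finally show ?case using Suc by simp
  qed
  have "cmod x = (t * cmod r)\<^sup>2"
    using assms(1) by (simp add: x_def norm_mult norm_power)
  also have "\<dots> < 1"
    unfolding abs_square_less_1 using assms by (simp add: abs_mult)
  finally have "(\<lambda>j. ((- (1 / 2)) gchoose j) * x ^ j) sums (1 + x) powr (- (1 / 2))"
    by (rule gen_binomial_complex)
  then have "(\<lambda>j. mehler_term t a r 0 0 (2 * j)) sums (1 + x) powr (- (1 / 2))"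
    using even by simp
  then have "mehler_term t a r 0 0 sums (1 + x) powr (- (1 / 2))"
  proof (subst (asm) sums_mono_reindex)
    show "strict_mono (\<lambda>j::nat. 2 * j)" by (rule strict_monoI) simp
    fix k :: nat assume "k \<notin> range (\<lambda>j. 2 * j)"
    then have "odd k" by (auto elim!: evenE)
    then obtain j where "k = Suc (2 * j)" by (auto elim!: oddE)
    then show "mehler_term t a r 0 0 k = 0" using even[of j] by (simp add: mehler_term_def)
  qed auto
  then show ?thesis by (simp add: sums_iff x_def)
qed

text \<open>By symmetry in \<open>w\<close> and \<open>z\<close> the differential equation is used
  twice, once for each variable, and the value at the origin remains.\<close>

theorem mehler_formula:
  assumes "0 \<le> t" "t * cmod r < 1"
  shows "mehler_term t a r w z sums mehler_fun t a r w z"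
proof -
  have swap: "mehler_term t a r w 0 = mehler_term t a r 0 w"
    by (rule ext) (simp add: mehler_term_def mult_ac)
  have "suminf (mehler_term t a r w z) = mehler_fun t a r w z"
    unfolding suminf_mehler_term_eq[OF assms, of a w z] swap suminf_mehler_term_eq[OF assms, of a 0 w]
      suminf_mehler_term_0[OF assms] mehler_fun_def mult.assoc exp_add[symmetric] add_divide_distrib[symmetric] distrib_left[symmetric]
    by (simp add: algebra_simps add_divide_distrib)
  moreover have "summable (mehler_term t a r w z)"
    using summable_mehler_term[OF assms] by (rule summable_norm_cancel)
  ultimately show ?thesis by (simp add: sums_iff)
qed

section \<open>The complementary error function\<close>

text \<open>The imaginary part of \<open>k\<close> is covered by the characteristic function of the
  normal distribution, the real part by a real translation; no contour has to be moved.\<close>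

lemma has_bochner_integral_gaussian_fourier:
  "has_bochner_integral lborel (\<lambda>y::real. exp (- (complex_of_real y)\<^sup>2 / 2 + k * complex_of_real y))
     (of_real (sqrt (2 * pi)) * exp (k\<^sup>2 / 2))"
proof -
  define p q where "p = Re k" and "q = Im k"
  have k: "k = of_real p + \<i> * of_real q" by (simp add: p_def q_def complex_eq_iff)
  have int: "integrable lborel (\<lambda>x. std_normal_density x *\<^sub>R iexp (q * x))"
    by (rule Bochner_Integration.integrable_bound[of lborel "std_normal_density"]) auto
  have "(\<integral>x. std_normal_density x *\<^sub>R iexp (q * x) \<partial>lborel) = char std_normal_distribution q"
    unfolding char_def by (subst integral_density) auto
  also have "\<dots> = complex_of_real (exp (- q\<^sup>2 / 2))"
    by (simp add: char_std_normal_distribution)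
  finally have "has_bochner_integral lborel (\<lambda>x. std_normal_density x *\<^sub>R iexp (q * x)) (complex_of_real (exp (- q\<^sup>2 / 2)))"
    using int by (simp add: has_bochner_integral_iff)
  from lborel_has_bochner_integral_translate[OF this, of "- p"]
  have "has_bochner_integral lborel (\<lambda>x. std_normal_density (- p + x) *\<^sub>R iexp (q * (- p + x))) (complex_of_real (exp (- q\<^sup>2 / 2)))" .
  then have "has_bochner_integral lborel (\<lambda>x. (of_real (sqrt (2 * pi)) * exp (of_real (p\<^sup>2 / 2) + \<i> * of_real (p * q))) * (std_normal_density (- p + x) *\<^sub>R iexp (q * (- p + x))))
     (of_real (sqrt (2 * pi)) * exp (of_real (p\<^sup>2 / 2) + \<i> * of_real (p * q)) * complex_of_real (exp (- q\<^sup>2 / 2)))"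
    by (rule has_bochner_integral_mult_right)
  moreover have "(of_real (sqrt (2 * pi)) * exp (of_real (p\<^sup>2 / 2) + \<i> * of_real (p * q))) * (std_normal_density (- p + x) *\<^sub>R iexp (q * (- p + x)))
      = exp (- (complex_of_real x)\<^sup>2 / 2 + k * complex_of_real x)" for x
  proof -
    have "std_normal_density (- p + x) = (1 / sqrt (2 * pi)) * exp (- (- p + x)\<^sup>2 / 2)"
      by (simp only: std_normal_density_def)
    then have "std_normal_density (- p + x) *\<^sub>R iexp (q * (- p + x)) = of_real (1 / sqrt (2 * pi)) * (exp (of_real (- (- p + x)\<^sup>2 / 2)) * iexp (q * (- p + x)))"
      by (simp only: scaleR_conv_of_real exp_of_real of_real_mult mult.assoc)
    moreover have "complex_of_real (sqrt (2 * pi)) * of_real (1 / sqrt (2 * pi)) = 1"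
      by (simp flip: of_real_mult)
    moreover have "(b * c) * (d * e) = c * e" if "b * d = 1" for b c d e :: complex
      using that by algebra
    ultimately have "(of_real (sqrt (2 * pi)) * exp (of_real (p\<^sup>2 / 2) + \<i> * of_real (p * q))) * (std_normal_density (- p + x) *\<^sub>R iexp (q * (- p + x)))
       = exp (of_real (p\<^sup>2 / 2) + \<i> * of_real (p * q)) * (exp (of_real (- (- p + x)\<^sup>2 / 2)) * iexp (q * (- p + x)))"
      by (simp only:)
    also have "\<dots> = exp (- (complex_of_real x)\<^sup>2 / 2 + k * complex_of_real x)"
      unfolding k exp_add[symmetric] by (rule arg_cong[of _ _ exp]) (simp add: field_simps power2_eq_square)
    finally show ?thesis .
  qed
  moreover have "of_real (sqrt (2 * pi)) * exp (of_real (p\<^sup>2 / 2) + \<i> * of_real (p * q)) * complex_of_real (exp (- q\<^sup>2 / 2))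
      = of_real (sqrt (2 * pi)) * exp (k\<^sup>2 / 2)"
  proof -
    have "of_real (p\<^sup>2 / 2) + \<i> * of_real (p * q) + complex_of_real (- q\<^sup>2 / 2) = k\<^sup>2 / 2"
      unfolding k by (simp add: power2_eq_square algebra_simps add_divide_distrib diff_divide_distrib)
    then show ?thesis
      unfolding exp_of_real[symmetric] mult.assoc exp_add[symmetric] by (simp only:)
  qed
  ultimately show ?thesis by (simp only:)
qed

lemma erfc_eq_integral:
  "erfc (g / of_real (sqrt 2)) = of_real (sqrt (2 / pi)) * (\<integral>x\<in>{0..}. exp (- ((of_real x + g)\<^sup>2 / 2)) \<partial>lborel)"
proof -
  let ?f = "\<lambda>x::real. indicator {0..} x *\<^sub>R exp (- ((of_real x + g)\<^sup>2 / 2))"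
  have "(\<integral>x. ?f x \<partial>lborel) = \<bar>sqrt 2\<bar> *\<^sub>R (\<integral>x. ?f (0 + sqrt 2 * x) \<partial>lborel)"
    by (rule lborel_integral_real_affine) simp
  moreover have "?f (0 + sqrt 2 * x) = indicator {0..} x *\<^sub>R exp (- (g / of_real (sqrt 2) + of_real x)\<^sup>2)" for x
  proof -
    have s: "complex_of_real (sqrt 2) * complex_of_real (sqrt 2) = 2"
      by (simp flip: of_real_mult)
    have "complex_of_real (sqrt 2 * x) + g = of_real (sqrt 2) * (g / of_real (sqrt 2) + of_real x)"
      by (simp add: distrib_left)
    then have "(complex_of_real (sqrt 2 * x) + g)\<^sup>2 / 2 = (g / of_real (sqrt 2) + of_real x)\<^sup>2"
      using s by (simp only: power_mult_distrib) (simp add: power2_eq_square)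
    then show ?thesis by (simp add: indicator_def zero_le_mult_iff)
  qed
  then have "(\<lambda>x. ?f (0 + sqrt 2 * x)) = (\<lambda>x. indicator {0..} x *\<^sub>R exp (- (g / of_real (sqrt 2) + of_real x)\<^sup>2))"
    by (rule ext)
  ultimately have "(\<integral>x\<in>{0..}. exp (- ((of_real x + g)\<^sup>2 / 2)) \<partial>lborel)
      = of_real (sqrt 2) * (\<integral>x\<in>{0..}. exp (- (g / of_real (sqrt 2) + of_real x)\<^sup>2) \<partial>lborel)"
    unfolding set_lebesgue_integral_def by (simp add: scaleR_conv_of_real)
  moreover have "complex_of_real (sqrt (2 / pi)) * of_real (sqrt 2) = of_real (2 / sqrt pi)"
    by (simp add: real_sqrt_divide flip: of_real_mult)
  ultimately show ?thesis
    unfolding erfc_def set_lebesgue_integral_def by (simp only: mult.assoc[symmetric])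
qed

lemma tendsto_erfc:
  assumes "g \<longlonglongrightarrow> l"
  shows "(\<lambda>j. erfc (g j)) \<longlonglongrightarrow> erfc l"
proof -
  obtain B where B: "\<And>j. cmod (g j) \<le> B" "B \<ge> 0"
    using Bseq_eq_bounded convergent_imp_Bseq[of g] assms by (metis BseqE convergentI less_imp_le)
  have "(\<lambda>j. \<integral>x. indicator {0..} x *\<^sub>R exp (- (g j + complex_of_real x)\<^sup>2) \<partial>lborel)
     \<longlonglongrightarrow> (\<integral>x. indicator {0..} x *\<^sub>R exp (- (l + complex_of_real x)\<^sup>2) \<partial>lborel)"
  proof (rule integral_dominated_convergence[where w = "\<lambda>x. exp (2 * B\<^sup>2) * exp (- (1 / 2) * (x - 0)\<^sup>2)"])
    show "integrable lborel (\<lambda>x::real. exp (2 * B\<^sup>2) * exp (- (1 / 2) * (x - 0)\<^sup>2))"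
      using has_bochner_integral_gaussian[of "1 / 2" 0] by (intro integrable_mult_right) (auto simp: has_bochner_integral_iff)
    show "AE x in lborel. (\<lambda>j. indicator {0..} x *\<^sub>R exp (- (g j + complex_of_real x)\<^sup>2))
        \<longlonglongrightarrow> indicator {0..} x *\<^sub>R exp (- (l + complex_of_real x)\<^sup>2)"
      by (intro AE_I2 tendsto_intros assms)
    show "AE x in lborel. norm (indicator {0..} x *\<^sub>R exp (- (g j + complex_of_real x)\<^sup>2))
        \<le> exp (2 * B\<^sup>2) * exp (- (1 / 2) * (x - 0)\<^sup>2)" for j
    proof (intro AE_I2)
      fix x :: real
      have 1: "(Im (g j))\<^sup>2 + (Re (g j))\<^sup>2 \<le> B\<^sup>2"
        using power_mono[OF B(1)[of j], of 2] by (simp add: cmod_power2)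
      \<comment> \<open>Keeps half of \<open>x\<^sup>2\<close> in the exponent, uniformly in the
        bounded shift \<open>g j\<close>.\<close>
      have "0 \<le> (2 * Re (g j) + x)\<^sup>2" by simp
      then have 2: "x\<^sup>2 / 2 \<le> (Re (g j) + x)\<^sup>2 + (Re (g j))\<^sup>2"
        by (simp add: power2_eq_square algebra_simps)
      have "norm (exp (- (g j + complex_of_real x)\<^sup>2)) = exp ((Im (g j))\<^sup>2 - (Re (g j) + x)\<^sup>2)"
        by (simp add: power2_eq_square)
      also have "\<dots> \<le> exp (2 * B\<^sup>2 - x\<^sup>2 / 2)"
        unfolding exp_le_cancel_iff using 1 2 zero_le_power2[of B] by linarith
      also have "\<dots> = exp (2 * B\<^sup>2) * exp (- (1 / 2) * (x - 0)\<^sup>2)"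
        by (simp flip: exp_add)
      finally have *: "norm (exp (- (g j + complex_of_real x)\<^sup>2)) \<le> exp (2 * B\<^sup>2) * exp (- (1 / 2) * (x - 0)\<^sup>2)" .
      show "norm (indicator {0..} x *\<^sub>R exp (- (g j + complex_of_real x)\<^sup>2))
        \<le> exp (2 * B\<^sup>2) * exp (- (1 / 2) * (x - 0)\<^sup>2)"
      proof (cases "0 \<le> x")
        case True
        then have "indicator {0..} x = (1::real)" by simp
        then show ?thesis using * by (simp only: scaleR_one)
      qed simp
    qed
  qed auto
  then show ?thesis
    unfolding erfc_def set_lebesgue_integral_def by (intro tendsto_mult tendsto_const)
qed

text \<open>The edge limit appears in this form, a Gaussian on the line with real part 1 divided by
  its pole at 0. Since \<open>Re s = 1\<close>, \<open>1 / s\<close> is the integral of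
  \<open>exp (- u * s)\<close> over \<open>u \<ge> 0\<close>; after an exchange of integrals the
  inner one is Gaussian and the outer one is the tail defining \<open>erfc\<close>.\<close>

lemma erfc_contour_integral:
  "(\<integral>y. exp ((1 + \<i> * complex_of_real y)\<^sup>2 / 2 - g * (1 + \<i> * complex_of_real y)) / (1 + \<i> * complex_of_real y) \<partial>lborel)
     = of_real pi * erfc (g / of_real (sqrt 2))"
proof -
  let ?s = "\<lambda>y. 1 + \<i> * complex_of_real y"
  let ?f = "\<lambda>(y::real) (u::real). indicator {0..} u *\<^sub>R exp ((?s y)\<^sup>2 / 2 - (of_real u + g) * ?s y)"
  have sq: "(?s y)\<^sup>2 / 2 - h * ?s y = (1 / 2 - h) + (- (complex_of_real y)\<^sup>2 / 2 + (\<i> * (1 - h)) * complex_of_real y)" for y h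
    by (simp add: power2_eq_square algebra_simps) (simp add: field_simps)
  have inner1: "has_bochner_integral lborel (\<lambda>y. exp ((?s y)\<^sup>2 / 2 - h * ?s y)) (of_real (sqrt (2 * pi)) * exp (- (h\<^sup>2 / 2)))" for h
  proof -
    have "has_bochner_integral lborel (\<lambda>y. exp (1 / 2 - h) * exp (- (complex_of_real y)\<^sup>2 / 2 + (\<i> * (1 - h)) * complex_of_real y))
       (exp (1 / 2 - h) * (of_real (sqrt (2 * pi)) * exp ((\<i> * (1 - h))\<^sup>2 / 2)))"
      by (intro has_bochner_integral_mult_right has_bochner_integral_gaussian_fourier)
    moreover have "exp (1 / 2 - h) * (of_real (sqrt (2 * pi)) * exp ((\<i> * (1 - h))\<^sup>2 / 2))
        = of_real (sqrt (2 * pi)) * exp (- (h\<^sup>2 / 2))"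
    proof -
      have "1 / 2 - h + (\<i> * (1 - h))\<^sup>2 / 2 = - (h\<^sup>2 / 2)"
        by (simp add: power2_eq_square algebra_simps) (simp add: field_simps)
      then have "exp (1 / 2 - h) * exp ((\<i> * (1 - h))\<^sup>2 / 2) = exp (- (h\<^sup>2 / 2))"
        by (simp only: exp_add[symmetric])
      then show ?thesis by (simp only: mult.left_commute)
    qed
    ultimately show ?thesis
      unfolding sq exp_add[of "1 / 2 - h"] by (simp only:)
  qed
  have e1: "has_bochner_integral lborel (\<lambda>u. indicator {0..} u *\<^sub>R exp (- u :: real)) 1"
    using has_bochner_integral_I0i_power_exp_m'[of 0] by (simp add: mult.commute)
  have inner2: "has_bochner_integral lborel (\<lambda>u::real. indicator {0..} u *\<^sub>R exp (- (of_real u * s))) (1 / s)" if "Re s = 1" for s :: complex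
  proof -
    have s0: "s \<noteq> 0" using that by auto
    have meas: "(\<lambda>u::real. indicator A u *\<^sub>R exp (- (of_real u * s))) \<in> borel_measurable lborel" if "A \<in> sets borel" for A
      using that by (intro borel_measurable_scaleR borel_measurable_continuous_onI borel_measurable_indicator)
        (auto intro!: continuous_intros borel_measurable_continuous_onI)
    have bound: "norm (indicator A u *\<^sub>R exp (- (of_real u * s))) \<le> indicator {0..} u *\<^sub>R exp (- u)" if "A \<subseteq> {0..}" for u and A :: "real set"
      using that \<open>Re s = 1\<close> by (auto simp: indicator_def)
    have int: "integrable lborel (\<lambda>u::real. indicator {0..} u *\<^sub>R exp (- (of_real u * s)))"
      by (rule Bochner_Integration.integrable_bound[of lborel "\<lambda>u. indicator {0..} u *\<^sub>R exp (- u :: real)"])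
        (use e1 meas[of "{0..}"] bound[of "{0..}"] in \<open>auto simp: has_bochner_integral_iff intro!: AE_I2 order_trans[OF _ abs_ge_self]\<close>)
    have 1: "(\<lambda>n. \<integral>u. indicator {0..real n} u *\<^sub>R exp (- (of_real u * s)) \<partial>lborel)
        \<longlonglongrightarrow> (\<integral>u. indicator {0..} u *\<^sub>R exp (- (of_real u * s)) \<partial>lborel)"
    proof (rule integral_dominated_convergence[where w = "\<lambda>u. indicator {0..} u *\<^sub>R exp (- u)"])
      show "AE u in lborel. (\<lambda>n. indicator {0..real n} u *\<^sub>R exp (- (of_real u * s))) \<longlonglongrightarrow> indicator {0..} u *\<^sub>R exp (- (of_real u * s))"
      proof (intro AE_I2 tendsto_eventually)
        fix u :: real
        obtain m where "u \<le> real m" using real_arch_simple by blast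
        then show "\<forall>\<^sub>F n in sequentially. indicator {0..real n} u *\<^sub>R exp (- (of_real u * s)) = indicator {0..} u *\<^sub>R exp (- (of_real u * s))"
          by (intro eventually_sequentiallyI[of m]) (auto simp: indicator_def)
      qed
      show "AE u in lborel. norm (indicator {0..real n} u *\<^sub>R exp (- (of_real u * s))) \<le> indicator {0..} u *\<^sub>R exp (- u)" for n
        by (intro AE_I2 bound) auto
    qed (use e1 meas in \<open>auto simp: has_bochner_integral_iff\<close>)
    have "(\<integral>u. indicator {0..real n} u *\<^sub>R exp (- (of_real u * s)) \<partial>lborel) = - exp (- (of_real (real n) * s)) / s - (- exp (- (of_real 0 * s)) / s)" for n
    proof (rule integral_FTC_atLeastAtMost)
      show "((\<lambda>u. - exp (- (complex_of_real u * s)) / s) has_vector_derivative exp (- (of_real u * s))) (at u within {0..real n})" for u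
      proof -
        have "((\<lambda>z. - exp (- (z * s)) / s) has_field_derivative exp (- (of_real u * s))) (at (of_real u))"
          using s0 by (auto intro!: derivative_eq_intros)
        from has_vector_derivative_real_field[OF this] show ?thesis
          by (rule has_vector_derivative_at_within)
      qed
    qed (auto intro!: continuous_intros)
    then have 2: "(\<integral>u. indicator {0..real n} u *\<^sub>R exp (- (of_real u * s)) \<partial>lborel) = (1 - exp (- (of_real (real n) * s))) / s" for n
      by (simp add: diff_divide_distrib)
    have "(\<lambda>n. exp (- (complex_of_real (real n) * s))) \<longlonglongrightarrow> 0"
    proof (rule Lim_null_comparison)
      show "\<forall>\<^sub>F n in sequentially. norm (exp (- (complex_of_real (real n) * s))) \<le> exp (- real n)"
        using that by simp
      show "(\<lambda>n. exp (- real n)) \<longlonglongrightarrow> 0"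
        by real_asymp
    qed
    from tendsto_divide[OF tendsto_diff[OF tendsto_const this] tendsto_const s0, of 1]
    have "(\<lambda>n. \<integral>u. indicator {0..real n} u *\<^sub>R exp (- (of_real u * s)) \<partial>lborel) \<longlonglongrightarrow> 1 / s"
      unfolding 2 by simp
    with 1 int show ?thesis
      using LIMSEQ_unique by (auto simp: has_bochner_integral_iff)
  qed
  have f_eq: "?f y u = exp ((?s y)\<^sup>2 / 2 - g * ?s y) * (indicator {0..} u *\<^sub>R exp (- (of_real u * ?s y)))" for y u
  proof -
    have "(?s y)\<^sup>2 / 2 - (of_real u + g) * ?s y = ((?s y)\<^sup>2 / 2 - g * ?s y) + (- (of_real u * ?s y))"
      by (simp add: distrib_right)
    then show ?thesis by (simp only: exp_add mult_scaleR_right)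
  qed
  have int: "integrable (lborel \<Otimes>\<^sub>M lborel) (case_prod ?f)"
  proof (rule lborel_pair.Fubini_integrable)
    have "continuous_on UNIV (\<lambda>p :: real \<times> real. exp ((?s (fst p))\<^sup>2 / 2 - (of_real (snd p) + g) * ?s (fst p)))"
      by (intro continuous_intros) auto
    then have "(\<lambda>p :: real \<times> real. exp ((?s (fst p))\<^sup>2 / 2 - (of_real (snd p) + g) * ?s (fst p))) \<in> borel_measurable (borel \<Otimes>\<^sub>M borel)"
      unfolding borel_prod by (rule borel_measurable_continuous_onI)
    moreover have "(\<lambda>p. indicator {0..} (snd p)) \<in> borel_measurable (borel \<Otimes>\<^sub>M borel :: (real \<times> real) measure)"
      by (rule measurable_compose[OF measurable_snd]) simp
    ultimately have "(\<lambda>p. indicator {0..} (snd p) *\<^sub>R exp ((?s (fst p))\<^sup>2 / 2 - (of_real (snd p) + g) * ?s (fst p))) \<in> borel_measurable (borel \<Otimes>\<^sub>M borel)"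
      by (intro borel_measurable_scaleR)
    then show "case_prod ?f \<in> borel_measurable (lborel \<Otimes>\<^sub>M lborel)"
      unfolding case_prod_unfold
      by (simp only: measurable_cong_sets[OF sets_pair_measure_cong[OF sets_lborel sets_lborel] refl])
    show "AE y in lborel. integrable lborel (\<lambda>u. case (y, u) of (y, u) \<Rightarrow> ?f y u)"
      unfolding prod.case f_eq using inner2 by (intro AE_I2 integrable_mult_right) (auto simp: has_bochner_integral_iff)
    \<comment> \<open>The modulus of \<open>exp (- u * s)\<close> is \<open>exp (- u)\<close>, with
      integral 1, so absolute integrability reduces to that of the Gaussian on the vertical
      line.\<close>
    have "(\<integral>u. norm (case (y, u) of (y, u) \<Rightarrow> ?f y u) \<partial>lborel) = norm (exp ((?s y)\<^sup>2 / 2 - g * ?s y))" for y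
    proof -
      have "norm (?f y u) = norm (exp ((?s y)\<^sup>2 / 2 - g * ?s y)) * (indicator {0..} u *\<^sub>R exp (- u))" for u
        unfolding f_eq norm_mult by (simp add: indicator_def)
      then have "(\<integral>u. norm (?f y u) \<partial>lborel) = norm (exp ((?s y)\<^sup>2 / 2 - g * ?s y)) * (\<integral>u. indicator {0..} u *\<^sub>R exp (- u) \<partial>lborel)"
        by (simp only: integral_mult_right_zero)
      then show ?thesis using e1 by (simp add: has_bochner_integral_iff)
    qed
    then show "integrable lborel (\<lambda>y. \<integral>u. norm (case (y, u) of (y, u) \<Rightarrow> ?f y u) \<partial>lborel)"
      using inner1[of g] by (simp only: has_bochner_integral_iff integrable_norm)
  qed
  have "(\<integral>y. exp ((?s y)\<^sup>2 / 2 - g * ?s y) / ?s y \<partial>lborel) = (\<integral>y. \<integral>u. ?f y u \<partial>lborel \<partial>lborel)"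
  proof (rule Bochner_Integration.integral_cong[OF refl])
    fix y :: real
    show "exp ((?s y)\<^sup>2 / 2 - g * ?s y) / ?s y = (\<integral>u. ?f y u \<partial>lborel)"
      unfolding f_eq integral_mult_right_zero using inner2[of "?s y"] by (simp add: has_bochner_integral_iff)
  qed
  also have "\<dots> = (\<integral>u. \<integral>y. ?f y u \<partial>lborel \<partial>lborel)"
    by (rule lborel_pair.Fubini_integral[OF int, symmetric])
  also have "\<dots> = (\<integral>u. of_real (sqrt (2 * pi)) * (indicator {0..} u *\<^sub>R exp (- ((of_real u + g)\<^sup>2 / 2))) \<partial>lborel)"
  proof (rule Bochner_Integration.integral_cong[OF refl])
    fix u :: real
    have "(\<integral>y. ?f y u \<partial>lborel) = indicator {0..} u *\<^sub>R (\<integral>y. exp ((?s y)\<^sup>2 / 2 - (of_real u + g) * ?s y) \<partial>lborel)"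
      by (rule integral_scaleR_right)
    then show "(\<integral>y. ?f y u \<partial>lborel) = of_real (sqrt (2 * pi)) * (indicator {0..} u *\<^sub>R exp (- ((of_real u + g)\<^sup>2 / 2)))"
      using inner1[of "of_real u + g"] by (simp add: has_bochner_integral_iff)
  qed
  also have "\<dots> = of_real (sqrt (2 * pi)) * (\<integral>x\<in>{0..}. exp (- ((of_real x + g)\<^sup>2 / 2)) \<partial>lborel)"
    unfolding set_lebesgue_integral_def by (rule integral_mult_right_zero)
  also have "sqrt (2 * pi) = sqrt (pi\<^sup>2 * (2 / pi))"
    by (simp add: power2_eq_square mult.commute)
  also have "sqrt (pi\<^sup>2 * (2 / pi)) = pi * sqrt (2 / pi)"
    unfolding real_sqrt_mult by simp
  finally show ?thesis
    unfolding erfc_eq_integral by (simp only: of_real_mult mult.assoc)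
qed

section \<open>Partial sums of Mehler's series\<close>

lemma integral_exp_orthogonal:
  fixes m :: int and q :: real
  assumes "q > 0"
  shows "has_bochner_integral lborel (\<lambda>y. indicator {- (pi / q)..pi / q} y *\<^sub>R exp (- (\<i> * of_int m * of_real (q * y))))
    (if m = 0 then of_real (2 * pi / q) else 0)"
proof (cases "m = 0")
  case True
  have "has_bochner_integral lborel (\<lambda>y. indicator {- (pi / q)..pi / q} y *\<^sub>R (1 :: complex)) (measure lborel {- (pi / q)..pi / q} *\<^sub>R 1)"
    using assms by (intro has_bochner_integral_indicator) auto
  moreover have "measure lborel {- (pi / q)..pi / q} = 2 * pi / q"
    using assms by (simp add: field_simps)
  moreover have "(2 * pi / q) *\<^sub>R (1 :: complex) = of_real (2 * pi / q)"
    by (simp only: scaleR_conv_of_real mult_1_right)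
  moreover have "exp (- (\<i> * of_int m * of_real (q * y))) = 1" for y
    using True by simp
  ultimately show ?thesis
    using True by simp
next
  case False
  define c where "c = - (\<i> * of_int m * complex_of_real q)"
  have nz: "c \<noteq> 0"
    using False assms by (simp add: c_def)
  have ec: "exp (- (\<i> * of_int m * of_real (q * y))) = exp (of_real y * c)" for y
    by (simp add: c_def mult_ac)
  have "has_bochner_integral lborel (\<lambda>y. indicator {- (pi / q)..pi / q} y *\<^sub>R exp (of_real y * c))
     (exp (of_real (pi / q) * c) / c - exp (of_real (- (pi / q)) * c) / c)"
  proof (rule has_bochner_integral_FTC_Icc)
    show "- (pi / q) \<le> pi / q" using assms by simp
    show "((\<lambda>y. exp (of_real y * c) / c) has_vector_derivative exp (of_real y * c)) (at y within {- (pi / q)..pi / q})" for y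
    proof -
      have "((\<lambda>z. exp (z * c) / c) has_field_derivative exp (of_real y * c)) (at (of_real y))"
        using nz by (auto intro!: derivative_eq_intros)
      from has_vector_derivative_real_field[OF this] show ?thesis
        by (rule has_vector_derivative_at_within)
    qed
    show "continuous_on {- (pi / q)..pi / q} (\<lambda>y. exp (of_real y * c))"
      by (intro continuous_intros)
  qed
  moreover have "exp (of_real (pi / q) * c) = exp (of_real (- (pi / q)) * c)"
  proof -
    have c1: "of_real (pi / q) * c = - (\<i> * of_int m * of_real pi)" "of_real (- (pi / q)) * c = \<i> * of_int m * of_real pi"
      using assms by (simp_all add: c_def)
    have "- (\<i> * M * P) + \<i> * (M * (P * 2)) = \<i> * M * P" for M P
      by (simp add: mult.assoc mult_2_right distrib_left)
    then show ?thesis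
      using exp_plus_2pin[of "- (\<i> * of_int m * of_real pi)" m] unfolding c1 by metis
  qed
  ultimately show ?thesis using False unfolding ec by simp
qed

text \<open>Coefficient extraction on the circle of radius \<open>exp (- q)\<close>, parametrised by
  the angle \<open>q * y\<close> over one period. Multiplying by the powers
  \<open>inverse (r y) ^ j\<close> with \<open>j < n\<close> and integrating retains exactly the
  coefficients with \<open>k < n\<close>. The unit of \<open>y\<close> is \<open>q\<close>, so that
  the integrand has a limit when \<open>q\<close> tends to 0.\<close>

lemma partial_sum_eq_integral:
  fixes A :: "nat \<Rightarrow> complex" and q :: real
  assumes q: "q > 0" and A: "summable (\<lambda>k. norm (A k))"
  defines "r \<equiv> \<lambda>y. exp (- (of_real q * (1 + \<i> * complex_of_real y)))"
  shows "(\<Sum>k<n. A k) = of_real (q / (2 * pi)) *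
     (\<integral>y. indicator {- (pi / q)..pi / q} y *\<^sub>R ((\<Sum>k. A k * r y ^ k) * (\<Sum>j<n. inverse (r y) ^ j)) \<partial>lborel)"
proof -
  define I where "I = {- (pi / q)..pi / q}"
  define S where "S = (\<lambda>y. \<Sum>j<n. inverse (r y) ^ j)"
  define f where "f = (\<lambda>k y. indicator I y *\<^sub>R (A k * r y ^ k * S y))"
  have rr: "r y ^ k * inverse (r y) ^ j = of_real (exp (q * (real j - real k))) * exp (- (\<i> * of_int (int k - int j) * of_real (q * y)))" for y k j
    unfolding r_def exp_of_nat_mult[symmetric] exp_minus[symmetric] exp_of_real[symmetric] exp_add[symmetric]
    by (rule arg_cong[of _ _ exp]) (simp add: algebra_simps)
  have fk: "has_bochner_integral lborel (f k) (A k * (if k < n then of_real (2 * pi / q) else 0))" for k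
  proof -
    have "f k = (\<lambda>y. \<Sum>j<n. (A k * of_real (exp (q * (real j - real k)))) * (indicator I y *\<^sub>R exp (- (\<i> * of_int (int k - int j) * of_real (q * y)))))"
    proof
      fix y
      have "A k * r y ^ k * S y = (\<Sum>j<n. A k * (r y ^ k * inverse (r y) ^ j))"
        by (simp add: S_def sum_distrib_left mult.assoc)
      then show "f k y = (\<Sum>j<n. (A k * of_real (exp (q * (real j - real k)))) * (indicator I y *\<^sub>R exp (- (\<i> * of_int (int k - int j) * of_real (q * y)))))"
        unfolding f_def rr by (simp only: scaleR_sum_right mult.assoc mult_scaleR_right)
    qed
    then have "has_bochner_integral lborel (f k) (\<Sum>j<n. (A k * of_real (exp (q * (real j - real k)))) * (if int k - int j = 0 then of_real (2 * pi / q) else 0))"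
      unfolding I_def by (simp only:) (intro has_bochner_integral_sum has_bochner_integral_mult_right integral_exp_orthogonal q)
    also have "(\<Sum>j<n. (A k * of_real (exp (q * (real j - real k)))) * (if int k - int j = 0 then of_real (2 * pi / q) else 0))
        = (\<Sum>j<n. if j = k then A k * of_real (2 * pi / q) else 0)"
      by (intro sum.cong) auto
    also have "\<dots> = A k * (if k < n then of_real (2 * pi / q) else 0)"
      by simp
    finally show ?thesis .
  qed
  have nr: "norm (r y) = exp (- q)" for y
    by (simp add: r_def)
  have r1: "norm (r y ^ k) \<le> 1" for y k
    using q by (simp add: norm_power nr power_le_one)
  have nf: "norm (f k y) \<le> norm (A k) * (indicator I y *\<^sub>R (real n * exp (q * real n)))" for k y
  proof -
    \<comment> \<open>A bound depending on \<open>n\<close> suffices here: \<open>n\<close> is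
      fixed, and it is only used to exchange sum and integral.\<close>
    have "norm (inverse (r y) ^ j) \<le> exp (q * real n)" if "j < n" for j
      using that q by (simp add: norm_power norm_inverse nr exp_minus flip: exp_of_nat_mult)
    then have "norm (S y) \<le> (\<Sum>j<n. exp (q * real n))"
      unfolding S_def by (intro order_trans[OF norm_sum] sum_mono) auto
    then have "norm (A k) * norm (r y ^ k) * norm (S y) \<le> norm (A k) * 1 * (real n * exp (q * real n))"
      using r1[of y k] by (intro mult_mono) auto
    then show ?thesis
      by (simp add: f_def norm_mult indicator_def)
  qed
  have intI: "integrable lborel (\<lambda>y. indicator I y *\<^sub>R (real n * exp (q * real n)))"
    unfolding I_def by (intro integrable_indicator) (auto simp: emeasure_lborel_Icc_eq)
  have "(\<lambda>k. integral\<^sup>L lborel (f k)) sums (\<integral>y. (\<Sum>k. f k y) \<partial>lborel)"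
  proof (rule sums_integral)
    show "integrable lborel (f k)" for k
      using fk by (simp add: has_bochner_integral_iff)
    show "AE y in lborel. summable (\<lambda>k. norm (f k y))"
    proof (intro AE_I2)
      fix y
      show "summable (\<lambda>k. norm (f k y))"
      proof (rule summable_comparison_test')
        show "summable (\<lambda>k. norm (A k) * (indicator I y *\<^sub>R (real n * exp (q * real n))))"
          by (rule summable_mult2[OF A])
        show "norm (norm (f k y)) \<le> norm (A k) * (indicator I y *\<^sub>R (real n * exp (q * real n)))" for k
          using nf[of k y] by (simp only: real_norm_def abs_norm_cancel)
      qed
    qed
    have "(\<integral>y. norm (f k y) \<partial>lborel) \<le> norm (A k) * (\<integral>y. indicator I y *\<^sub>R (real n * exp (q * real n)) \<partial>lborel)" for k
      unfolding integral_mult_right_zero[symmetric]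
    proof (rule integral_mono)
      show "integrable lborel (\<lambda>y. norm (f k y))"
        using fk[of k] by (simp only: has_bochner_integral_iff integrable_norm)
      show "integrable lborel (\<lambda>y. norm (A k) * (indicator I y *\<^sub>R (real n * exp (q * real n))))"
        by (rule integrable_mult_right[OF intI])
    qed (rule nf)
    then have le: "norm (\<integral>y. norm (f k y) \<partial>lborel) \<le> norm (A k) * (\<integral>y. indicator I y *\<^sub>R (real n * exp (q * real n)) \<partial>lborel)" for k
      by (simp only: real_norm_def abs_of_nonneg Bochner_Integration.integral_nonneg norm_ge_zero)
    show "summable (\<lambda>k. \<integral>y. norm (f k y) \<partial>lborel)"
    proof (rule summable_comparison_test')
      show "summable (\<lambda>k. norm (A k) * (\<integral>y. indicator I y *\<^sub>R (real n * exp (q * real n)) \<partial>lborel))"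
        by (rule summable_mult2[OF A])
    qed (rule le)
  qed
  moreover have "integral\<^sup>L lborel (f k) = A k * (if k < n then of_real (2 * pi / q) else 0)" for k
    using fk by (simp add: has_bochner_integral_iff)
  ultimately have "(\<lambda>k. A k * (if k < n then of_real (2 * pi / q) else 0)) sums (\<integral>y. (\<Sum>k. f k y) \<partial>lborel)"
    by simp
  moreover have "(\<lambda>k. A k * (if k < n then of_real (2 * pi / q) else 0)) sums (\<Sum>k<n. A k * (if k < n then of_real (2 * pi / q) else 0))"
    by (rule sums_finite) auto
  ultimately have "(\<integral>y. (\<Sum>k. f k y) \<partial>lborel) = (\<Sum>k<n. A k * (if k < n then of_real (2 * pi / q) else 0))"
    by (rule sums_unique2)
  also have "\<dots> = (\<Sum>k<n. A k) * of_real (2 * pi / q)"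
    unfolding sum_distrib_right by (intro sum.cong) auto
  finally have 1: "(\<Sum>k<n. A k) * of_real (2 * pi / q) = (\<integral>y. (\<Sum>k. f k y) \<partial>lborel)" ..
  have "(\<Sum>k. f k y) = indicator I y *\<^sub>R ((\<Sum>k. A k * r y ^ k) * S y)" for y
  proof -
    have le: "norm (A k * r y ^ k) \<le> norm (A k)" for k
      using mult_left_mono[OF r1[of y k] norm_ge_zero[of "A k"]] by (simp only: norm_mult mult_1_right)
    have "summable (\<lambda>k. A k * r y ^ k)"
      by (rule summable_comparison_test'[where N = 0, OF A]) (rule le)
    then have "(\<lambda>k. A k * r y ^ k) sums (\<Sum>k. A k * r y ^ k)"
      by (rule summable_sums)
    then have "(\<lambda>k. A k * r y ^ k * S y) sums ((\<Sum>k. A k * r y ^ k) * S y)"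
      by (rule sums_mult2)
    from bounded_linear.sums[OF bounded_linear_scaleR_right this, of "indicator I y"]
    have "(\<lambda>k. f k y) sums (indicator I y *\<^sub>R ((\<Sum>k. A k * r y ^ k) * S y))"
      unfolding f_def .
    then show ?thesis
      by (rule sums_unique[symmetric])
  qed
  then have "(\<Sum>k<n. A k) * of_real (2 * pi / q) = (\<integral>y. indicator I y *\<^sub>R ((\<Sum>k. A k * r y ^ k) * S y) \<partial>lborel)"
    using 1 by (simp only:)
  moreover have "of_real (q / (2 * pi)) * (c * of_real (2 * pi / q)) = c" for c :: complex
    using q by simp
  ultimately show ?thesis
    unfolding I_def S_def by metis
qed

text \<open>For \<open>a\<^sup>2 = n * (1 - t\<^sup>2)\<close> the exponent of Mehler's function at
  \<open>r\<close> exceeds that at 1 by \<open>n * (r - 1)\<close> times this quantity. At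
  \<open>r = 1\<close> and real \<open>X\<close>, \<open>Y\<close> it equals
  \<open>ellipse_form\<close>, which is how the droplet enters.\<close>

definition exponent_factor :: "real \<Rightarrow> complex \<Rightarrow> complex \<Rightarrow> complex \<Rightarrow> complex" where
  "exponent_factor t X Y r = X\<^sup>2 * (of_real (1 - t) / (1 + of_real t * r)) + Y\<^sup>2 * (of_real (1 + t) / (1 - of_real t * r))"

definition prefactor :: "real \<Rightarrow> complex \<Rightarrow> complex" where
  "prefactor t r = (1 - (of_real t * r)\<^sup>2) powr (- (1 / 2)) / (1 - (of_real t)\<^sup>2) powr (- (1 / 2))"

lemma mehler_fun_nonzero:
  assumes "0 \<le> t" "t * cmod r < 1"
  shows "mehler_fun t a r w z \<noteq> 0"
  using one_minus_square_nonzero[OF assms] by (simp add: mehler_fun_def)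

text \<open>With \<open>X = (z + w) / 2\<close> and \<open>Y = (z - w) / (2 * \<i>)\<close> one has
  \<open>w * z = X\<^sup>2 + Y\<^sup>2\<close> and
  \<open>(w\<^sup>2 + z\<^sup>2) / 2 = X\<^sup>2 - Y\<^sup>2\<close>. The exponent then splits into
  partial fractions with denominators \<open>1 + t * r\<close> and \<open>1 - t * r\<close>.\<close>

lemma mehler_fun_ratio:
  assumes "0 \<le> t" "t < 1" "t * cmod r < 1" and a: "a\<^sup>2 = real n * (1 - t\<^sup>2)"
  shows "mehler_fun t a r w z / mehler_fun t a 1 w z =
    prefactor t r * exp (of_nat n * ((r - 1) * exponent_factor t ((z + w) / 2) ((z - w) / (2 * \<i>)) r))"
proof -
  define T where "T = complex_of_real t"
  define X2 where "X2 = ((z + w) / 2)\<^sup>2"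
  define Y2 where "Y2 = ((z - w) / (2 * \<i>))\<^sup>2"
  have XY: "w * z = X2 + Y2" "(w\<^sup>2 + z\<^sup>2) / 2 = X2 - Y2"
    by (simp_all add: X2_def Y2_def power2_eq_square field_simps)
  have "(1 + T * r) * (1 - T * r) \<noteq> 0"
    using one_minus_square_nonzero[OF assms(1,3)] by (simp add: T_def power2_eq_square algebra_simps)
  then have nz: "1 + T * r \<noteq> 0" "1 - T * r \<noteq> 0"
    by auto
  have "(1 + T) * (1 - T) \<noteq> 0"
    using one_minus_square_nonzero[of t 1] assms by (simp add: T_def power2_eq_square algebra_simps)
  then have nz1: "1 + T \<noteq> 0" "1 - T \<noteq> 0"
    by auto
  have a': "(of_real a)\<^sup>2 = of_nat n * ((1 - T) * (1 + T))"
    unfolding T_def of_real_power[symmetric] a by (simp add: power2_eq_square algebra_simps)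
  define Q where "Q = (\<lambda>r. of_nat n * ((1 - T) * (1 + T)) * (r * w * z - T * r\<^sup>2 * (w\<^sup>2 + z\<^sup>2) / 2) / (1 - (T * r)\<^sup>2))"
  have Q: "Q r = of_nat n * ((1 - T) * (1 + T) * (X2 * (r / (1 + T * r)) + Y2 * (r / (1 - T * r))))"
    if "1 + T * r \<noteq> 0" "1 - T * r \<noteq> 0" for r
  proof -
    have "r * w * z - T * r\<^sup>2 * (w\<^sup>2 + z\<^sup>2) / 2 = r * (w * z) - T * r\<^sup>2 * ((w\<^sup>2 + z\<^sup>2) / 2)"
      by simp
    also have "\<dots> = X2 * r * (1 - T * r) + Y2 * r * (1 + T * r)"
      unfolding XY by (simp add: power2_eq_square algebra_simps)
    also have "\<dots> / (1 - (T * r)\<^sup>2) = X2 * (r / (1 + T * r)) + Y2 * (r / (1 - T * r))"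
    proof -
      have "1 - (T * r)\<^sup>2 = (1 + T * r) * (1 - T * r)"
        by (simp add: power2_eq_square algebra_simps)
      then show ?thesis using that by (simp add: add_divide_distrib)
    qed
    finally show ?thesis unfolding Q_def by (simp only: times_divide_eq_right[symmetric] mult.assoc)
  qed
  \<comment> \<open>Subtracting the value at \<open>r = 1\<close> lets \<open>r - 1\<close> be
    factored out of both fractions.\<close>
  have d: "(1 - T) * (1 + T) * (r / (1 + T * r) - 1 / (1 + T)) = (r - 1) * ((1 - T) / (1 + T * r))"
    "(1 - T) * (1 + T) * (r / (1 - T * r) - 1 / (1 - T)) = (r - 1) * ((1 + T) / (1 - T * r))"
  proof -
    have "r / (1 + T * r) - 1 / (1 + T) = (r - 1) / ((1 + T * r) * (1 + T))"
      using diff_frac_eq[OF nz(1) nz1(1), of r 1] by (simp add: algebra_simps)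
    then show "(1 - T) * (1 + T) * (r / (1 + T * r) - 1 / (1 + T)) = (r - 1) * ((1 - T) / (1 + T * r))"
      using nz1 by simp
    have "r / (1 - T * r) - 1 / (1 - T) = (r - 1) / ((1 - T * r) * (1 - T))"
      using diff_frac_eq[OF nz(2) nz1(2), of r 1] by (simp add: algebra_simps)
    then show "(1 - T) * (1 + T) * (r / (1 - T * r) - 1 / (1 - T)) = (r - 1) * ((1 + T) / (1 - T * r))"
      using nz1 by simp
  qed
  have "Q r - Q 1 = of_nat n * (X2 * ((1 - T) * (1 + T) * (r / (1 + T * r) - 1 / (1 + T)))
      + Y2 * ((1 - T) * (1 + T) * (r / (1 - T * r) - 1 / (1 - T))))"
    using Q[OF nz] Q[of 1] nz1 by (simp add: algebra_simps)
  then have QQ: "Q r - Q 1 = of_nat n * ((r - 1) * exponent_factor t ((z + w) / 2) ((z - w) / (2 * \<i>)) r)"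
    unfolding d exponent_factor_def X2_def[symmetric] Y2_def[symmetric]
    by (simp only: T_def of_real_diff of_real_add of_real_1 distrib_left mult.left_commute[of _ "r - 1"])
  have "mehler_fun t a r w z / mehler_fun t a 1 w z = prefactor t r * (exp (Q r) / exp (Q 1))"
    unfolding mehler_fun_def a' prefactor_def Q_def T_def by simp
  then show ?thesis
    unfolding exp_diff[symmetric] QQ .
qed

section \<open>Asymptotics at the edge\<close>

lemma sin_ge_third:
  assumes "0 \<le> x" "x \<le> 2"
  shows "x / 3 \<le> sin (x::real)"
proof -
  have "(\<Sum>m<3. sin_coeff m * x ^ m) = x"
    by (simp add: sin_coeff_def numeral_3_eq_3)
  then have "\<bar>sin x - x\<bar> \<le> inverse (fact 3) * \<bar>x\<bar> ^ 3"
    using Maclaurin_sin_bound[of x 3] by simp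
  then have "x - sin x \<le> inverse (fact 3) * \<bar>x\<bar> ^ 3"
    by linarith
  then have "x - x ^ 3 / 6 \<le> sin x"
    using assms by (simp add: fact_numeral)
  moreover have "x ^ 3 \<le> 4 * x"
  proof -
    have "x\<^sup>2 \<le> 2\<^sup>2" using assms by (intro power_mono)
    then have "x * x\<^sup>2 \<le> x * 4" using assms by (intro mult_left_mono) auto
    then show ?thesis by (simp add: power2_eq_square power3_eq_cube)
  qed
  ultimately show ?thesis by simp
qed

text \<open>With \<open>x = \<bar>\<theta>\<bar> / 2\<close> the left-over is
  \<open>2 * (sin x)\<^sup>2 \<ge> 2 * (x / 3)\<^sup>2\<close>, which explains the 18.\<close>

lemma one_minus_cos_ge:
  assumes "\<bar>\<theta>\<bar> \<le> pi"
  shows "\<theta>\<^sup>2 / 18 \<le> 1 - cos \<theta>"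
proof -
  define x where "x = \<bar>\<theta>\<bar> / 2"
  have x: "0 \<le> x" "x \<le> 2" using assms pi_less_4 by (auto simp: x_def)
  have "cos \<theta> = cos (2 * x)" by (simp add: x_def)
  then have c: "1 - cos \<theta> = 2 * (sin x)\<^sup>2" by (simp add: cos_double_sin)
  have "(x / 3)\<^sup>2 \<le> (sin x)\<^sup>2"
    using sin_ge_third[OF x] x by (intro power_mono) auto
  then show ?thesis unfolding c by (simp add: x_def power_divide)
qed

text \<open>Controls the phase on the whole circle: leaving the positive real axis costs at least a
  multiple of \<open>1 - cos \<theta>\<close>. It is applied with \<open>u = t\<close> and
  \<open>u = - t\<close>, one for each fraction in \<open>exponent_factor\<close>. Here
  \<open>S\<close> is the squared modulus of the denominator.\<close>

lemma Re_moebius_le: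
  fixes u \<rho> \<theta> \<tau> :: real
  assumes u: "\<bar>u\<bar> \<le> \<tau>" "\<tau> < 1" and \<rho>: "0 < \<rho>" "\<rho> \<le> 1"
  defines "r \<equiv> of_real \<rho> * cis \<theta>"
  shows "Re ((r - 1) / (1 - of_real u * r)) \<le> (\<rho> - 1) / (1 - u * \<rho>) - (1 - \<tau>)\<^sup>2 / 8 * (\<rho> * (1 - cos \<theta>))"
proof -
  define a b where "a = \<rho> * cos \<theta>" and "b = \<rho> * sin \<theta>"
  define h Q where "h = \<rho> * (1 - cos \<theta>)" and "Q = 1 - u * \<rho>"
  define S where "S = Q\<^sup>2 + 2 * u * h"
  have "a\<^sup>2 + b\<^sup>2 = \<rho>\<^sup>2 * ((cos \<theta>)\<^sup>2 + (sin \<theta>)\<^sup>2)"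
    unfolding a_def b_def by (simp only: power_mult_distrib distrib_left)
  then have ab: "a * a + b * b = \<rho> * \<rho>" by (simp add: power2_eq_square)
  have a: "a = \<rho> - h" by (simp add: a_def h_def algebra_simps)
  have h: "0 \<le> h" using \<rho> by (simp add: h_def)
  have r: "Re r = a" "Im r = b" by (simp_all add: r_def a_def b_def)
  have uf: "\<bar>u\<bar> < 1" using u by simp
  have u\<rho>: "\<bar>u * \<rho>\<bar> \<le> \<bar>u\<bar>"
    using \<rho> by (simp add: abs_mult mult_left_le)
  have Q: "0 < Q" "Q \<le> 2" and 1: "1 - \<tau> \<le> 1 + u * \<rho>" "1 - \<tau> \<le> 1 - u"
    using u\<rho> uf u by (auto simp: Q_def)
  have S: "(1 - u * a)\<^sup>2 + (u * b)\<^sup>2 = S"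
  proof -
    have "(1 - u * a)\<^sup>2 + (u * b)\<^sup>2 = 1 - 2 * (u * a) + u * u * (a * a + b * b)"
      by (simp add: power2_eq_square algebra_simps)
    also have "\<dots> = S"
      unfolding ab unfolding S_def Q_def a by (simp add: power2_eq_square algebra_simps)
    finally show ?thesis .
  qed
  have num: "(a - 1) * (1 - u * a) - b * (u * b) = (\<rho> - 1) * Q - (1 + u) * h"
  proof -
    have "(a - 1) * (1 - u * a) - b * (u * b) = a - 1 + u * a - u * (a * a + b * b)"
      by (simp add: algebra_simps)
    also have "\<dots> = (\<rho> - 1) * Q - (1 + u) * h"
      unfolding ab unfolding Q_def a by (simp add: algebra_simps)
    finally show ?thesis .
  qed
  have Re: "Re ((r - 1) / (1 - of_real u * r)) = ((\<rho> - 1) * Q - (1 + u) * h) / S"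
    unfolding Re_divide S[symmetric] num[symmetric] by (simp add: r)
  have S_pos: "0 < S"
  proof -
    have "u * a < 1"
    proof -
      have "\<bar>u * a\<bar> \<le> \<bar>u\<bar> * 1"
        unfolding abs_mult a_def using \<rho> abs_cos_le_one[of \<theta>] by (intro mult_left_mono) (auto simp: abs_mult mult_le_one)
      then show ?thesis using uf by simp
    qed
    then show ?thesis unfolding S[symmetric] by (intro add_pos_nonneg) auto
  qed
  have S4: "S \<le> 4"
  proof -
    have "h \<le> \<rho> * 2" unfolding h_def using \<rho> by (intro mult_left_mono) (auto intro: order_trans[OF _ cos_ge_minus_one])
    have "sqrt S = cmod (1 - of_real u * r)"
      unfolding S[symmetric] cmod_def by (simp add: r)
    also have "\<dots> \<le> 1 + \<bar>u\<bar> * \<rho>"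
      using norm_triangle_ineq4[of 1 "of_real u * r"] \<rho> by (simp add: r_def norm_mult)
    also have "\<dots> \<le> 2"
      using u\<rho> uf \<rho> by (simp add: abs_mult)
    finally have "(sqrt S)\<^sup>2 \<le> 2\<^sup>2"
      using S_pos by (intro power_mono) auto
    then show ?thesis using S_pos by simp
  qed
  define Z where "Z = (\<rho> - 1) * Q - (1 + u) * h"
  \<comment> \<open>\<open>W / (Q * S)\<close> is the exact loss against the value
    \<open>(\<rho> - 1) / Q\<close> at angle 0.\<close>
  define W where "W = h * ((1 - u) * (1 + u * \<rho>))"
  have ZQ: "(\<rho> - 1) * S - W = Z * Q"
    unfolding Z_def W_def S_def Q_def by (simp add: power2_eq_square algebra_simps)
  have "(\<rho> - 1) / Q - W / (Q * S) = ((\<rho> - 1) * S - W) / (Q * S)"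
    using Q S_pos by (simp add: diff_divide_distrib)
  also have "\<dots> = Z / S"
    unfolding ZQ using Q by simp
  finally have eq: "((\<rho> - 1) * Q - (1 + u) * h) / S = (\<rho> - 1) / Q - h * ((1 - u) * (1 + u * \<rho>)) / (Q * S)"
    unfolding Z_def W_def by (rule sym)
  \<comment> \<open>The 8 is the product of the bounds \<open>Q \<le> 2\<close> and
    \<open>S \<le> 4\<close>.\<close>
  have "(1 - \<tau>)\<^sup>2 / 8 \<le> ((1 - u) * (1 + u * \<rho>)) / (Q * S)"
  proof (rule frac_le)
    show "(1 - \<tau>)\<^sup>2 \<le> (1 - u) * (1 + u * \<rho>)"
      unfolding power2_eq_square using 1 u by (intro mult_mono) auto
    show "Q * S \<le> 8"
      using mult_mono[of Q 2 S 4] Q S_pos S4 by simp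
    show "0 \<le> (1 - u) * (1 + u * \<rho>)"
      using 1 u by (intro mult_nonneg_nonneg) auto
  qed (use Q S_pos in simp)
  then have "(1 - \<tau>)\<^sup>2 / 8 * h \<le> ((1 - u) * (1 + u * \<rho>)) / (Q * S) * h"
    using h by (rule mult_right_mono)
  then show ?thesis
    unfolding Re eq h_def[symmetric] Q_def[symmetric] by (simp add: mult.commute)
qed

text \<open>Mean value estimate on the left half-plane, where the derivative of \<open>exp\<close>
  has modulus at most 1.\<close>

lemma norm_exp_minus_one_le:
  fixes w :: complex
  assumes "0 \<le> Re w"
  shows "cmod (exp (- w) - 1) \<le> cmod w"
proof -
  have "cmod (exp (- w) - exp 0) \<le> 1 * cmod (- w - 0)"
  proof (rule field_differentiable_bound[where f' = exp])
    show "convex {z. Re z \<le> 0}" by (rule convex_halfspace_Re_le)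
    show "(exp has_field_derivative exp z) (at z within {z. Re z \<le> 0})" for z :: complex
      by (rule has_field_derivative_at_within[OF DERIV_exp])
  qed (use assms in auto)
  then show ?thesis by simp
qed

lemma prefactor_bound:
  assumes "0 \<le> t" "t \<le> \<tau>" "\<tau> < 1" "cmod r \<le> 1"
  shows "cmod (prefactor t r) \<le> (1 - \<tau>) powr (- (1 / 2))"
proof -
  have "t * t \<le> t * 1" using assms by (intro mult_left_mono) auto
  then have t2: "1 - \<tau> \<le> 1 - t\<^sup>2" "t\<^sup>2 < 1"
    using assms by (auto simp: power2_eq_square)
  have "cmod ((of_real t * r)\<^sup>2) = t\<^sup>2 * (cmod r)\<^sup>2"
    using assms by (simp add: norm_mult norm_power power_mult_distrib)
  also have "\<dots> \<le> t\<^sup>2 * 1"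
    using assms by (intro mult_left_mono) (auto simp: power_le_one)
  finally have "1 - \<tau> \<le> cmod (1 - (of_real t * r)\<^sup>2)"
    using t2 norm_triangle_ineq2[of 1 "(of_real t * r)\<^sup>2"] by simp
  then have 1: "cmod ((1 - (of_real t * r)\<^sup>2) powr (- (1 / 2))) \<le> (1 - \<tau>) powr (- (1 / 2))"
    using assms by (subst norm_powr_real_powr') (auto intro!: powr_mono2')
  have "cmod ((1 - (of_real t)\<^sup>2) powr (- (1 / 2))) = (1 - t\<^sup>2) powr (- (1 / 2))"
  proof -
    have "1 - (complex_of_real t)\<^sup>2 = of_real (1 - t\<^sup>2)" by simp
    then show ?thesis using t2 by (simp add: norm_powr_real_powr' del: of_real_diff)
  qed
  also have "\<dots> \<ge> 1 powr (- (1 / 2))"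
    using t2 by (intro powr_mono2') auto
  finally have 2: "1 \<le> cmod ((1 - (complex_of_real t)\<^sup>2) powr (- (1 / 2)))" by simp
  have "cmod (prefactor t r) \<le> cmod ((1 - (of_real t * r)\<^sup>2) powr (- (1 / 2))) / 1"
    unfolding prefactor_def norm_divide using 2 by (intro divide_left_mono) auto
  with 1 show ?thesis by simp
qed

text \<open>The boundary of the droplet in standard coordinates is the level set 1; the semi-axes
  are reciprocal to each other.\<close>

definition ellipse_form :: "real \<Rightarrow> real \<Rightarrow> real \<Rightarrow> real" where
  "ellipse_form t x y = x\<^sup>2 * ((1 - t) / (1 + t)) + y\<^sup>2 * ((1 + t) / (1 - t))"

text \<open>Half the Euclidean length of the gradient of \<open>ellipse_form t\<close>.\<close>

definition ellipse_gradient :: "real \<Rightarrow> real \<Rightarrow> real \<Rightarrow> real" where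
  "ellipse_gradient t x y = sqrt (x\<^sup>2 * ((1 - t) / (1 + t))\<^sup>2 + y\<^sup>2 * ((1 + t) / (1 - t))\<^sup>2)"

text \<open>On the ellipse the two summands \<open>p\<close> and \<open>s\<close> of
  \<open>ellipse_form\<close> are weights with sum 1, and the squared gradient is the corresponding
  mean of \<open>c\<close> and \<open>1 / c\<close>. All bounds follow from
  \<open>m / 2 \<le> c \<le> 1\<close> and depend only on \<open>\<tau>\<close>.\<close>

lemma ellipse_bounds:
  assumes t: "0 \<le> t" "t \<le> \<tau>" "\<tau> < 1" and E: "ellipse_form t x y = 1"
  defines "m \<equiv> 1 - \<tau>" and "D \<equiv> ellipse_gradient t x y"
  shows "x\<^sup>2 \<le> 2 / m" "y\<^sup>2 \<le> 2 / m" "m / 2 \<le> D\<^sup>2" "D\<^sup>2 \<le> 2 / m" "0 < D" "m \<le> x\<^sup>2 * (1 - t) + y\<^sup>2 * (1 + t)"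
proof -
  define c where "c = (1 - t) / (1 + t)"
  have m: "0 < m" "m \<le> 1" "m \<le> 1 - t" using t by (auto simp: m_def)
  have c: "0 < c" "c \<le> 1"
    using t by (auto simp: c_def divide_le_eq_1)
  have c2: "m / 2 \<le> c"
    unfolding c_def using t m by (intro frac_le) auto
  have ic: "(1 + t) / (1 - t) = 1 / c" using t by (simp add: c_def)
  have ic1: "1 \<le> 1 / c" "1 / c \<le> 2 / m"
  proof -
    show "1 \<le> 1 / c" using c by simp
    have "1 / c \<le> 1 / (m / 2)" using c2 m c by (intro divide_left_mono) auto
    then show "1 / c \<le> 2 / m" by simp
  qed
  have cc: "c \<le> 1 / c" using c ic1 by linarith
  define p s where "p = x\<^sup>2 * c" and "s = y\<^sup>2 * (1 / c)"
  have ps: "p + s = 1" "0 \<le> p" "0 \<le> s"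
    using E c by (simp_all add: ellipse_form_def p_def s_def c_def[symmetric] ic)
  have xy: "x\<^sup>2 = p * (1 / c)" "y\<^sup>2 = s * c"
    using c by (simp_all add: p_def s_def)
  show "x\<^sup>2 \<le> 2 / m"
    unfolding xy using ps ic1 c mult_mono[of p 1 "1 / c" "2 / m"] by auto
  show "y\<^sup>2 \<le> 2 / m"
    unfolding xy using ps ic1 c mult_mono[of s 1 c 1] by linarith
  have D2: "D\<^sup>2 = p * c + s * (1 / c)"
  proof -
    have "D\<^sup>2 = x\<^sup>2 * c\<^sup>2 + y\<^sup>2 * (1 / c)\<^sup>2"
      unfolding D_def ellipse_gradient_def c_def[symmetric] ic by (intro real_sqrt_pow2) auto
    then show ?thesis by (simp add: p_def s_def power2_eq_square)
  qed
  have "p * c + s * c \<le> D\<^sup>2"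
    unfolding D2 using ps cc by (intro add_mono mult_left_mono) auto
  then have "c \<le> D\<^sup>2" using ps by (simp flip: distrib_right)
  then show D1: "m / 2 \<le> D\<^sup>2" using c2 by simp
  have "D\<^sup>2 \<le> p * (1 / c) + s * (1 / c)"
    unfolding D2 using ps cc by (intro add_mono mult_left_mono) auto
  then have "D\<^sup>2 \<le> 1 / c" using ps by (simp add: add_divide_distrib[symmetric])
  then show "D\<^sup>2 \<le> 2 / m" using ic1 by simp
  have "D \<noteq> 0" using D1 m by auto
  moreover have "0 \<le> D" by (simp add: D_def ellipse_gradient_def)
  ultimately show "0 < D" by simp
  have "x\<^sup>2 * (1 - t) = p * (1 + t)" "y\<^sup>2 * (1 + t) = s * (1 - t)"
    using t by (simp_all add: p_def s_def c_def)
  moreover have "p * m + s * m \<le> p * (1 + t) + s * (1 - t)"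
    using ps m t by (intro add_mono mult_left_mono) auto
  ultimately show "m \<le> x\<^sup>2 * (1 - t) + y\<^sup>2 * (1 + t)"
    using ps by (simp flip: distrib_right)
qed

lemma Re_of_nat_mult: "Re (of_nat n * z) = real n * Re z"
  by simp

text \<open>The summand \<open>real n * q\<close> is the logarithm of
  \<open>1 / cmod (r ^ n)\<close>. Since \<open>ellipse_form\<close> is 1, the terms of first order
  in \<open>q\<close> cancel; what is left at angle 0 is of order \<open>n * q\<^sup>2\<close>,
  hence bounded, and the cosine loss supplies the decay in \<open>\<eta>\<close>.\<close>

lemma Re_exponent_le:
  fixes \<eta> :: real
  assumes t: "0 \<le> t" "t \<le> \<tau>" "\<tau> < 1" and E: "ellipse_form t x y = 1" and n: "0 < n"
  defines "m \<equiv> 1 - \<tau>" and "D \<equiv> ellipse_gradient t x y"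
  defines "q \<equiv> 1 / (D * sqrt (real n))"
  assumes \<eta>: "\<bar>\<eta>\<bar> \<le> pi / q"
  defines "r \<equiv> exp (- (of_real q * (1 + \<i> * complex_of_real \<eta>)))"
  shows "Re (of_nat n * ((r - 1) * exponent_factor t (of_real x) (of_real y) r)) + real n * q
    \<le> 2 / m * (1 + 1 / m) - m\<^sup>2 / 8 * exp (- sqrt (2 / m)) * m * (m / 2) / 18 * \<eta>\<^sup>2"
proof -
  note eb = ellipse_bounds[OF t E, folded m_def D_def]
  have m: "0 < m" "m \<le> 1" using t by (auto simp: m_def)
  have sn: "0 < sqrt (real n)" using n by simp
  have q: "0 < q" using eb(5) sn by (simp add: q_def)
  have nq2: "real n * q\<^sup>2 = 1 / D\<^sup>2"
    using n by (simp add: q_def power_divide power_mult_distrib)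
  have D2: "m / 2 \<le> 1 / D\<^sup>2" "1 / D\<^sup>2 \<le> 2 / m"
  proof -
    have "1 / (2 / m) \<le> 1 / D\<^sup>2" using eb m by (intro divide_left_mono) auto
    then show "m / 2 \<le> 1 / D\<^sup>2" by simp
    have "1 / D\<^sup>2 \<le> 1 / (m / 2)" using eb m by (intro divide_left_mono) auto
    then show "1 / D\<^sup>2 \<le> 2 / m" by simp
  qed
  define \<rho> where "\<rho> = exp (- q)"
  have \<rho>: "0 < \<rho>" "\<rho> \<le> 1" using q by (simp_all add: \<rho>_def)
  have r: "r = of_real \<rho> * cis (- (q * \<eta>))"
    unfolding r_def \<rho>_def cis_conv_exp exp_of_real[symmetric] exp_add[symmetric]
    by (rule arg_cong[of _ _ exp]) (simp add: distrib_left mult_ac)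
  have q1: "q \<le> sqrt (2 / m)"
  proof -
    have "1 \<le> sqrt (real n)" using n by simp
    then have "D * 1 \<le> D * sqrt (real n)" using eb(5) by (intro mult_left_mono) auto
    then have "q \<le> 1 / D" unfolding q_def using eb(5) by (intro divide_left_mono) auto
    also have "1 / D = sqrt (1 / D\<^sup>2)" using eb(5) by (simp add: real_sqrt_divide)
    also have "\<dots> \<le> sqrt (2 / m)" using D2 by simp
    finally show ?thesis .
  qed
  have \<rho>l: "exp (- sqrt (2 / m)) \<le> \<rho>" using q1 by (simp add: \<rho>_def)
  \<comment> \<open>First and second order estimates for \<open>\<rho> = exp (- q)\<close>.\<close>
  have exq: "\<rho> - 1 + q \<le> q\<^sup>2" "1 - \<rho> \<le> q" "0 \<le> 1 - \<rho>"
  proof -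
    have "1 + q \<le> exp q" by (rule exp_ge_add_one_self)
    then have "\<rho> \<le> 1 / (1 + q)"
      using q by (simp add: \<rho>_def exp_minus inverse_eq_divide divide_left_mono)
    also have "1 / (1 + q) \<le> 1 - q + q\<^sup>2"
    proof -
      have "1 \<le> (1 - q + q\<^sup>2) * (1 + q)" using q by (simp add: power2_eq_square algebra_simps)
      then show ?thesis using q by (simp add: divide_le_eq)
    qed
    finally show "\<rho> - 1 + q \<le> q\<^sup>2" by simp
    show "1 - \<rho> \<le> q" using exp_ge_add_one_self[of "- q"] by (simp add: \<rho>_def)
    show "0 \<le> 1 - \<rho>" using \<rho> by simp
  qed
  \<comment> \<open>The range of \<open>\<eta>\<close> is one full turn, so the angle
    \<open>q * \<eta>\<close> stays within \<open>pi\<close> of 0.\<close>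
  have cosb: "(q * \<eta>)\<^sup>2 / 18 \<le> 1 - cos (- (q * \<eta>))"
  proof -
    have "\<bar>q * \<eta>\<bar> \<le> q * (pi / q)" using q \<eta> by (simp only: abs_mult) (intro mult_mono, auto)
    then show ?thesis using one_minus_cos_ge[of "q * \<eta>"] q by simp
  qed
  define h where "h = \<rho> * (1 - cos (- (q * \<eta>)))"
  define a b where "a = x\<^sup>2 * (1 - t)" and "b = y\<^sup>2 * (1 + t)"
  have ab: "0 \<le> a" "0 \<le> b" using t by (simp_all add: a_def b_def)
  have abE: "a / (1 + t) + b / (1 - t) = 1"
    using E by (simp add: ellipse_form_def a_def b_def)
  have tf: "\<bar>t\<bar> \<le> \<tau>" "\<bar>- t\<bar> \<le> \<tau>" using t by auto
  have M1: "Re ((r - 1) / (1 + of_real t * r)) \<le> (\<rho> - 1) / (1 + t * \<rho>) - m\<^sup>2 / 8 * h"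
    using Re_moebius_le[OF tf(2) t(3) \<rho>, of "- (q * \<eta>)"] unfolding r[symmetric] h_def m_def by simp
  have M2: "Re ((r - 1) / (1 - of_real t * r)) \<le> (\<rho> - 1) / (1 - t * \<rho>) - m\<^sup>2 / 8 * h"
    using Re_moebius_le[OF tf(1) t(3) \<rho>, of "- (q * \<eta>)"] unfolding r[symmetric] h_def m_def by simp
  have "(r - 1) * exponent_factor t (of_real x) (of_real y) r =
      of_real a * ((r - 1) / (1 + of_real t * r)) + of_real b * ((r - 1) / (1 - of_real t * r))"
    unfolding exponent_factor_def a_def b_def of_real_mult of_real_power
    by (simp only: distrib_left times_divide_eq_right mult_ac)
  then have "Re ((r - 1) * exponent_factor t (of_real x) (of_real y) r) =
      a * Re ((r - 1) / (1 + of_real t * r)) + b * Re ((r - 1) / (1 - of_real t * r))"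
    by (simp only: plus_complex.sel Re_complex_of_real Im_complex_of_real times_complex.sel mult_zero_left diff_zero)
  also have "\<dots> \<le> a * ((\<rho> - 1) / (1 + t * \<rho>) - m\<^sup>2 / 8 * h) + b * ((\<rho> - 1) / (1 - t * \<rho>) - m\<^sup>2 / 8 * h)"
    using M1 M2 ab by (intro add_mono mult_left_mono)
  also have "\<dots> = (\<rho> - 1) * (a / (1 + t * \<rho>) + b / (1 - t * \<rho>)) - m\<^sup>2 / 8 * h * (a + b)"
    by (simp add: algebra_simps)
  also have "\<dots> \<le> (- q + q\<^sup>2 * (1 + 1 / m)) - m\<^sup>2 / 8 * h * m"
  proof (rule diff_mono)
    show "m\<^sup>2 / 8 * h * m \<le> m\<^sup>2 / 8 * h * (a + b)"
      using eb(6) \<rho> by (intro mult_left_mono) (auto simp: a_def b_def h_def intro!: mult_nonneg_nonneg)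
    define B where "B = a / (1 + t * \<rho>) + b / (1 - t * \<rho>)"
    have t\<rho>: "t * \<rho> \<le> t" "0 \<le> t * \<rho>" using t \<rho> by (auto simp: mult_left_le)
    \<comment> \<open>At \<open>\<rho> = 1\<close> the quantity \<open>B\<close> is
      \<open>ellipse_form\<close>, hence 1. For smaller \<open>\<rho>\<close> the quotient with
      \<open>a\<close> grows, and the one with \<open>b\<close> drops by at most
      \<open>(1 - \<rho>) / m\<close>.\<close>
    have B1: "B \<ge> 1 - (1 - \<rho>) / m"
    proof -
      have b1: "b / (1 - t) \<le> 1" using abE ab t divide_nonneg_pos[of a "1 + t"] by linarith
      have "b / (1 - t) - b / (1 - t * \<rho>) = b / (1 - t) * ((t * (1 - \<rho>)) / (1 - t * \<rho>))"
      proof -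
        have "b / P - b / R = b / P * ((R - P) / R)" if "P \<noteq> 0" "R \<noteq> 0" for P R
          using that by (simp add: field_simps)
        moreover have "(1 - t * \<rho>) - (1 - t) = t * (1 - \<rho>)" by (simp add: algebra_simps)
        moreover have "1 - t \<noteq> 0" "1 - t * \<rho> \<noteq> 0" using t t\<rho> by auto
        ultimately show ?thesis by metis
      qed
      also have "\<dots> \<le> 1 * ((1 - \<rho>) / m)"
      proof (rule mult_mono[OF b1])
        show "t * (1 - \<rho>) / (1 - t * \<rho>) \<le> (1 - \<rho>) / m"
          using t t\<rho> exq(3) m by (intro frac_le) (auto simp: m_def mult_left_le_one_le)
        show "0 \<le> t * (1 - \<rho>) / (1 - t * \<rho>)"
          using t t\<rho> exq(3) by simp
      qed simp
      finally have "b / (1 - t) - (1 - \<rho>) / m \<le> b / (1 - t * \<rho>)" by simp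
      moreover have "a / (1 + t) \<le> a / (1 + t * \<rho>)"
        using ab t t\<rho> by (intro divide_left_mono) auto
      ultimately show ?thesis unfolding B_def using abE by linarith
    qed
    have "(1 - \<rho>) * (1 - (1 - \<rho>) / m) \<le> (1 - \<rho>) * B"
      using B1 exq(3) by (rule mult_left_mono)
    moreover have "(1 - \<rho>) * (1 - (1 - \<rho>) / m) = (1 - \<rho>) - (1 - \<rho>)\<^sup>2 / m"
      by (simp add: power2_eq_square right_diff_distrib)
    moreover have "(1 - \<rho>)\<^sup>2 / m \<le> q\<^sup>2 / m"
      using exq m by (intro divide_right_mono power_mono) auto
    moreover have "(\<rho> - 1) * B = - ((1 - \<rho>) * B)"
      by (simp add: algebra_simps)
    moreover have "q\<^sup>2 * (1 + 1 / m) = q\<^sup>2 + q\<^sup>2 / m"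
      by (simp add: distrib_left)
    ultimately show "(\<rho> - 1) * B \<le> - q + q\<^sup>2 * (1 + 1 / m)"
      using exq(1) by linarith
  qed
  finally have R: "Re ((r - 1) * exponent_factor t (of_real x) (of_real y) r) \<le> (- q + q\<^sup>2 * (1 + 1 / m)) - m\<^sup>2 / 8 * h * m" .
  have "Re (of_nat n * ((r - 1) * exponent_factor t (of_real x) (of_real y) r)) + real n * q
      = real n * (Re ((r - 1) * exponent_factor t (of_real x) (of_real y) r) + q)"
    by (simp only: Re_of_nat_mult distrib_left)
  also have "\<dots> \<le> real n * (q\<^sup>2 * (1 + 1 / m) - m\<^sup>2 / 8 * h * m)"
    using R by (intro mult_left_mono) auto
  also have "\<dots> = (real n * q\<^sup>2) * (1 + 1 / m) - m\<^sup>2 / 8 * m * (real n * h)"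
    by (simp add: algebra_simps)
  also have "\<dots> \<le> 2 / m * (1 + 1 / m) - m\<^sup>2 / 8 * m * (exp (- sqrt (2 / m)) * ((m / 2) * \<eta>\<^sup>2 / 18))"
  proof (rule diff_mono)
    show "(real n * q\<^sup>2) * (1 + 1 / m) \<le> 2 / m * (1 + 1 / m)"
      unfolding nq2 using D2 m by (intro mult_right_mono) auto
    have "exp (- sqrt (2 / m)) * ((m / 2) * \<eta>\<^sup>2 / 18) \<le> \<rho> * ((real n * q\<^sup>2) * \<eta>\<^sup>2 / 18)"
      unfolding nq2 using \<rho>l \<rho> D2 m by (intro mult_mono divide_right_mono mult_right_mono) auto
    also have "\<dots> = real n * (\<rho> * ((q * \<eta>)\<^sup>2 / 18))"
      by (simp add: power_mult_distrib)
    also have "\<dots> \<le> real n * h"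
      unfolding h_def using cosb \<rho> by (intro mult_left_mono) auto
    finally show "m\<^sup>2 / 8 * m * (exp (- sqrt (2 / m)) * ((m / 2) * \<eta>\<^sup>2 / 18)) \<le> m\<^sup>2 / 8 * m * (real n * h)"
      using m by (intro mult_left_mono) auto
  qed
  finally show ?thesis by (simp add: mult_ac)
qed

text \<open>Displacements of order \<open>1 / sqrt n\<close> change \<open>exponent_factor\<close>
  by the same order, while \<open>r - 1\<close> is of order
  \<open>(1 + \<bar>\<eta>\<bar>) / sqrt n\<close>. The factor \<open>n\<close> is used up, and the
  change of the phase grows only linearly in \<open>\<eta>\<close>.\<close>

lemma exponent_perturbation_le:
  fixes \<eta> :: real
  assumes t: "0 \<le> t" "t \<le> \<tau>" "\<tau> < 1" and E: "ellipse_form t x y = 1" and n: "0 < n"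
  defines "m \<equiv> 1 - \<tau>" and "D \<equiv> ellipse_gradient t x y"
  defines "q \<equiv> 1 / (D * sqrt (real n))"
  defines "r \<equiv> exp (- (of_real q * (1 + \<i> * complex_of_real \<eta>)))"
  assumes K: "cmod \<xi> \<le> K" "cmod \<upsilon> \<le> K"
  defines "X \<equiv> of_real x + \<xi> / of_real (sqrt (real n))" and "Y \<equiv> of_real y + \<upsilon> / of_real (sqrt (real n))"
  shows "cmod (of_nat n * ((r - 1) * exponent_factor t X Y r) - of_nat n * ((r - 1) * exponent_factor t (of_real x) (of_real y) r))
    \<le> (1 + \<bar>\<eta>\<bar>) * (sqrt (2 / m) * (3 * (2 * sqrt (2 / m) * K + K\<^sup>2) / m))"
proof -
  note eb = ellipse_bounds[OF t E, folded m_def D_def]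
  define L where "L = sqrt (2 / m)"
  define s where "s = sqrt (real n)"
  have m: "0 < m" "m \<le> 1" using t by (auto simp: m_def)
  have s: "1 \<le> s" "s * s = real n" using n by (auto simp: s_def)
  have L: "0 \<le> L" using m by (simp add: L_def)
  have xy: "\<bar>x\<bar> \<le> L" "\<bar>y\<bar> \<le> L"
    using eb(1,2) by (auto simp: L_def intro!: real_le_rsqrt)
  have K0: "0 \<le> K" using K(1) norm_ge_zero order_trans by blast
  have D: "0 < D" "1 / D \<le> L"
  proof -
    show "0 < D" by (rule eb(5))
    have "1 / D\<^sup>2 \<le> 1 / (m / 2)" using eb m by (intro divide_left_mono) auto
    then have "sqrt (1 / D\<^sup>2) \<le> L" unfolding L_def by simp
    then show "1 / D \<le> L" using eb(5) by (simp add: real_sqrt_divide)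
  qed
  have q: "0 < q" "s * q = 1 / D" using D s by (simp_all add: q_def s_def[symmetric])
  have r1: "s * cmod (r - 1) \<le> L * (1 + \<bar>\<eta>\<bar>)"
  proof -
    have "cmod (r - 1) \<le> cmod (of_real q * (1 + \<i> * complex_of_real \<eta>))"
      unfolding r_def using q by (intro norm_exp_minus_one_le) simp
    also have "\<dots> \<le> q * (1 + \<bar>\<eta>\<bar>)"
      using q norm_triangle_ineq[of 1 "\<i> * complex_of_real \<eta>"] by (simp add: norm_mult)
    finally have "s * cmod (r - 1) \<le> s * (q * (1 + \<bar>\<eta>\<bar>))"
      using s by (intro mult_left_mono) auto
    also have "\<dots> = 1 / D * (1 + \<bar>\<eta>\<bar>)" by (simp only: mult.assoc[symmetric] q)
    also have "\<dots> \<le> L * (1 + \<bar>\<eta>\<bar>)" using D by (intro mult_right_mono) auto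
    finally show ?thesis .
  qed
  have nr: "cmod r \<le> 1" unfolding r_def using q by simp
  have den: "m \<le> cmod (1 + of_real t * r)" "m \<le> cmod (1 - of_real t * r)"
  proof -
    have "cmod (of_real t * r) \<le> \<tau> * 1"
      unfolding norm_mult using t nr by (intro mult_mono) auto
    then show "m \<le> cmod (1 + of_real t * r)" "m \<le> cmod (1 - of_real t * r)"
      using norm_triangle_ineq2[of 1 "of_real t * r"] norm_triangle_ineq2[of 1 "- (of_real t * r)"] by (auto simp: m_def)
  qed
  have fr: "cmod (of_real (1 - t) / (1 + of_real t * r)) \<le> 1 / m" "cmod (of_real (1 + t) / (1 - of_real t * r)) \<le> 2 / m"
    unfolding norm_divide norm_of_real using t m den by (auto intro!: frac_le)
  define G where "G = (\<lambda>(v::real) \<zeta>. 2 * of_real v * \<zeta> + \<zeta>\<^sup>2 / complex_of_real s)"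
  have sq: "(of_real v + \<zeta> / of_real s)\<^sup>2 - (of_real v)\<^sup>2 = G v \<zeta> / of_real s" for v \<zeta>
    using s by (simp add: G_def power2_eq_square field_simps)
  have Gb: "cmod (G v \<zeta>) \<le> 2 * L * K + K\<^sup>2" if "\<bar>v\<bar> \<le> L" "cmod \<zeta> \<le> K" for v \<zeta>
  proof -
    have "cmod (G v \<zeta>) \<le> 2 * \<bar>v\<bar> * cmod \<zeta> + (cmod \<zeta>)\<^sup>2 / s"
      unfolding G_def using s by (intro order_trans[OF norm_triangle_ineq]) (simp add: norm_mult norm_divide norm_power)
    also have "\<dots> \<le> 2 * L * K + K\<^sup>2 / 1"
      using that s L K0 by (intro add_mono mult_mono frac_le power_mono) auto
    finally show ?thesis by simp
  qed
  define F where "F = G x \<xi> * (of_real (1 - t) / (1 + of_real t * r)) + G y \<upsilon> * (of_real (1 + t) / (1 - of_real t * r))"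
  \<comment> \<open>The 3 collects the bounds \<open>1 / m\<close> and \<open>2 / m\<close> of the
    two fractions.\<close>
  have Fb: "cmod F \<le> 3 * (2 * L * K + K\<^sup>2) / m"
  proof -
    have "cmod F \<le> (2 * L * K + K\<^sup>2) * (1 / m) + (2 * L * K + K\<^sup>2) * (2 / m)"
      unfolding F_def using Gb[OF xy(1) K(1)] Gb[OF xy(2) K(2)] fr L K0
      by (intro order_trans[OF norm_triangle_ineq] add_mono) (auto simp only: norm_mult intro!: mult_mono, auto)
    then show ?thesis by (simp add: add_divide_distrib[symmetric] distrib_left mult.commute[of K L])
  qed
  have "exponent_factor t X Y r - exponent_factor t (of_real x) (of_real y) r = F / of_real s"
    unfolding exponent_factor_def X_def Y_def s_def[symmetric] F_def add_divide_distrib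
    by (simp only: times_divide_eq_left[symmetric] sq[symmetric]) (simp only: left_diff_distrib add_diff_add)
  then have "of_nat n * ((r - 1) * exponent_factor t X Y r) - of_nat n * ((r - 1) * exponent_factor t (of_real x) (of_real y) r)
      = of_nat n * ((r - 1) * (F / of_real s))"
    by (simp only: right_diff_distrib[symmetric])
  also have "\<dots> = (of_real s * (r - 1)) * F"
  proof -
    have "of_nat n = complex_of_real s * of_real s" using s(2) by (metis of_real_mult of_real_of_nat_eq)
    then show ?thesis using s by simp
  qed
  also have "cmod \<dots> \<le> (L * (1 + \<bar>\<eta>\<bar>)) * (3 * (2 * L * K + K\<^sup>2) / m)"
    unfolding norm_mult[of _ F] using r1 Fb s L by (intro mult_mono) (auto simp: norm_mult)
  finally show ?thesis
    by (simp add: L_def mult_ac)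
qed

text \<open>One Gaussian majorant for all parameters at once, so that dominated convergence applies
  along any sequence of parameters. The explicit variables \<open>q\<close> and \<open>r\<close>
  stand for the radius exponent and the point on the circle.\<close>

lemma edge_integrand_domination:
  assumes \<tau>: "0 \<le> \<tau>" "\<tau> < 1" and "0 \<le> K"
  shows "\<exists>C \<kappa>. 0 \<le> C \<and> 0 < \<kappa> \<and> (\<forall>t x y n \<xi> \<upsilon> \<eta> q r. 0 \<le> t \<longrightarrow> t \<le> \<tau> \<longrightarrow> ellipse_form t x y = 1 \<longrightarrow> 0 < n \<longrightarrow>
     cmod \<xi> \<le> K \<longrightarrow> cmod \<upsilon> \<le> K \<longrightarrow> q = 1 / (ellipse_gradient t x y * sqrt (real n)) \<longrightarrow> \<bar>\<eta>\<bar> \<le> pi / q \<longrightarrow>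
     r = exp (- (of_real q * (1 + \<i> * complex_of_real \<eta>))) \<longrightarrow>
     cmod (prefactor t r * exp (of_nat n * ((r - 1) * exponent_factor t (of_real x + \<xi> / of_real (sqrt (real n)))
        (of_real y + \<upsilon> / of_real (sqrt (real n))) r)) / r ^ n) \<le> C * exp (- \<kappa> * \<eta>\<^sup>2))"
proof -
  define m where "m = 1 - \<tau>"
  have m: "0 < m" using \<tau> by (simp add: m_def)
  define a where "a = m\<^sup>2 / 8 * exp (- sqrt (2 / m)) * m * (m / 2) / 18"
  define b where "b = sqrt (2 / m) * (3 * (2 * sqrt (2 / m) * K + K\<^sup>2) / m)"
  define c where "c = 2 / m * (1 + 1 / m)"
  \<comment> \<open>The term \<open>b\<^sup>2 / (2 * a)\<close> comes from completing the square:
    half of the quadratic decay \<open>a * \<eta>\<^sup>2\<close> absorbs the linear growth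
    \<open>b * \<bar>\<eta>\<bar>\<close>.\<close>
  define C where "C = m powr (- (1 / 2)) * exp (c + b + b\<^sup>2 / (2 * a))"
  have a: "0 < a" using m by (simp add: a_def)
  have main: "cmod (prefactor t r * exp (of_nat n * ((r - 1) * exponent_factor t X Y r)) / r ^ n) \<le> C * exp (- (a / 2) * \<eta>\<^sup>2)"
    if A: "0 \<le> t" "t \<le> \<tau>" "ellipse_form t x y = 1" "0 < n" "cmod \<xi> \<le> K" "cmod \<upsilon> \<le> K"
      and q: "q = 1 / (ellipse_gradient t x y * sqrt (real n))" and \<eta>: "\<bar>\<eta>\<bar> \<le> pi / q"
      and r: "r = exp (- (of_real q * (1 + \<i> * complex_of_real \<eta>)))"
      and X: "X = of_real x + \<xi> / of_real (sqrt (real n))" and Y: "Y = of_real y + \<upsilon> / of_real (sqrt (real n))"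
    for t x y n \<xi> \<upsilon> \<eta> q r X Y
  proof -
    define e e0 where "e = of_nat n * ((r - 1) * exponent_factor t X Y r)"
      and "e0 = of_nat n * ((r - 1) * exponent_factor t (of_real x) (of_real y) r)"
    have q0: "0 < q" using ellipse_bounds(5)[OF A(1,2) \<tau>(2) A(3)] A(4) by (simp add: q)
    have 1: "Re e0 + real n * q \<le> c - a * \<eta>\<^sup>2"
      using Re_exponent_le[OF A(1,2) \<tau>(2) A(3,4) \<eta>[unfolded q]]
      unfolding e0_def c_def a_def m_def r q .
    have "cmod (e - e0) \<le> (1 + \<bar>\<eta>\<bar>) * b"
      using exponent_perturbation_le[OF A(1,2) \<tau>(2) A(3,4,5,6), of \<eta>]
      unfolding e_def e0_def b_def m_def r q X Y .
    then have 2: "Re e - Re e0 \<le> (1 + \<bar>\<eta>\<bar>) * b"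
      using complex_Re_le_cmod[of "e - e0"] minus_complex.sel(1)[of e e0] by linarith
    have "0 \<le> (a * \<bar>\<eta>\<bar> - b)\<^sup>2 / (2 * a)" using a by simp
    also have "\<dots> = (a / 2) * \<eta>\<^sup>2 - b * \<bar>\<eta>\<bar> + b\<^sup>2 / (2 * a)"
    proof -
      have "(a * z - b)\<^sup>2 / (2 * a) = (a / 2) * (z * z) - b * z + b\<^sup>2 / (2 * a)" for z
        using a by (simp add: field_simps power2_eq_square)
      from this[of "\<bar>\<eta>\<bar>"] show ?thesis by (simp only: abs_mult_self_eq power2_eq_square)
    qed
    finally have "b * \<bar>\<eta>\<bar> \<le> (a / 2) * \<eta>\<^sup>2 + b\<^sup>2 / (2 * a)" by simp
    moreover have "(1 + \<bar>\<eta>\<bar>) * b = b + b * \<bar>\<eta>\<bar>" by (simp add: distrib_right)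
    moreover have "a * \<eta>\<^sup>2 = (a / 2) * \<eta>\<^sup>2 + (a / 2) * \<eta>\<^sup>2" by simp
    ultimately have "Re e + real n * q \<le> (c + b + b\<^sup>2 / (2 * a)) + (- (a / 2) * \<eta>\<^sup>2)"
      using 1 2 by linarith
    then have 3: "exp (Re e + real n * q) \<le> exp (c + b + b\<^sup>2 / (2 * a)) * exp (- (a / 2) * \<eta>\<^sup>2)"
      unfolding exp_add[symmetric] exp_le_cancel_iff .
    have nr: "cmod r = exp (- q)" by (simp add: r)
    then have nrn: "cmod (r ^ n) = exp (- (real n * q))"
      unfolding norm_power nr exp_of_nat_mult[symmetric] by simp
    have 4: "cmod (prefactor t r) \<le> m powr (- (1 / 2))"
      unfolding m_def using A \<tau> nr q0 by (intro prefactor_bound) auto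
    have "cmod (prefactor t r * exp e / r ^ n) = cmod (prefactor t r) * exp (Re e + real n * q)"
      unfolding norm_divide norm_mult nrn by (simp only: exp_add exp_minus divide_inverse norm_exp_eq_Re inverse_inverse_eq mult.assoc)
    also have "\<dots> \<le> m powr (- (1 / 2)) * (exp (c + b + b\<^sup>2 / (2 * a)) * exp (- (a / 2) * \<eta>\<^sup>2))"
      using 3 4 by (intro mult_mono) auto
    finally show ?thesis unfolding C_def e_def by (simp only: mult.assoc)
  qed
  show ?thesis
  proof (rule exI[of _ C], rule exI[of _ "a / 2"], intro conjI allI impI)
    show "0 \<le> C" by (simp add: C_def)
    show "0 < a / 2" using a by simp
  qed (rule main; (assumption | rule refl))
qed

section \<open>Pointwise limit of the edge integrand\<close>

lemma tendsto_exp_quotients: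
  fixes h :: "nat \<Rightarrow> complex"
  assumes h: "h \<longlonglongrightarrow> 0" and nz: "\<And>j. h j \<noteq> 0"
  shows "(\<lambda>j. (exp (h j) - 1) / h j) \<longlonglongrightarrow> 1"
    and "(\<lambda>j. (exp (h j) - 1 - h j) / (h j)\<^sup>2) \<longlonglongrightarrow> 1 / 2"
proof -
  have T: "cmod (exp z - (\<Sum>k\<le>2. z ^ k / fact k)) \<le> exp \<bar>Re z\<bar> * cmod z ^ Suc 2 / fact 2" for z
    by (rule Taylor_exp)
  have S: "(\<Sum>k\<le>2. z ^ k / fact k) = 1 + z + z\<^sup>2 / 2" for z :: complex
    by (simp add: numeral_2_eq_2)
  have bnd: "cmod ((exp (h j) - 1 - h j) / (h j)\<^sup>2 - 1 / 2) \<le> exp \<bar>Re (h j)\<bar> * cmod (h j) / 2" for j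
  proof -
    have "(exp (h j) - 1 - h j) / (h j)\<^sup>2 - 1 / 2 = (exp (h j) - (1 + h j + (h j)\<^sup>2 / 2)) / (h j)\<^sup>2"
      using nz[of j] by (simp add: diff_divide_distrib add_divide_distrib)
    also have "cmod \<dots> \<le> (exp \<bar>Re (h j)\<bar> * cmod (h j) ^ Suc 2 / fact 2) / (cmod (h j))\<^sup>2"
      unfolding norm_divide norm_power using T[of "h j"] unfolding S by (intro divide_right_mono) auto
    also have "\<dots> = exp \<bar>Re (h j)\<bar> * cmod (h j) / 2"
      using nz[of j] by (simp add: power2_eq_square power3_eq_cube)
    finally show ?thesis .
  qed
  have "(\<lambda>j. exp \<bar>Re (h j)\<bar> * cmod (h j) / 2) \<longlonglongrightarrow> exp \<bar>Re 0\<bar> * cmod 0 / 2"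
    by (intro tendsto_intros h) auto
  then have "(\<lambda>j. exp \<bar>Re (h j)\<bar> * cmod (h j) / 2) \<longlonglongrightarrow> 0" by simp
  then have "(\<lambda>j. (exp (h j) - 1 - h j) / (h j)\<^sup>2 - 1 / 2) \<longlonglongrightarrow> 0"
    by (rule Lim_null_comparison[rotated]) (use bnd in auto)
  then show 2: "(\<lambda>j. (exp (h j) - 1 - h j) / (h j)\<^sup>2) \<longlonglongrightarrow> 1 / 2"
    by (rule LIM_zero_cancel)
  have "(\<lambda>j. 1 + h j * ((exp (h j) - 1 - h j) / (h j)\<^sup>2)) \<longlonglongrightarrow> 1 + 0 * (1 / 2)"
    by (intro tendsto_intros h 2)
  moreover have "1 + h j * ((exp (h j) - 1 - h j) / (h j)\<^sup>2) = (exp (h j) - 1) / h j" for j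
    using nz[of j] by (simp add: field_simps power2_eq_square)
  ultimately show "(\<lambda>j. (exp (h j) - 1) / h j) \<longlonglongrightarrow> 1" by simp
qed

text \<open>With \<open>r = exp h\<close> and \<open>R = sqrt N\<close> the phase is
  \<open>N * (r - 1 - h) + (R * (r - 1)) * (R * (B - 1))\<close>. Each of the three factors built
  with \<open>R\<close> or \<open>N\<close> has a limit, because \<open>R * h = - s / D\<close> and
  because \<open>B - 1\<close> is of order \<open>1 / R\<close> on the ellipse.\<close>

lemma edge_integrand_tendsto:
  fixes N :: "nat \<Rightarrow> nat" and t x y :: "nat \<Rightarrow> real" and \<xi> \<upsilon> :: "nat \<Rightarrow> complex" and \<eta> :: real
  assumes N: "filterlim N at_top sequentially" "\<And>j. 0 < N j"
    and t: "\<And>j. 0 \<le> t j" "\<And>j. t j \<le> \<tau>" "\<tau> < 1"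
    and E: "\<And>j. ellipse_form (t j) (x j) (y j) = 1"
    and lims: "t \<longlonglongrightarrow> t0" "x \<longlonglongrightarrow> x0" "y \<longlonglongrightarrow> y0" "\<xi> \<longlonglongrightarrow> \<xi>0" "\<upsilon> \<longlonglongrightarrow> \<upsilon>0"
    and \<gamma>: "\<gamma> = 2 * (of_real (x0 * ((1 - t0) / (1 + t0))) * \<xi>0 + of_real (y0 * ((1 + t0) / (1 - t0))) * \<upsilon>0) / of_real (ellipse_gradient t0 x0 y0)"
    and q: "\<And>j. q j = 1 / (ellipse_gradient (t j) (x j) (y j) * sqrt (real (N j)))"
    and r: "\<And>j. r j = exp (- (of_real (q j) * (1 + \<i> * complex_of_real \<eta>)))"
    and X: "\<And>j. X j = of_real (x j) + \<xi> j / of_real (sqrt (real (N j)))"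
    and Y: "\<And>j. Y j = of_real (y j) + \<upsilon> j / of_real (sqrt (real (N j)))"
  shows "(\<lambda>j. prefactor (t j) (r j) * exp (of_nat (N j) * ((r j - 1) * exponent_factor (t j) (X j) (Y j) (r j))) / r j ^ N j *
      ((1 - r j ^ N j) * (of_real (q j) * r j / (1 - r j)))) \<longlonglongrightarrow>
     exp ((1 + \<i> * complex_of_real \<eta>)\<^sup>2 / 2 - \<gamma> * (1 + \<i> * complex_of_real \<eta>)) / (1 + \<i> * complex_of_real \<eta>)"
proof -
  define s where "s = 1 + \<i> * complex_of_real \<eta>"
  have s: "s \<noteq> 0" "Re s = 1" by (auto simp: s_def complex_eq_iff)
  define D where "D = (\<lambda>j. ellipse_gradient (t j) (x j) (y j))"
  define D0 where "D0 = ellipse_gradient t0 x0 y0"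
  define R where "R = (\<lambda>j. sqrt (real (N j)))"
  have t0: "0 \<le> t0" "t0 \<le> \<tau>"
    using LIMSEQ_le_const[OF lims(1)] LIMSEQ_le_const2[OF lims(1)] t by auto
  have t01: "1 - t0 \<noteq> 0" "1 + t0 \<noteq> 0" using t0 t(3) by auto
  have "(\<lambda>j. ellipse_form (t j) (x j) (y j)) \<longlonglongrightarrow> ellipse_form t0 x0 y0"
    unfolding ellipse_form_def using t01 by (intro tendsto_intros lims)
  then have E0: "ellipse_form t0 x0 y0 = 1"
    unfolding E by (simp add: LIMSEQ_const_iff)
  have D: "D \<longlonglongrightarrow> D0"
    unfolding D_def D0_def ellipse_gradient_def using t01 by (intro tendsto_intros lims)
  have Dpos: "0 < D j" for j
    unfolding D_def by (rule ellipse_bounds(5)[OF t(1,2,3) E])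
  have D0: "0 < D0" "D0 \<noteq> 0"
    using ellipse_bounds(5)[OF t0 t(3) E0] by (auto simp: D0_def)
  have R: "filterlim R at_top sequentially"
    unfolding R_def using N(1)
    by (intro filterlim_compose[OF sqrt_at_top] filterlim_compose[OF filterlim_real_sequentially])
  have Rpos: "0 < R j" for j using N(2)[of j] by (simp add: R_def)
  have Rc0: "(\<lambda>j. inverse (complex_of_real (R j))) \<longlonglongrightarrow> 0"
    using tendsto_of_real[OF tendsto_inverse_0_at_top[OF R], where 'a = complex] by simp
  have qj: "q j = 1 / (D j * R j)" for j by (simp add: q D_def R_def)
  have qpos: "0 < q j" for j using Dpos[of j] Rpos[of j] by (simp add: qj)
  have q0: "q \<longlonglongrightarrow> 0"
  proof -
    have "(\<lambda>j. inverse (D j) * inverse (R j)) \<longlonglongrightarrow> inverse D0 * 0"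
      using D0(2) by (intro tendsto_intros D tendsto_inverse_0_at_top[OF R])
    then show ?thesis by (simp add: qj[abs_def] divide_inverse)
  qed
  define h where "h = (\<lambda>j. - (of_real (q j) * s))"
  have rh: "r j = exp (h j)" for j by (simp add: r h_def s_def)
  have hnz: "h j \<noteq> 0" for j using qpos[of j] s by (simp add: h_def)
  have h0: "h \<longlonglongrightarrow> 0"
  proof -
    have "(\<lambda>j. - (complex_of_real (q j) * s)) \<longlonglongrightarrow> - (of_real 0 * s)"
      by (intro tendsto_intros q0)
    then show ?thesis by (simp add: h_def)
  qed
  note eq = tendsto_exp_quotients[OF h0 hnz, folded rh]
  have r1: "r \<longlonglongrightarrow> 1"
    using tendsto_exp[OF h0] by (simp add: rh[abs_def])
  have rne: "r j \<noteq> 1" for j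
  proof -
    have "cmod (r j) < 1" using qpos[of j] s by (simp add: rh h_def)
    then show ?thesis by auto
  qed
  have Rh: "of_real (R j) * h j = - s / of_real (D j)" for j
    using Rpos[of j] Dpos[of j] by (simp add: h_def qj)
  have Re: "(\<lambda>j. of_real (R j) * (r j - 1)) \<longlonglongrightarrow> - s / of_real D0"
  proof -
    have "(\<lambda>j. - s / of_real (D j) * ((r j - 1) / h j)) \<longlonglongrightarrow> - s / of_real D0 * 1"
      using D0(2) by (intro tendsto_intros D eq) auto
    moreover have "- s / of_real (D j) * ((r j - 1) / h j) = of_real (R j) * (r j - 1)" for j
      unfolding Rh[symmetric] using hnz[of j] by simp
    ultimately show ?thesis by simp
  qed
  have NR: "of_nat (N j) = complex_of_real (R j) * of_real (R j)" for j
  proof -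
    have "R j * R j = real (N j)" by (simp add: R_def)
    then show ?thesis by (metis of_real_mult of_real_of_nat_eq)
  qed
  have Neh: "(\<lambda>j. of_nat (N j) * (r j - 1 - h j)) \<longlonglongrightarrow> (s / of_real D0)\<^sup>2 / 2"
  proof -
    have "(\<lambda>j. (- s / of_real (D j))\<^sup>2 * ((r j - 1 - h j) / (h j)\<^sup>2)) \<longlonglongrightarrow> (- s / of_real D0)\<^sup>2 * (1 / 2)"
      using D0(2) by (intro tendsto_intros D eq) auto
    moreover have "(- s / of_real (D j))\<^sup>2 * ((r j - 1 - h j) / (h j)\<^sup>2) = of_nat (N j) * (r j - 1 - h j)" for j
      unfolding Rh[symmetric] NR power_mult_distrib using hnz[of j] by (simp add: power2_eq_square)
    ultimately show ?thesis by simp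
  qed
  define T T0 where "T = (\<lambda>j. complex_of_real (t j))" and "T0 = complex_of_real t0"
  have T: "T \<longlonglongrightarrow> T0" unfolding T_def T0_def by (intro tendsto_intros lims)
  have T01: "1 - T0 \<noteq> 0" "1 + T0 \<noteq> 0"
    using t01 unfolding T0_def by (metis of_real_eq_0_iff of_real_diff of_real_1, metis of_real_eq_0_iff of_real_add of_real_1)
  have Tj: "1 - T j \<noteq> 0" "1 + T j \<noteq> 0" "1 - T j * r j \<noteq> 0" "1 + T j * r j \<noteq> 0" for j
  proof -
    have "cmod (T j) < 1" using t(1)[of j] t(2)[of j] t(3) by (simp add: T_def)
    moreover have "cmod (T j * r j) < 1"
    proof -
      have "cmod (r j) \<le> 1" using qpos[of j] s by (simp add: rh h_def)
      then have "cmod (T j) * cmod (r j) \<le> cmod (T j) * 1" by (intro mult_left_mono) auto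
      with calculation show ?thesis by (simp add: norm_mult)
    qed
    ultimately show "1 - T j \<noteq> 0" "1 + T j \<noteq> 0" "1 - T j * r j \<noteq> 0" "1 + T j * r j \<noteq> 0"
      by (auto simp: add_eq_0_iff)
  qed
  define a b where "a = (\<lambda>j. (1 - T j) / (1 + T j * r j))" and "b = (\<lambda>j. (1 + T j) / (1 - T j * r j))"
  have ab: "a \<longlonglongrightarrow> (1 - T0) / (1 + T0 * 1)" "b \<longlonglongrightarrow> (1 + T0) / (1 - T0 * 1)"
    unfolding a_def b_def using T01 by (intro tendsto_intros T r1; simp)+
  define G where "G = (\<lambda>j v \<zeta>. 2 * complex_of_real v * \<zeta> + \<zeta>\<^sup>2 * inverse (of_real (R j)))"
  define B where "B = (\<lambda>j. exponent_factor (t j) (X j) (Y j) (r j))"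
  define e where "e = (\<lambda>j. of_real (R j) * (r j - 1))"
  \<comment> \<open>The first two terms come from moving \<open>r\<close> away from 1, the last two
    from displacing the points. The constant 1 is removed by
    \<open>ellipse_form = 1\<close>.\<close>
  have RB: "of_real (R j) * (B j - 1) =
      - ((of_real (x j))\<^sup>2 * (T j * e j * (1 / (1 + T j))) * a j) + (of_real (y j))\<^sup>2 * (T j * e j * (1 / (1 - T j))) * b j
      + G j (x j) (\<xi> j) * a j + G j (y j) (\<upsilon> j) * b j" for j
  proof -
    have sq: "of_real (R j) * ((of_real v + \<zeta> / of_real (R j))\<^sup>2 - (of_real v)\<^sup>2) = G j v \<zeta>" for v \<zeta>
      using Rpos[of j] by (simp add: G_def power2_eq_square field_simps)
    have "complex_of_real (ellipse_form (t j) (x j) (y j)) = 1" by (simp add: E)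
    then have E1: "(of_real (x j))\<^sup>2 * ((1 - T j) / (1 + T j)) + (of_real (y j))\<^sup>2 * ((1 + T j) / (1 - T j)) = 1"
      by (simp add: ellipse_form_def T_def)
    have d1: "a j - (1 - T j) / (1 + T j) = - (T j * (r j - 1) * (1 / (1 + T j)) * a j)"
      and d2: "b j - (1 + T j) / (1 - T j) = T j * (r j - 1) * (1 / (1 - T j)) * b j"
    proof -
      have "(1 - T j) / P - (1 - T j) / Q = - ((P - Q) * (1 / Q) * ((1 - T j) / P))"
        "(1 + T j) / P - (1 + T j) / Q = (Q - P) * (1 / Q) * ((1 + T j) / P)" if "P \<noteq> 0" "Q \<noteq> 0" for P Q
        using that by (simp_all add: field_simps)
      note this(1)[OF Tj(4,2)[of j]] this(2)[OF Tj(3,1)[of j]]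
      moreover have "1 + T j * r j - (1 + T j) = T j * (r j - 1)" "1 - T j - (1 - T j * r j) = T j * (r j - 1)"
        by (simp_all add: right_diff_distrib)
      ultimately show "a j - (1 - T j) / (1 + T j) = - (T j * (r j - 1) * (1 / (1 + T j)) * a j)"
        "b j - (1 + T j) / (1 - T j) = T j * (r j - 1) * (1 / (1 - T j)) * b j"
        unfolding a_def b_def by simp_all
    qed
    have "B j - 1 = ((X j)\<^sup>2 * a j + (Y j)\<^sup>2 * b j) - ((of_real (x j))\<^sup>2 * ((1 - T j) / (1 + T j)) + (of_real (y j))\<^sup>2 * ((1 + T j) / (1 - T j)))"
      unfolding E1 by (simp add: B_def exponent_factor_def a_def b_def T_def)
    also have "\<dots> = (of_real (x j))\<^sup>2 * (a j - (1 - T j) / (1 + T j)) + (of_real (y j))\<^sup>2 * (b j - (1 + T j) / (1 - T j))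
        + ((X j)\<^sup>2 - (of_real (x j))\<^sup>2) * a j + ((Y j)\<^sup>2 - (of_real (y j))\<^sup>2) * b j"
      by (simp only: right_diff_distrib left_diff_distrib) simp
    finally have "of_real (R j) * (B j - 1) = of_real (R j) * \<dots>" by simp
    also have "\<dots> = (of_real (x j))\<^sup>2 * (of_real (R j) * (a j - (1 - T j) / (1 + T j))) + (of_real (y j))\<^sup>2 * (of_real (R j) * (b j - (1 + T j) / (1 - T j)))
        + (of_real (R j) * ((X j)\<^sup>2 - (of_real (x j))\<^sup>2)) * a j + (of_real (R j) * ((Y j)\<^sup>2 - (of_real (y j))\<^sup>2)) * b j"
      by (simp only: distrib_left mult_ac)
    also have "of_real (R j) * ((X j)\<^sup>2 - (of_real (x j))\<^sup>2) = G j (x j) (\<xi> j)"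
      unfolding X R_def[symmetric] using sq[of "x j" "\<xi> j"] by (simp add: R_def)
    also have "of_real (R j) * ((Y j)\<^sup>2 - (of_real (y j))\<^sup>2) = G j (y j) (\<upsilon> j)"
      unfolding Y R_def[symmetric] using sq[of "y j" "\<upsilon> j"] by (simp add: R_def)
    finally show ?thesis
      unfolding d1 d2 e_def by (simp add: mult_ac)
  qed
  define C C' where "C = (1 - T0) / (1 + T0)" and "C' = (1 + T0) / (1 - T0)"
  define H where "H = - ((of_real x0)\<^sup>2 * (T0 * (1 / (1 + T0))) * C) + (of_real y0)\<^sup>2 * (T0 * (1 / (1 - T0))) * C'"
  define S where "S = 2 * of_real x0 * \<xi>0 * C + 2 * of_real y0 * \<upsilon>0 * C'"
  have "(\<lambda>j. of_real (R j) * (B j - 1)) \<longlonglongrightarrow>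
      - ((of_real x0)\<^sup>2 * (T0 * (- s / of_real D0) * (1 / (1 + T0))) * ((1 - T0) / (1 + T0 * 1)))
      + (of_real y0)\<^sup>2 * (T0 * (- s / of_real D0) * (1 / (1 - T0))) * ((1 + T0) / (1 - T0 * 1))
      + (2 * complex_of_real x0 * \<xi>0 + \<xi>0\<^sup>2 * 0) * ((1 - T0) / (1 + T0 * 1)) + (2 * complex_of_real y0 * \<upsilon>0 + \<upsilon>0\<^sup>2 * 0) * ((1 + T0) / (1 - T0 * 1))"
    unfolding RB G_def e_def using T01 by (intro tendsto_intros ab lims T Re Rc0)
  then have RBlim: "(\<lambda>j. of_real (R j) * (B j - 1)) \<longlonglongrightarrow> (- s / of_real D0) * H + S"
  proof (rule tendsto_eq_rhs)
    have c: "(1 - T0) / (1 + T0 * 1) = C" "(1 + T0) / (1 - T0 * 1) = C'"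
      by (simp_all add: C_def C'_def)
    have gen: "- (P * (T0 * w * u) * C) + Q * (T0 * w * v) * C' + k * C + l * C'
        = w * (- (P * (T0 * u) * C) + Q * (T0 * v) * C') + (k * C + l * C')" for P Q u v w k l
      by (simp add: algebra_simps)
    show "- ((of_real x0)\<^sup>2 * (T0 * (- s / of_real D0) * (1 / (1 + T0))) * ((1 - T0) / (1 + T0 * 1)))
      + (of_real y0)\<^sup>2 * (T0 * (- s / of_real D0) * (1 / (1 - T0))) * ((1 + T0) / (1 - T0 * 1))
      + (2 * complex_of_real x0 * \<xi>0 + \<xi>0\<^sup>2 * 0) * ((1 - T0) / (1 + T0 * 1)) + (2 * complex_of_real y0 * \<upsilon>0 + \<upsilon>0\<^sup>2 * 0) * ((1 + T0) / (1 - T0 * 1))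
      = (- s / of_real D0) * H + S"
      unfolding c gen H_def S_def by (simp only: mult_zero_right add_0_right)
  qed
  \<comment> \<open>\<open>H\<close> is the derivative of \<open>exponent_factor\<close> at
    \<open>r = 1\<close>. This identity is the reason for putting the gradient into
    \<open>q\<close>: it makes the quadratic coefficient in the limit exactly 1/2.\<close>
  have D02: "1 / 2 + H = (of_real D0)\<^sup>2 / 2"
  proof -
    have "D0\<^sup>2 = x0\<^sup>2 * ((1 - t0) / (1 + t0))\<^sup>2 + y0\<^sup>2 * ((1 + t0) / (1 - t0))\<^sup>2"
      unfolding D0_def ellipse_gradient_def by (intro real_sqrt_pow2) auto
    then have "complex_of_real (D0\<^sup>2) = (of_real x0)\<^sup>2 * C\<^sup>2 + (of_real y0)\<^sup>2 * C'\<^sup>2"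
      by (simp add: C_def C'_def T0_def)
    moreover have "1 = (of_real x0)\<^sup>2 * C + (of_real y0)\<^sup>2 * C'"
      using arg_cong[OF E0, of complex_of_real] by (simp add: ellipse_form_def C_def C'_def T0_def)
    moreover have "C = 1 - 2 * (T0 * (1 / (1 + T0)))" "C' = 1 + 2 * (T0 * (1 / (1 - T0)))"
      using T01 by (simp_all add: C_def C'_def divide_simps)
    moreover have "1 / 2 + (- (P * u * c) + Q * v * c') = (P * c\<^sup>2 + Q * c'\<^sup>2) / 2"
      if "1 = P * c + Q * c'" "c = 1 - 2 * u" "c' = 1 + 2 * v" for P Q c c' u v :: complex
    proof -
      have "1 + 2 * (- (P * u * c) + Q * v * c') = P * c\<^sup>2 + Q * c'\<^sup>2"
        using that by algebra
      then show ?thesis by (simp add: field_simps)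
    qed
    ultimately show ?thesis
      unfolding H_def by (metis of_real_power)
  qed
  have "(\<lambda>j. of_nat (N j) * (r j - 1 - h j) + e j * (of_real (R j) * (B j - 1))) \<longlonglongrightarrow>
      (s / of_real D0)\<^sup>2 / 2 + (- s / of_real D0) * ((- s / of_real D0) * H + S)"
    unfolding e_def by (intro tendsto_intros Neh Re RBlim)
  also have "(\<lambda>j. of_nat (N j) * (r j - 1 - h j) + e j * (of_real (R j) * (B j - 1))) = (\<lambda>j. of_nat (N j) * ((r j - 1) * B j) - of_nat (N j) * h j)"
    by (rule ext) (simp add: e_def NR algebra_simps)
  also have "(s / of_real D0)\<^sup>2 / 2 + (- s / of_real D0) * ((- s / of_real D0) * H + S) = s\<^sup>2 / 2 - \<gamma> * s"
  proof -
    have "(s / of_real D0)\<^sup>2 / 2 + (- s / of_real D0) * ((- s / of_real D0) * H + S) = (s / of_real D0)\<^sup>2 * (1 / 2 + H) - s * (S / of_real D0)"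
    proof -
      have "w\<^sup>2 / 2 + (- w) * ((- w) * H + S) = w\<^sup>2 * (1 / 2 + H) - w * S" for w
        by (simp add: power2_eq_square algebra_simps)
      from this[of "s / of_real D0"] show ?thesis by simp
    qed
    also have "\<dots> = s\<^sup>2 / 2 - s * (S / of_real D0)"
      unfolding D02 using D0(2) by (simp add: power_divide)
    also have "S / of_real D0 = \<gamma>"
      unfolding \<gamma> D0_def[symmetric] S_def C_def C'_def T0_def by (simp add: mult_ac distrib_left)
    finally show ?thesis by (simp add: mult.commute)
  qed
  finally have expo: "(\<lambda>j. of_nat (N j) * ((r j - 1) * B j) - of_nat (N j) * h j) \<longlonglongrightarrow> s\<^sup>2 / 2 - \<gamma> * s" .
  have pref: "(\<lambda>j. prefactor (t j) (r j)) \<longlonglongrightarrow> 1"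
  proof -
    have tt: "t0\<^sup>2 < 1" using t0 t(3) by (simp add: abs_square_less_1)
    have nn: "1 - (complex_of_real t0)\<^sup>2 = of_real (1 - t0\<^sup>2)" by simp
    have np: "1 - (complex_of_real t0 * 1)\<^sup>2 \<notin> \<real>\<^sub>\<le>\<^sub>0" "1 - (complex_of_real t0)\<^sup>2 \<notin> \<real>\<^sub>\<le>\<^sub>0"
      unfolding mult_1_right nn complex_nonpos_Reals_iff using tt by auto
    have "(\<lambda>j. prefactor (t j) (r j)) \<longlonglongrightarrow> (1 - (of_real t0 * 1)\<^sup>2) powr (- (1 / 2)) / (1 - (of_real t0)\<^sup>2) powr (- (1 / 2))"
      unfolding prefactor_def using np by (intro tendsto_intros lims r1 tendsto_powr_complex) (auto simp: powr_eq_0_iff)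
    moreover have "(1 - (complex_of_real t0)\<^sup>2) \<noteq> 0" using np(2) by force
    ultimately show ?thesis by simp
  qed
  have rN: "r j ^ N j = exp (of_nat (N j) * h j)" for j by (simp add: rh exp_of_nat_mult)
  \<comment> \<open>\<open>N * q\<close> grows like \<open>sqrt N\<close>, so the upper end of the
    geometric sum contributes nothing and only the pole remains.\<close>
  have rN0: "(\<lambda>j. r j ^ N j) \<longlonglongrightarrow> 0"
  proof (rule tendsto_norm_zero_cancel)
    have "filterlim (\<lambda>j. inverse (D j) * R j) at_top sequentially"
      using D0 by (intro filterlim_tendsto_pos_mult_at_top[OF tendsto_inverse[OF D] _ R]) auto
    then have "(\<lambda>j. exp (- (inverse (D j) * R j))) \<longlonglongrightarrow> 0"
      by (intro filterlim_compose[OF exp_at_bot] filterlim_compose[OF filterlim_uminus_at_bot_at_top])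
    moreover have "norm (r j ^ N j) = exp (- (inverse (D j) * R j))" for j
    proof -
      have "of_nat (N j) * h j = of_real (R j) * (of_real (R j) * h j)" by (simp add: NR)
      also have "\<dots> = - (of_real (inverse (D j) * R j) * s)" unfolding Rh by (simp add: divide_inverse)
      finally have eq: "of_nat (N j) * h j = - (of_real (inverse (D j) * R j) * s)" .
      have "Re (of_real c * s) = c" for c using s by simp
      then show ?thesis unfolding rN eq norm_exp_eq_Re by (simp only: uminus_complex.sel)
    qed
    ultimately show "(\<lambda>j. norm (r j ^ N j)) \<longlonglongrightarrow> 0" by simp
  qed
  \<comment> \<open>The pole at \<open>r = 1\<close> becomes the pole of \<open>1 / s\<close> at 0,
    which the contour \<open>Re s = 1\<close> avoids.\<close>
  have last: "(\<lambda>j. of_real (q j) * r j / (1 - r j)) \<longlonglongrightarrow> 1 / s"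
  proof -
    have "(\<lambda>j. r j / (s * ((r j - 1) / h j))) \<longlonglongrightarrow> 1 / (s * 1)"
      using s by (intro tendsto_intros r1 eq) auto
    moreover have "r j / (s * ((r j - 1) / h j)) = of_real (q j) * r j / (1 - r j)" for j
      using s rne[of j] qpos[of j] by (simp add: h_def divide_simps) (simp add: algebra_simps)
    ultimately show ?thesis by simp
  qed
  have "(\<lambda>j. prefactor (t j) (r j) * exp (of_nat (N j) * ((r j - 1) * B j) - of_nat (N j) * h j) * ((1 - r j ^ N j) * (of_real (q j) * r j / (1 - r j))))
     \<longlonglongrightarrow> 1 * exp (s\<^sup>2 / 2 - \<gamma> * s) * ((1 - 0) * (1 / s))"
    by (intro tendsto_intros pref expo rN0 last)
  then show ?thesis
    unfolding exp_diff rN[symmetric] B_def s_def by simp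
qed

text \<open>By Mehler's formula the denominator is the sum of the full series.\<close>

definition kernel_ratio :: "nat \<Rightarrow> real \<Rightarrow> complex \<Rightarrow> complex \<Rightarrow> complex" where
  "kernel_ratio n t w z = (\<Sum>k<n. mehler_term t (sqrt (real n * (1 - t\<^sup>2))) 1 (cnj w) z k) /
     mehler_fun t (sqrt (real n * (1 - t\<^sup>2))) 1 (cnj w) z"

lemma mehler_term_scale: "mehler_term t a (r * r') w z k = mehler_term t a r w z k * r' ^ k"
  by (simp add: mehler_term_def power_mult_distrib)

text \<open>The last factor is grouped so that it stays bounded as \<open>q\<close> tends to 0:
  \<open>q / (1 - r)\<close> is the rescaled pole, and all exponential growth is collected in the
  division by \<open>r \<eta> ^ n\<close>.\<close>

lemma kernel_ratio_eq_integral: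
  fixes q :: real
  assumes t: "0 \<le> t" "t < 1" and q: "0 < q"
  defines "r \<equiv> \<lambda>\<eta>. exp (- (of_real q * (1 + \<i> * complex_of_real \<eta>)))"
  shows "kernel_ratio n t w z = of_real (1 / (2 * pi)) *
    (\<integral>\<eta>. indicator {- (pi / q)..pi / q} \<eta> *\<^sub>R
      (prefactor t (r \<eta>) * exp (of_nat n * ((r \<eta> - 1) * exponent_factor t ((z + cnj w) / 2) ((z - cnj w) / (2 * \<i>)) (r \<eta>))) / r \<eta> ^ n *
      ((1 - r \<eta> ^ n) * (of_real q * r \<eta> / (1 - r \<eta>)))) \<partial>lborel)"
proof -
  define a where "a = sqrt (real n * (1 - t\<^sup>2))"
  have "t\<^sup>2 < 1" using t by (simp add: abs_square_less_1)
  then have a2: "a\<^sup>2 = real n * (1 - t\<^sup>2)" by (simp add: a_def)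
  define A where "A = mehler_term t a 1 (cnj w) z"
  define M where "M = mehler_fun t a 1 (cnj w) z"
  have M0: "M \<noteq> 0" unfolding M_def using t by (intro mehler_fun_nonzero) auto
  have nr: "cmod (r \<eta>) = exp (- q)" for \<eta> by (simp add: r_def)
  have r0: "r \<eta> \<noteq> 0" "1 - r \<eta> \<noteq> 0" for \<eta>
    using nr[of \<eta>] q by auto
  have tr: "t * cmod (r \<eta>) < 1" for \<eta>
  proof -
    have "t * cmod (r \<eta>) \<le> t * 1" unfolding nr using t q by (intro mult_left_mono) auto
    then show ?thesis using t by simp
  qed
  have sumM: "(\<Sum>k. A k * r \<eta> ^ k) = mehler_fun t a (r \<eta>) (cnj w) z" for \<eta>
  proof -
    have "mehler_term t a (r \<eta>) (cnj w) z sums mehler_fun t a (r \<eta>) (cnj w) z"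
      by (rule mehler_formula[OF t(1) tr])
    moreover have "mehler_term t a (r \<eta>) (cnj w) z = (\<lambda>k. A k * r \<eta> ^ k)"
      using mehler_term_scale[of t a 1 "r \<eta>" "cnj w" z] by (simp add: A_def fun_eq_iff)
    ultimately show ?thesis by (simp add: sums_iff)
  qed
  \<comment> \<open>The finite geometric sum that cuts the series at \<open>n\<close> is the source
    of the pole.\<close>
  have geo: "of_real q * (\<Sum>j<n. inverse (r \<eta>) ^ j) = (1 - r \<eta> ^ n) * (of_real q * r \<eta> / (1 - r \<eta>)) / r \<eta> ^ n" for \<eta>
  proof -
    have ne: "inverse (r \<eta>) \<noteq> 1" using r0[of \<eta>] by (metis eq_iff_diff_eq_0 inverse_eq_1_iff)
    have "(\<Sum>j<n. inverse (r \<eta>) ^ j) = (inverse (r \<eta>) ^ n - 1) / (inverse (r \<eta>) - 1)"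
      using geometric_sum[OF ne] .
    also have "inverse (r \<eta>) ^ n - 1 = (1 - r \<eta> ^ n) / r \<eta> ^ n"
      using r0[of \<eta>] by (simp add: power_inverse divide_inverse left_diff_distrib)
    also have "inverse (r \<eta>) - 1 = (1 - r \<eta>) / r \<eta>"
      using r0[of \<eta>] by (simp add: divide_inverse left_diff_distrib)
    finally show ?thesis by (simp add: mult_ac)
  qed
  have ratio: "mehler_fun t a (r \<eta>) (cnj w) z = M * (prefactor t (r \<eta>) * exp (of_nat n * ((r \<eta> - 1) * exponent_factor t ((z + cnj w) / 2) ((z - cnj w) / (2 * \<i>)) (r \<eta>))))" for \<eta>
    using mehler_fun_ratio[OF t tr a2, of \<eta> "cnj w" z] M0 unfolding M_def[symmetric] by (simp add: divide_eq_eq mult.commute)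
  have "summable (\<lambda>k. norm (A k))"
    unfolding A_def using t by (intro summable_mehler_term) auto
  then have "(\<Sum>k<n. A k) = of_real (q / (2 * pi)) * (\<integral>\<eta>. indicator {- (pi / q)..pi / q} \<eta> *\<^sub>R ((\<Sum>k. A k * r \<eta> ^ k) * (\<Sum>j<n. inverse (r \<eta>) ^ j)) \<partial>lborel)"
    unfolding r_def by (rule partial_sum_eq_integral[OF q])
  also have "complex_of_real (q / (2 * pi)) = of_real (1 / (2 * pi)) * of_real q" by simp
  also have "of_real (1 / (2 * pi)) * of_real q * (\<integral>\<eta>. indicator {- (pi / q)..pi / q} \<eta> *\<^sub>R ((\<Sum>k. A k * r \<eta> ^ k) * (\<Sum>j<n. inverse (r \<eta>) ^ j)) \<partial>lborel)
     = of_real (1 / (2 * pi)) * (\<integral>\<eta>. of_real q * (indicator {- (pi / q)..pi / q} \<eta> *\<^sub>R ((\<Sum>k. A k * r \<eta> ^ k) * (\<Sum>j<n. inverse (r \<eta>) ^ j))) \<partial>lborel)"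
    by (simp only: integral_mult_right_zero mult.assoc)
  also have "(\<lambda>\<eta>. of_real q * (indicator {- (pi / q)..pi / q} \<eta> *\<^sub>R ((\<Sum>k. A k * r \<eta> ^ k) * (\<Sum>j<n. inverse (r \<eta>) ^ j))))
      = (\<lambda>\<eta>. M * (indicator {- (pi / q)..pi / q} \<eta> *\<^sub>R (prefactor t (r \<eta>) * exp (of_nat n * ((r \<eta> - 1) * exponent_factor t ((z + cnj w) / 2) ((z - cnj w) / (2 * \<i>)) (r \<eta>))) / r \<eta> ^ n *
      ((1 - r \<eta> ^ n) * (of_real q * r \<eta> / (1 - r \<eta>))))))"
  proof
    fix \<eta>
    define P where "P = prefactor t (r \<eta>) * exp (of_nat n * ((r \<eta> - 1) * exponent_factor t ((z + cnj w) / 2) ((z - cnj w) / (2 * \<i>)) (r \<eta>)))"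
    define S where "S = (\<Sum>j<n. inverse (r \<eta>) ^ j)"
    define W where "W = (1 - r \<eta> ^ n) * (of_real q * r \<eta> / (1 - r \<eta>))"
    have "of_real q * S = W / r \<eta> ^ n" unfolding S_def W_def by (rule geo)
    then have "of_real q * ((M * P) * S) = (M * P) * (W / r \<eta> ^ n)" by (metis mult.left_commute)
    also have "\<dots> = M * (P / r \<eta> ^ n * W)" by simp
    finally have "of_real q * (M * P * S) = M * (P / r \<eta> ^ n * W)" .
    then show "of_real q * (indicator {- (pi / q)..pi / q} \<eta> *\<^sub>R ((\<Sum>k. A k * r \<eta> ^ k) * (\<Sum>j<n. inverse (r \<eta>) ^ j)))
      = M * (indicator {- (pi / q)..pi / q} \<eta> *\<^sub>R (prefactor t (r \<eta>) * exp (of_nat n * ((r \<eta> - 1) * exponent_factor t ((z + cnj w) / 2) ((z - cnj w) / (2 * \<i>)) (r \<eta>))) / r \<eta> ^ n *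
      ((1 - r \<eta> ^ n) * (of_real q * r \<eta> / (1 - r \<eta>)))))"
      unfolding sumM ratio P_def[symmetric] S_def[symmetric] W_def[symmetric] by (simp only: mult_scaleR_right)
  qed
  finally have "(\<Sum>k<n. A k) / M = of_real (1 / (2 * pi)) * (\<integral>\<eta>. indicator {- (pi / q)..pi / q} \<eta> *\<^sub>R (prefactor t (r \<eta>) * exp (of_nat n * ((r \<eta> - 1) * exponent_factor t ((z + cnj w) / 2) ((z - cnj w) / (2 * \<i>)) (r \<eta>))) / r \<eta> ^ n *
      ((1 - r \<eta> ^ n) * (of_real q * r \<eta> / (1 - r \<eta>)))) \<partial>lborel)"
    unfolding integral_mult_right_zero using M0 by simp
  then show ?thesis
    unfolding kernel_ratio_def A_def M_def a_def .
qed

text \<open>Dominated convergence. The limit integral is \<open>pi * erfc\<close>, and the factor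
  \<open>1 / (2 * pi)\<close> leaves one half of it.\<close>

theorem kernel_ratio_edge_tendsto:
  fixes N :: "nat \<Rightarrow> nat" and t x y :: "nat \<Rightarrow> real" and \<xi> \<upsilon> z w :: "nat \<Rightarrow> complex"
  assumes N: "filterlim N at_top sequentially" "\<And>j. 0 < N j"
    and t: "\<And>j. 0 \<le> t j" "\<And>j. t j \<le> \<tau>" "\<tau> < 1"
    and E: "\<And>j. ellipse_form (t j) (x j) (y j) = 1"
    and lims: "t \<longlonglongrightarrow> t0" "x \<longlonglongrightarrow> x0" "y \<longlonglongrightarrow> y0" "\<xi> \<longlonglongrightarrow> \<xi>0" "\<upsilon> \<longlonglongrightarrow> \<upsilon>0"
    and \<gamma>: "\<gamma> = 2 * (of_real (x0 * ((1 - t0) / (1 + t0))) * \<xi>0 + of_real (y0 * ((1 + t0) / (1 - t0))) * \<upsilon>0) / of_real (ellipse_gradient t0 x0 y0)"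
    and X: "\<And>j. (z j + cnj (w j)) / 2 = of_real (x j) + \<xi> j / of_real (sqrt (real (N j)))"
    and Y: "\<And>j. (z j - cnj (w j)) / (2 * \<i>) = of_real (y j) + \<upsilon> j / of_real (sqrt (real (N j)))"
  shows "(\<lambda>j. kernel_ratio (N j) (t j) (w j) (z j)) \<longlonglongrightarrow> erfc (\<gamma> / of_real (sqrt 2)) / 2"
proof -
  define q where "q = (\<lambda>j. 1 / (ellipse_gradient (t j) (x j) (y j) * sqrt (real (N j))))"
  define r where "r = (\<lambda>j \<eta>. exp (- (of_real (q j) * (1 + \<i> * complex_of_real \<eta>))))"
  define G where "G = (\<lambda>j \<eta>. prefactor (t j) (r j \<eta>) * exp (of_nat (N j) * ((r j \<eta> - 1) *
      exponent_factor (t j) ((z j + cnj (w j)) / 2) ((z j - cnj (w j)) / (2 * \<i>)) (r j \<eta>))) / r j \<eta> ^ N j)"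
  define W where "W = (\<lambda>j \<eta>. (1 - r j \<eta> ^ N j) * (of_real (q j) * r j \<eta> / (1 - r j \<eta>)))"
  define F where "F = (\<lambda>j \<eta>. indicator {- (pi / q j)..pi / q j} \<eta> *\<^sub>R (G j \<eta> * W j \<eta>))"
  define L where "L = (\<lambda>\<eta>. exp ((1 + \<i> * complex_of_real \<eta>)\<^sup>2 / 2 - \<gamma> * (1 + \<i> * complex_of_real \<eta>)) / (1 + \<i> * complex_of_real \<eta>))"
  have t1: "t j < 1" for j using t(2)[of j] t(3) by simp
  have t0: "0 \<le> t0" "t0 \<le> \<tau>"
    using LIMSEQ_le_const[OF lims(1)] LIMSEQ_le_const2[OF lims(1)] t by auto
  have q: "0 < q j" for j
    using ellipse_bounds(5)[OF t(1,2,3) E, of j] N(2)[of j] by (simp add: q_def)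
  have F: "kernel_ratio (N j) (t j) (w j) (z j) = of_real (1 / (2 * pi)) * integral\<^sup>L lborel (F j)" for j
    unfolding kernel_ratio_eq_integral[OF t(1) t1 q[of j]] F_def G_def W_def r_def ..
  obtain K where K: "0 < K" "\<And>j. cmod (\<xi> j) \<le> K" "\<And>j. cmod (\<upsilon> j) \<le> K"
  proof -
    obtain K1 where K1: "0 < K1" "\<And>j. cmod (\<xi> j) \<le> K1"
      using convergent_imp_Bseq[OF convergentI[OF lims(4)]] by (auto elim: BseqE)
    obtain K2 where K2: "0 < K2" "\<And>j. cmod (\<upsilon> j) \<le> K2"
      using convergent_imp_Bseq[OF convergentI[OF lims(5)]] by (auto elim: BseqE)
    show thesis using K1 K2 by (intro that[of "max K1 K2"]) (auto simp: le_max_iff_disj)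
  qed
  have \<tau>0: "0 \<le> \<tau>" using t(1)[of 0] t(2)[of 0] by simp
  obtain C \<kappa> where C: "0 \<le> C" "0 < \<kappa>" and dom: "\<forall>t x y n \<xi> \<upsilon> \<eta> q r. 0 \<le> t \<longrightarrow> t \<le> \<tau> \<longrightarrow> ellipse_form t x y = 1 \<longrightarrow> 0 < n \<longrightarrow>
     cmod \<xi> \<le> K \<longrightarrow> cmod \<upsilon> \<le> K \<longrightarrow> q = 1 / (ellipse_gradient t x y * sqrt (real n)) \<longrightarrow> \<bar>\<eta>\<bar> \<le> pi / q \<longrightarrow>
     r = exp (- (of_real q * (1 + \<i> * complex_of_real \<eta>))) \<longrightarrow>
     cmod (prefactor t r * exp (of_nat n * ((r - 1) * exponent_factor t (of_real x + \<xi> / of_real (sqrt (real n)))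
        (of_real y + \<upsilon> / of_real (sqrt (real n))) r)) / r ^ n) \<le> C * exp (- \<kappa> * \<eta>\<^sup>2)"
    using edge_integrand_domination[OF \<tau>0 t(3), of K] K(1) by auto
  have Gb: "cmod (G j \<eta>) \<le> C * exp (- \<kappa> * \<eta>\<^sup>2)" if "\<bar>\<eta>\<bar> \<le> pi / q j" for j \<eta>
  proof -
    have "q j = 1 / (ellipse_gradient (t j) (x j) (y j) * sqrt (real (N j)))" by (simp add: q_def)
    moreover have "r j \<eta> = exp (- (of_real (q j) * (1 + \<i> * complex_of_real \<eta>)))" by (simp add: r_def)
    ultimately show ?thesis
      unfolding G_def X Y by (rule dom[rule_format, OF t(1) t(2) E N(2) K(2) K(3) _ that])
  qed
  \<comment> \<open>Both \<open>1 - r ^ N\<close> and the pole are controlled by moduli alone: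
    \<open>q * exp (- q) \<le> 1 - exp (- q) \<le> cmod (1 - r)\<close>.\<close>
  have Wb: "cmod (W j \<eta>) \<le> 2" for j \<eta>
  proof -
    have nr: "cmod (r j \<eta>) = exp (- q j)" by (simp add: r_def)
    have "cmod (1 - r j \<eta> ^ N j) \<le> 1 + cmod (r j \<eta>) ^ N j"
      using norm_triangle_ineq4[of 1 "r j \<eta> ^ N j"] by (simp add: norm_power)
    also have "\<dots> \<le> 2" unfolding nr using q[of j] by (simp add: power_le_one)
    finally have 1: "cmod (1 - r j \<eta> ^ N j) \<le> 2" .
    have "1 - exp (- q j) \<le> cmod (1 - r j \<eta>)"
      using norm_triangle_ineq2[of 1 "r j \<eta>"] nr by simp
    moreover have "q j * exp (- q j) \<le> 1 - exp (- q j)"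
    proof -
      have "(1 + q j) * exp (- q j) \<le> exp (q j) * exp (- q j)"
        by (intro mult_right_mono exp_ge_add_one_self) auto
      then show ?thesis by (simp add: distrib_right flip: exp_add)
    qed
    moreover have "0 < q j * exp (- q j)" using q[of j] by simp
    ultimately have "q j * exp (- q j) / cmod (1 - r j \<eta>) \<le> 1"
      by (simp add: divide_le_eq_1)
    then have 2: "cmod (of_real (q j) * r j \<eta> / (1 - r j \<eta>)) \<le> 1"
      using q[of j] by (simp add: norm_divide norm_mult nr)
    show ?thesis
      unfolding W_def norm_mult[of "1 - _"] using mult_mono[OF 1 2] by simp
  qed
  have Flim: "(\<lambda>j. F j \<eta>) \<longlonglongrightarrow> L \<eta>" for \<eta>
  proof -
    have 1: "(\<lambda>j. G j \<eta> * W j \<eta>) \<longlonglongrightarrow> L \<eta>"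
      unfolding G_def W_def L_def
      by (rule edge_integrand_tendsto[OF N t E lims \<gamma> _ _ X Y]) (simp_all add: q_def r_def)
    \<comment> \<open>This is \<open>pi / q j\<close>: the interval of integration exhausts the real
      line, so the indicator disappears in the limit.\<close>
    have "filterlim (\<lambda>j. ellipse_gradient (t j) (x j) (y j) * sqrt (real (N j)) * pi) at_top sequentially"
    proof -
      have t01: "1 - t0 \<noteq> 0" "1 + t0 \<noteq> 0" using t0 t(3) by auto
      have "(\<lambda>j. ellipse_form (t j) (x j) (y j)) \<longlonglongrightarrow> ellipse_form t0 x0 y0"
        unfolding ellipse_form_def using t01 by (intro tendsto_intros lims)
      then have E0: "ellipse_form t0 x0 y0 = 1"
        unfolding E by (simp add: LIMSEQ_const_iff)
      have "(\<lambda>j. ellipse_gradient (t j) (x j) (y j)) \<longlonglongrightarrow> ellipse_gradient t0 x0 y0"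
        unfolding ellipse_gradient_def using t01 by (intro tendsto_intros lims)
      moreover have "filterlim (\<lambda>j. sqrt (real (N j))) at_top sequentially"
        using N(1) by (intro filterlim_compose[OF sqrt_at_top] filterlim_compose[OF filterlim_real_sequentially])
      ultimately have "filterlim (\<lambda>j. ellipse_gradient (t j) (x j) (y j) * sqrt (real (N j))) at_top sequentially"
        using ellipse_bounds(5)[OF t0 t(3) E0] by (intro filterlim_tendsto_pos_mult_at_top)
      then show ?thesis
        by (rule filterlim_at_top_mult_tendsto_pos[OF tendsto_const pi_gt_zero])
    qed
    then have "\<forall>\<^sub>F j in sequentially. \<bar>\<eta>\<bar> \<le> ellipse_gradient (t j) (x j) (y j) * sqrt (real (N j)) * pi"
      by (simp add: filterlim_at_top)
    then have "\<forall>\<^sub>F j in sequentially. G j \<eta> * W j \<eta> = F j \<eta>"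
    proof eventually_elim
      case (elim j)
      then have "\<bar>\<eta>\<bar> \<le> pi / q j" by (simp add: q_def mult.commute)
      then show ?case by (simp add: F_def abs_le_iff)
    qed
    from tendsto_cong[THEN iffD1, OF this 1] show ?thesis .
  qed
  have meas: "F j \<in> borel_measurable lborel" for j
  proof -
    have rc: "continuous_on UNIV (r j)"
      unfolding r_def by (intro continuous_intros)
    have nr: "cmod (r j \<eta>) = exp (- q j)" "exp (- q j) < 1" for \<eta>
      using q[of j] by (simp_all add: r_def)
    have tr: "cmod (of_real (t j) * r j \<eta>) < 1" for \<eta>
    proof -
      have "t j * exp (- q j) \<le> t j * 1" using t(1)[of j] nr(2) by (intro mult_left_mono) auto
      then show ?thesis using t(1)[of j] t1[of j] by (simp add: norm_mult nr)
    qed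
    \<comment> \<open>The base avoids the branch cut, which gives continuity of the complex power
      and hence measurability.\<close>
    have np: "1 - (of_real (t j) * r j \<eta>)\<^sup>2 \<notin> \<real>\<^sub>\<le>\<^sub>0" for \<eta>
    proof
      assume "1 - (of_real (t j) * r j \<eta>)\<^sup>2 \<in> \<real>\<^sub>\<le>\<^sub>0"
      then have "1 \<le> Re ((of_real (t j) * r j \<eta>)\<^sup>2)"
        by (simp add: complex_nonpos_Reals_iff)
      also have "\<dots> \<le> cmod (of_real (t j) * r j \<eta>) ^ 2"
        by (metis complex_Re_le_cmod norm_power)
      also have "\<dots> < 1"
        unfolding abs_square_less_1 using tr[of \<eta>] by simp
      finally show False by simp
    qed
    have "continuous_on UNIV (\<lambda>\<eta>. (1 - (of_real (t j) * r j \<eta>)\<^sup>2) powr (- (1 / 2)))"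
      unfolding continuous_on_def
    proof (intro ballI tendsto_powr_complex np tendsto_const)
      fix \<eta> :: real
      have "(r j \<longlongrightarrow> r j \<eta>) (at \<eta>)"
        using rc by (simp add: continuous_on_def)
      then show "((\<lambda>x. 1 - (of_real (t j) * r j x)\<^sup>2) \<longlongrightarrow> 1 - (of_real (t j) * r j \<eta>)\<^sup>2) (at \<eta>)"
        by (intro tendsto_intros)
    qed
    then have pc: "continuous_on UNIV (\<lambda>\<eta>. prefactor (t j) (r j \<eta>))"
      unfolding prefactor_def divide_inverse by (intro continuous_on_mult continuous_on_const)
    have d1: "1 + of_real (t j) * r j \<eta> \<noteq> 0" "1 - of_real (t j) * r j \<eta> \<noteq> 0" "1 - r j \<eta> \<noteq> 0" "r j \<eta> ^ N j \<noteq> 0" for \<eta>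
    proof -
      show "1 + of_real (t j) * r j \<eta> \<noteq> 0" "1 - of_real (t j) * r j \<eta> \<noteq> 0" using np[of \<eta>]
        by (auto simp: add_eq_0_iff power2_eq_square)
      show "1 - r j \<eta> \<noteq> 0" using nr(1)[of \<eta>] nr(2) by auto
      show "r j \<eta> ^ N j \<noteq> 0" by (simp add: r_def)
    qed
    have "continuous_on UNIV (\<lambda>\<eta>. G j \<eta> * W j \<eta>)"
      unfolding G_def W_def exponent_factor_def using d1
      by (intro continuous_on_mult continuous_on_divide continuous_on_exp continuous_on_add continuous_on_diff
          continuous_on_power continuous_on_const pc rc) auto
    then have "(\<lambda>\<eta>. indicator {- (pi / q j)..pi / q j} \<eta> *\<^sub>R (G j \<eta> * W j \<eta>)) \<in> borel_measurable borel"
      by (intro borel_measurable_scaleR borel_measurable_continuous_onI borel_measurable_indicator) auto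
    then show ?thesis unfolding F_def by simp
  qed
  have "(\<lambda>j. integral\<^sup>L lborel (F j)) \<longlonglongrightarrow> integral\<^sup>L lborel L"
  proof (rule integral_dominated_convergence[where w = "\<lambda>\<eta>. 2 * C * exp (- \<kappa> * (\<eta> - 0)\<^sup>2)"])
    show "L \<in> borel_measurable lborel"
      by (rule borel_measurable_LIMSEQ_metric[OF meas]) (use Flim in auto)
    show "integrable lborel (\<lambda>\<eta>. 2 * C * exp (- \<kappa> * (\<eta> - 0)\<^sup>2))"
      using has_bochner_integral_gaussian[OF C(2), of 0] by (intro integrable_mult_right) (auto simp: has_bochner_integral_iff)
    show "AE \<eta> in lborel. norm (F j \<eta>) \<le> 2 * C * exp (- \<kappa> * (\<eta> - 0)\<^sup>2)" for j
    proof (intro AE_I2)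
      fix \<eta> :: real
      show "norm (F j \<eta>) \<le> 2 * C * exp (- \<kappa> * (\<eta> - 0)\<^sup>2)"
      proof (cases "\<bar>\<eta>\<bar> \<le> pi / q j")
        case True
        have "norm (F j \<eta>) \<le> cmod (G j \<eta>) * cmod (W j \<eta>)"
          unfolding F_def by (simp add: norm_mult indicator_def)
        also have "\<dots> \<le> (C * exp (- \<kappa> * \<eta>\<^sup>2)) * 2"
          using Gb[OF True] Wb C by (intro mult_mono) auto
        finally show ?thesis by simp
      next
        case False
        then have "\<eta> \<notin> {- (pi / q j)..pi / q j}" by auto
        then show ?thesis using C by (simp add: F_def)
      qed
    qed
  qed (use meas Flim in auto)
  then have "(\<lambda>j. of_real (1 / (2 * pi)) * integral\<^sup>L lborel (F j)) \<longlonglongrightarrow> of_real (1 / (2 * pi)) * integral\<^sup>L lborel L"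
    by (rule tendsto_mult_left)
  moreover have "of_real (1 / (2 * pi)) * integral\<^sup>L lborel L = erfc (\<gamma> / of_real (sqrt 2)) / 2"
    unfolding L_def erfc_contour_integral by simp
  ultimately show ?thesis
    unfolding F by (simp only:)
qed

section \<open>Asymptotics in the bulk\<close>

lemma mehler_fun_one:
  assumes "0 \<le> t" "t < 1" and a: "a\<^sup>2 = real n * (1 - t\<^sup>2)"
  shows "mehler_fun t a 1 w z = of_real ((1 - t\<^sup>2) powr (- (1 / 2))) * exp (of_nat n * (w * z - of_real t * (w\<^sup>2 + z\<^sup>2) / 2))"
proof -
  have t2: "t\<^sup>2 < 1" using assms by (simp add: abs_square_less_1)
  have e: "1 - (of_real t * 1)\<^sup>2 = complex_of_real (1 - t\<^sup>2)" by simp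
  have p: "complex_of_real (1 - t\<^sup>2) powr (- (1 / 2)) = of_real ((1 - t\<^sup>2) powr (- (1 / 2)))"
    using powr_of_real[of "1 - t\<^sup>2" "- (1 / 2)"] t2 by simp
  have "(complex_of_real a)\<^sup>2 = of_nat n * complex_of_real (1 - t\<^sup>2)"
    unfolding of_real_power[symmetric] a by simp
  then have "(complex_of_real a)\<^sup>2 * v / complex_of_real (1 - t\<^sup>2) = of_nat n * v" for v
    using t2 by (simp del: of_real_diff)
  then show ?thesis
    unfolding mehler_fun_def e p by simp
qed

definition mehler_diag :: "nat \<Rightarrow> real \<Rightarrow> complex \<Rightarrow> real" where
  "mehler_diag n t z = (1 - t\<^sup>2) powr (- (1 / 2)) * exp (real n * ((cmod z)\<^sup>2 - t * Re (z\<^sup>2)))"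

lemma mehler_fun_diag:
  assumes "0 \<le> t" "t < 1" and a: "a\<^sup>2 = real n * (1 - t\<^sup>2)"
  shows "mehler_fun t a 1 (cnj z) z = of_real (mehler_diag n t z)"
proof -
  have "cnj z * z - of_real t * ((cnj z)\<^sup>2 + z\<^sup>2) / 2 = of_real ((cmod z)\<^sup>2 - t * Re (z\<^sup>2))"
    using complex_add_cnj[of "z\<^sup>2"] unfolding of_real_diff complex_norm_square by (simp add: mult.commute add.commute)
  then have E: "of_nat n * (cnj z * z - of_real t * ((cnj z)\<^sup>2 + z\<^sup>2) / 2) = complex_of_real (real n * ((cmod z)\<^sup>2 - t * Re (z\<^sup>2)))"
    by simp
  show ?thesis
    unfolding mehler_fun_one[OF assms] mehler_diag_def E exp_of_real by simp
qed

text \<open>Quantifies the loss in the Cauchy-Schwarz inequality: the geometric mean of the diagonal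
  sums exceeds the off-diagonal one by a factor that is bounded for \<open>\<bar>z - w\<bar>\<close>
  of order \<open>1 / sqrt n\<close>.\<close>

lemma cmod_mehler_fun_off_diag:
  assumes "0 \<le> t" "t < 1" and a: "a\<^sup>2 = real n * (1 - t\<^sup>2)"
  shows "sqrt (mehler_diag n t z * mehler_diag n t w) = cmod (mehler_fun t a 1 (cnj w) z) * exp (real n * (cmod (z - w))\<^sup>2 / 2)"
proof -
  define p where "p = (1 - t\<^sup>2) powr (- (1 / 2))"
  have p: "0 \<le> p" by (simp add: p_def)
  have c: "cmod (mehler_fun t a 1 (cnj w) z) = p * exp (Re (of_nat n * (cnj w * z - of_real t * ((cnj w)\<^sup>2 + z\<^sup>2) / 2)))"
    unfolding mehler_fun_one[OF assms] norm_mult p_def[symmetric] norm_exp_eq_Re using p by simp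
  define A where "A = (cmod z)\<^sup>2 - t * Re (z\<^sup>2)"
  define B where "B = (cmod w)\<^sup>2 - t * Re (w\<^sup>2)"
  have ee: "exp (real n * (A + B) / 2) * exp (real n * (A + B) / 2) = exp (real n * A) * exp (real n * B)"
    unfolding exp_add[symmetric] by (simp add: distrib_left)
  have sq: "(p * e)\<^sup>2 = (p * u) * (p * v)" if "e * e = u * v" for e u v
    using that by (simp add: power2_eq_square)
  have "mehler_diag n t z * mehler_diag n t w = (p * exp (real n * (A + B) / 2))\<^sup>2"
    unfolding mehler_diag_def p_def[symmetric] A_def[symmetric] B_def[symmetric] by (rule sq[OF ee, symmetric])
  then have "sqrt (mehler_diag n t z * mehler_diag n t w) = p * exp (real n * (A + B) / 2)"
    using p by simp
  moreover have "real n * (A + B) / 2 = Re (of_nat n * (cnj w * z - of_real t * ((cnj w)\<^sup>2 + z\<^sup>2) / 2)) + real n * (cmod (z - w))\<^sup>2 / 2"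
  proof -
    have "(A + B) / 2 = Re (cnj w * z - of_real t * ((cnj w)\<^sup>2 + z\<^sup>2) / 2) + (cmod (z - w))\<^sup>2 / 2"
      unfolding A_def B_def cmod_power2 by (simp add: power2_eq_square) (simp add: field_simps)
    then have "real n * ((A + B) / 2) = real n * (Re (cnj w * z - of_real t * ((cnj w)\<^sup>2 + z\<^sup>2) / 2) + (cmod (z - w))\<^sup>2 / 2)"
      by (rule arg_cong)
    then show ?thesis unfolding Re_of_nat_mult by (simp only: distrib_left times_divide_eq_right)
  qed
  ultimately show ?thesis
    unfolding c by (simp only: exp_add mult.assoc)
qed

text \<open>To first order in \<open>\<rho> - 1\<close> the claim reads \<open>\<beta> < 1\<close>.
  The explicit choice makes the radius depend on \<open>\<tau>\<close> and \<open>\<beta>\<close>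
  only.\<close>

lemma bulk_radius_exists:
  fixes \<tau> \<beta> :: real
  assumes \<tau>: "0 \<le> \<tau>" "\<tau> < 1" and \<beta>: "0 \<le> \<beta>" "\<beta> < 1"
  obtains \<rho> where "1 < \<rho>" "\<tau> * \<rho> < 1" "(\<rho> - 1) * (\<beta> * ((1 - \<tau>) / (1 - \<tau> * \<rho>))) < ln \<rho>"
proof -
  define m where "m = 1 - \<tau>"
  \<comment> \<open>From \<open>ln (1 + \<epsilon>) \<ge> \<epsilon> / (1 + \<epsilon>)\<close> the
    requirement becomes \<open>\<epsilon> * (\<beta> * m + \<tau>) < m * (1 - \<beta>)\<close>. As
    \<open>\<beta> * m + \<tau> \<le> 1\<close>, half of the right side will do.\<close>
  define \<epsilon> where "\<epsilon> = m * (1 - \<beta>) / 2"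
  have m: "0 < m" "m \<le> 1" using \<tau> by (auto simp: m_def)
  have \<epsilon>: "0 < \<epsilon>" using m \<beta> by (simp add: \<epsilon>_def)
  have mb: "m * (1 - \<beta>) \<le> m" using m \<beta> by (simp add: mult_left_le)
  have \<epsilon>m: "\<epsilon> < m" using mb m by (simp add: \<epsilon>_def)
  have \<tau>\<epsilon>: "\<tau> * \<epsilon> \<le> \<epsilon>" using \<tau> \<epsilon> by (simp add: mult_left_le_one_le)
  have den: "0 < m - \<tau> * \<epsilon>" using \<epsilon>m \<tau>\<epsilon> by linarith
  have d: "1 - \<tau> * (1 + \<epsilon>) = m - \<tau> * \<epsilon>" by (simp add: m_def distrib_left)
  have ln: "\<epsilon> / (1 + \<epsilon>) \<le> ln (1 + \<epsilon>)"
  proof -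
    have "ln (1 / (1 + \<epsilon>)) \<le> 1 / (1 + \<epsilon>) - 1"
      using \<epsilon> by (intro ln_le_minus_one) auto
    moreover have "1 / (1 + \<epsilon>) - 1 = - (\<epsilon> / (1 + \<epsilon>))"
      using \<epsilon> by (simp add: field_simps)
    ultimately show ?thesis using \<epsilon> by (simp add: ln_div)
  qed
  have "\<beta> * m * (1 + \<epsilon>) < m - \<tau> * \<epsilon>"
  proof -
    have "\<beta> * m + \<tau> \<le> 1"
    proof -
      have "\<beta> * m \<le> 1 * m" using \<beta> m by (intro mult_right_mono) auto
      moreover have "m + \<tau> = 1" by (simp add: m_def)
      ultimately show ?thesis by linarith
    qed
    then have "\<epsilon> * (\<beta> * m + \<tau>) \<le> \<epsilon> * 1" using \<epsilon> by (intro mult_left_mono) auto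
    also have "\<dots> < m * (1 - \<beta>)" using m \<beta> by (simp add: \<epsilon>_def)
    finally show ?thesis by (simp add: algebra_simps)
  qed
  then have "\<beta> * (m / (m - \<tau> * \<epsilon>)) < 1 / (1 + \<epsilon>)"
    using den \<epsilon> by (simp add: pos_less_divide_eq pos_divide_less_eq)
  then have "\<epsilon> * (\<beta> * (m / (m - \<tau> * \<epsilon>))) < \<epsilon> * (1 / (1 + \<epsilon>))"
    using \<epsilon> by (rule mult_strict_left_mono)
  then have "\<epsilon> * (\<beta> * (m / (m - \<tau> * \<epsilon>))) < ln (1 + \<epsilon>)"
    using ln by simp
  then show thesis
    using \<epsilon> den by (intro that[of "1 + \<epsilon>"]) (auto simp: d[symmetric] m_def[symmetric])
qed

text \<open>On the diagonal all terms are nonnegative, so weighting them by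
  \<open>\<rho> ^ k\<close> bounds the tail by \<open>\<rho> ^ (- n)\<close> times the full series
  at \<open>\<rho>\<close>, which Mehler's formula evaluates.\<close>

lemma diagonal_tail_bound:
  assumes t: "0 \<le> t" "t \<le> \<tau>" "\<tau> < 1" and \<rho>: "1 < \<rho>" "\<tau> * \<rho> < 1"
    and E: "ellipse_form t (Re z) (Im z) \<le> \<beta>" and a: "a\<^sup>2 = real n * (1 - t\<^sup>2)"
  shows "summable (\<lambda>k. (cmod (herm t a k z))\<^sup>2 / fact k)"
    and "(\<Sum>k. (cmod (herm t a (k + n) z))\<^sup>2 / fact (k + n)) \<le>
      mehler_diag n t z * ((1 - \<tau> * \<rho>) powr (- (1 / 2)) * (exp ((\<rho> - 1) * (\<beta> * ((1 - \<tau>) / (1 - \<tau> * \<rho>))) - ln \<rho>)) ^ n)"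
proof -
  define P where "P = (\<lambda>k. (cmod (herm t a k z))\<^sup>2 / fact k)"
  have t1: "t < 1" using t by simp
  have P: "mehler_term t a (of_real r) (cnj z) z k = of_real (P k * r ^ k)" for r k
    unfolding P_def mehler_term_def cnj_herm[symmetric] by (simp add: complex_norm_square mult.commute flip: of_real_power)
  have P0: "0 \<le> P k" for k by (simp add: P_def)
  have t\<rho>: "t * \<rho> \<le> \<tau> * \<rho>" "t * \<rho> < 1"
  proof -
    show "t * \<rho> \<le> \<tau> * \<rho>" using t \<rho> by (intro mult_right_mono) auto
    then show "t * \<rho> < 1" using \<rho> by linarith
  qed
  have tr: "t * cmod (of_real \<rho>) < 1" using t\<rho> \<rho> by simp
  have sums: "(\<lambda>k. of_real (P k * \<rho> ^ k)) sums mehler_fun t a (of_real \<rho>) (cnj z) z"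
  proof -
    have "mehler_term t a (of_real \<rho>) (cnj z) z = (\<lambda>k. of_real (P k * \<rho> ^ k))"
      by (rule ext) (rule P)
    moreover have "mehler_term t a (of_real \<rho>) (cnj z) z sums mehler_fun t a (of_real \<rho>) (cnj z) z"
      by (rule mehler_formula[OF t(1) tr])
    ultimately show ?thesis by (simp only:)
  qed
  then have "(\<lambda>k. Re (of_real (P k * \<rho> ^ k) :: complex)) sums Re (mehler_fun t a (of_real \<rho>) (cnj z) z)"
    by (rule sums_Re)
  then have s: "(\<lambda>k. P k * \<rho> ^ k) sums Re (mehler_fun t a (of_real \<rho>) (cnj z) z)"
    by simp
  have Ple: "P k \<le> P k * \<rho> ^ k" for k
    using P0[of k] \<rho> mult_left_mono[of 1 "\<rho> ^ k" "P k"] by (simp add: one_le_power)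
  show sP: "summable (\<lambda>k. (cmod (herm t a k z))\<^sup>2 / fact k)"
    unfolding P_def[symmetric]
    by (rule summable_comparison_test'[where N = 0, OF sums_summable[OF s]]) (use P0 Ple in auto)
  have "(\<Sum>k. P (k + n)) \<le> (\<Sum>k. P (k + n) * \<rho> ^ (k + n) / \<rho> ^ n)"
  proof (rule suminf_le)
    show "P (k + n) \<le> P (k + n) * \<rho> ^ (k + n) / \<rho> ^ n" for k
      using P0[of "k + n"] \<rho> mult_left_mono[of 1 "\<rho> ^ k" "P (k + n)"] by (simp add: power_add one_le_power)
    show "summable (\<lambda>k. P (k + n))"
      using sP unfolding P_def[symmetric] by (rule summable_ignore_initial_segment)
    show "summable (\<lambda>k. P (k + n) * \<rho> ^ (k + n) / \<rho> ^ n)"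
      using summable_ignore_initial_segment[OF sums_summable[OF s], of n] by (rule summable_divide)
  qed
  also have "\<dots> = (\<Sum>k. P (k + n) * \<rho> ^ (k + n)) / \<rho> ^ n"
    using summable_ignore_initial_segment[OF sums_summable[OF s], of n] by (rule suminf_divide)
  also have "\<dots> \<le> (\<Sum>k. P k * \<rho> ^ k) / \<rho> ^ n"
  proof (rule divide_right_mono)
    have "0 \<le> (\<Sum>i<n. P i * \<rho> ^ i)" using P0 \<rho> by (intro sum_nonneg) auto
    then show "(\<Sum>k. P (k + n) * \<rho> ^ (k + n)) \<le> (\<Sum>k. P k * \<rho> ^ k)"
      using suminf_split_initial_segment[OF sums_summable[OF s], of n] by simp
  qed (use \<rho> in simp)
  also have "(\<Sum>k. P k * \<rho> ^ k) \<le> cmod (mehler_fun t a (of_real \<rho>) (cnj z) z)"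
    unfolding sums_unique[OF s, symmetric] by (rule complex_Re_le_cmod)
  also have "mehler_fun t a (of_real \<rho>) (cnj z) z = of_real (mehler_diag n t z) *
      (prefactor t (of_real \<rho>) * exp (of_nat n * ((of_real \<rho> - 1) * exponent_factor t ((z + cnj z) / 2) ((z - cnj z) / (2 * \<i>)) (of_real \<rho>))))"
    using mehler_fun_ratio[OF t(1) t1 tr a, of "cnj z" z] mehler_fun_nonzero[of t 1 a "cnj z" z] t t1
    unfolding mehler_fun_diag[OF t(1) t1 a] by (simp add: divide_eq_eq mult.commute)
  also have "cmod \<dots> \<le> mehler_diag n t z * ((1 - \<tau> * \<rho>) powr (- (1 / 2)) * exp (real n * ((\<rho> - 1) * (\<beta> * ((1 - \<tau>) / (1 - \<tau> * \<rho>))))))"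
  proof -
    define B where "B = (Re z)\<^sup>2 * ((1 - t) / (1 + t * \<rho>)) + (Im z)\<^sup>2 * ((1 + t) / (1 - t * \<rho>))"
    have zz: "(z + cnj z) / 2 = of_real (Re z)" "(z - cnj z) / (2 * \<i>) = of_real (Im z)"
      by (simp_all add: complex_eq_iff)
    have "exponent_factor t ((z + cnj z) / 2) ((z - cnj z) / (2 * \<i>)) (of_real \<rho>) = of_real B"
      unfolding zz exponent_factor_def B_def by simp
    then have ex: "of_nat n * ((of_real \<rho> - 1) * exponent_factor t ((z + cnj z) / 2) ((z - cnj z) / (2 * \<i>)) (of_real \<rho>)) = complex_of_real (real n * ((\<rho> - 1) * B))"
      by simp
    define l where "l = (1 - \<tau>) / (1 - \<tau> * \<rho>)"
    \<comment> \<open>The quotient increases with \<open>t\<close>, so its value at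
      \<open>\<tau>\<close> serves all parameters. It measures how far
      \<open>exponent_factor\<close> at \<open>\<rho>\<close> can exceed
      \<open>ellipse_form\<close>.\<close>
    have tl: "(1 - t) / (1 - t * \<rho>) \<le> l"
    proof -
      have "(\<tau> - t) * (1 - \<rho>) \<le> 0" using t \<rho> by (intro mult_nonneg_nonpos) auto
      then have "(1 - t) * (1 - \<tau> * \<rho>) \<le> (1 - \<tau>) * (1 - t * \<rho>)" by (simp add: algebra_simps)
      then show ?thesis unfolding l_def using t\<rho> \<rho> by (simp add: divide_le_eq pos_le_divide_eq)
    qed
    have l1: "1 \<le> l"
    proof -
      have "\<tau> * 1 \<le> \<tau> * \<rho>" using t \<rho> by (intro mult_left_mono) auto
      then show ?thesis unfolding l_def using \<rho> by simp
    qed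
    have e1: "(1 - t) / (1 + t * \<rho>) \<le> (1 - t) / (1 + t) * l"
    proof -
      have "(1 - t) / (1 + t * \<rho>) \<le> (1 - t) / (1 + t)"
        using t t1 \<rho> mult_left_mono[of 1 \<rho> t] by (intro divide_left_mono) (auto intro!: mult_pos_pos add_pos_nonneg)
      also have "\<dots> \<le> (1 - t) / (1 + t) * l"
        using t t1 l1 mult_left_mono[of 1 l "(1 - t) / (1 + t)"] by simp
      finally show ?thesis .
    qed
    have e2: "(1 + t) / (1 - t * \<rho>) \<le> (1 + t) / (1 - t) * l"
    proof -
      have "(1 + t) / (1 - t * \<rho>) = (1 + t) / (1 - t) * ((1 - t) / (1 - t * \<rho>))"
        using t1 by simp
      also have "\<dots> \<le> (1 + t) / (1 - t) * l"
        using tl t t1 by (intro mult_left_mono) auto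
      finally show ?thesis .
    qed
    have "B \<le> (Re z)\<^sup>2 * ((1 - t) / (1 + t) * l) + (Im z)\<^sup>2 * ((1 + t) / (1 - t) * l)"
      unfolding B_def using e1 e2 by (intro add_mono mult_left_mono) auto
    also have "\<dots> = ellipse_form t (Re z) (Im z) * l"
      by (simp only: ellipse_form_def distrib_right mult.assoc)
    also have "\<dots> \<le> \<beta> * l" using E l1 by (intro mult_right_mono) auto
    finally have B: "real n * ((\<rho> - 1) * B) \<le> real n * ((\<rho> - 1) * (\<beta> * l))"
      using \<rho> by (intro mult_left_mono) auto
    have pf: "cmod (prefactor t (of_real \<rho>)) \<le> (1 - \<tau> * \<rho>) powr (- (1 / 2))"
    proof -
      have tt: "0 < 1 - t\<^sup>2" "1 - t\<^sup>2 \<le> 1" using t t1 by (auto simp: abs_square_less_1)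
      have "(t * \<rho>) * (t * \<rho>) \<le> (t * \<rho>) * 1" using t\<rho> t \<rho> by (intro mult_left_mono) auto
      then have q: "1 - \<tau> * \<rho> \<le> 1 - (t * \<rho>)\<^sup>2" using t\<rho> by (simp add: power2_eq_square)
      have c: "1 - (complex_of_real t * of_real \<rho>)\<^sup>2 = of_real (1 - (t * \<rho>)\<^sup>2)" "1 - (complex_of_real t)\<^sup>2 = of_real (1 - t\<^sup>2)"
        by simp_all
      have n1: "cmod (complex_of_real (1 - (t * \<rho>)\<^sup>2) powr (- (1 / 2))) = (1 - (t * \<rho>)\<^sup>2) powr (- (1 / 2))"
        using q \<rho> by (simp add: norm_powr_real_powr' del: of_real_diff)
      have n2: "cmod (complex_of_real (1 - t\<^sup>2) powr (- (1 / 2))) = (1 - t\<^sup>2) powr (- (1 / 2))"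
        using tt by (simp add: norm_powr_real_powr' del: of_real_diff)
      have "1 powr (- (1 / 2)) \<le> (1 - t\<^sup>2) powr (- (1 / 2))"
        using tt by (intro powr_mono2') auto
      then have g1: "1 \<le> (1 - t\<^sup>2) powr (- (1 / 2))" by simp
      have "(1 - (t * \<rho>)\<^sup>2) powr (- (1 / 2)) \<le> (1 - \<tau> * \<rho>) powr (- (1 / 2))"
        using q \<rho> by (intro powr_mono2') auto
      then have "(1 - (t * \<rho>)\<^sup>2) powr (- (1 / 2)) / (1 - t\<^sup>2) powr (- (1 / 2)) \<le> (1 - \<tau> * \<rho>) powr (- (1 / 2)) / 1"
        using g1 by (intro frac_le) auto
      then show ?thesis
        unfolding prefactor_def c norm_divide n1 n2 by simp
    qed
    have dg: "0 \<le> mehler_diag n t z" by (simp add: mehler_diag_def)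
    have "cmod (of_real (mehler_diag n t z) * (prefactor t (of_real \<rho>) * exp (complex_of_real (real n * ((\<rho> - 1) * B)))))
        = mehler_diag n t z * (cmod (prefactor t (of_real \<rho>)) * exp (real n * ((\<rho> - 1) * B)))"
      unfolding norm_mult norm_exp_eq_Re Re_complex_of_real using dg by simp
    also have "\<dots> \<le> mehler_diag n t z * ((1 - \<tau> * \<rho>) powr (- (1 / 2)) * exp (real n * ((\<rho> - 1) * (\<beta> * l))))"
      using B pf dg by (intro mult_left_mono mult_mono) auto
    finally show ?thesis unfolding ex l_def .
  qed
  finally have "(\<Sum>k. P (k + n)) \<le> mehler_diag n t z * ((1 - \<tau> * \<rho>) powr (- (1 / 2)) * exp (real n * ((\<rho> - 1) * (\<beta> * ((1 - \<tau>) / (1 - \<tau> * \<rho>)))))) / \<rho> ^ n"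
    using \<rho> by (simp add: divide_right_mono)
  also have "\<dots> = mehler_diag n t z * ((1 - \<tau> * \<rho>) powr (- (1 / 2)) * (exp ((\<rho> - 1) * (\<beta> * ((1 - \<tau>) / (1 - \<tau> * \<rho>))) - ln \<rho>)) ^ n)"
  proof -
    have "exp (real n * b) / \<rho> ^ n = exp (b - ln \<rho>) ^ n" for b
      using \<rho> by (simp add: exp_diff power_divide exp_of_nat_mult)
    then have "d * (p * exp (real n * b)) / \<rho> ^ n = d * (p * exp (b - ln \<rho>) ^ n)" for d p b
      by (metis times_divide_eq_right)
    then show ?thesis .
  qed
  finally show "(\<Sum>k. (cmod (herm t a (k + n) z))\<^sup>2 / fact (k + n)) \<le>
      mehler_diag n t z * ((1 - \<tau> * \<rho>) powr (- (1 / 2)) * (exp ((\<rho> - 1) * (\<beta> * ((1 - \<tau>) / (1 - \<tau> * \<rho>))) - ln \<rho>)) ^ n)"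
    unfolding P_def .
qed

text \<open>The off-diagonal tail is estimated termwise by the two diagonal tails; \<open>C\<close>
  and \<open>\<theta>\<close> come from the Chernoff bound and do not depend on the points.\<close>

theorem kernel_ratio_bulk_bound:
  assumes \<tau>: "0 \<le> \<tau>" "\<tau> < 1" and \<beta>: "0 \<le> \<beta>" "\<beta> < 1"
  obtains C \<theta> where "0 \<le> C" "0 < \<theta>" "\<theta> < 1"
    "\<And>n t w z. 0 \<le> t \<Longrightarrow> t \<le> \<tau> \<Longrightarrow> ellipse_form t (Re z) (Im z) \<le> \<beta> \<Longrightarrow> ellipse_form t (Re w) (Im w) \<le> \<beta> \<Longrightarrow>
       cmod (kernel_ratio n t w z - 1) \<le> exp (real n * (cmod (z - w))\<^sup>2 / 2) * (C * \<theta> ^ n)"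
proof -
  obtain \<rho> where \<rho>: "1 < \<rho>" "\<tau> * \<rho> < 1" "(\<rho> - 1) * (\<beta> * ((1 - \<tau>) / (1 - \<tau> * \<rho>))) < ln \<rho>"
    using bulk_radius_exists[OF assms] .
  define C where "C = (1 - \<tau> * \<rho>) powr (- (1 / 2))"
  define \<theta> where "\<theta> = exp ((\<rho> - 1) * (\<beta> * ((1 - \<tau>) / (1 - \<tau> * \<rho>))) - ln \<rho>)"
  show thesis
  proof (rule that[of C \<theta>])
    show "0 \<le> C" "0 < \<theta>" by (simp_all add: C_def \<theta>_def)
    show "\<theta> < 1" unfolding \<theta>_def using \<rho>(3) by simp
    fix n t w z
    assume t: "0 \<le> t" "t \<le> \<tau>" and Ez: "ellipse_form t (Re z) (Im z) \<le> \<beta>" and Ew: "ellipse_form t (Re w) (Im w) \<le> \<beta>"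
    have t1: "t < 1" using t \<tau> by simp
    have "t\<^sup>2 < 1" using t t1 by (simp add: abs_square_less_1)
    define a where "a = sqrt (real n * (1 - t\<^sup>2))"
    have a: "a\<^sup>2 = real n * (1 - t\<^sup>2)" using \<open>t\<^sup>2 < 1\<close> by (simp add: a_def)
    define A where "A = mehler_term t a 1 (cnj w) z"
    define M where "M = mehler_fun t a 1 (cnj w) z"
    define P where "P = (\<lambda>z k. (cmod (herm t a k z))\<^sup>2 / fact k)"
    define L where "L = mehler_diag n t"
    have L: "0 < L z" for z using \<open>t\<^sup>2 < 1\<close> by (simp add: L_def mehler_diag_def)
    have M0: "M \<noteq> 0" unfolding M_def using t t1 by (intro mehler_fun_nonzero) auto
    have sA: "A sums M" unfolding A_def M_def using t t1 by (intro mehler_formula) auto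
    have sums: "summable (P z)" "summable (P w)" and
      tail: "(\<Sum>k. P z (k + n)) \<le> L z * (C * \<theta> ^ n)" "(\<Sum>k. P w (k + n)) \<le> L w * (C * \<theta> ^ n)"
      using diagonal_tail_bound[OF t \<tau>(2) \<rho>(1,2) Ez a] diagonal_tail_bound[OF t \<tau>(2) \<rho>(1,2) Ew a]
      unfolding P_def L_def C_def \<theta>_def by simp_all
    define c where "c = sqrt (L z * L w)"
    have c: "0 < c" using L by (simp add: c_def)
    \<comment> \<open>Arithmetic-geometric mean inequality with each factor normalised by its own
      full diagonal sum. Without the weights \<open>L z\<close> and \<open>L w\<close> the two
      tails, of very different size, could not be combined.\<close>
    have Ab: "cmod (A k) \<le> c / 2 * (P z k / L z + P w k / L w)" for k
    proof -
      define u v where "u = cmod (herm t a k z) / sqrt (fact k)" and "v = cmod (herm t a k w) / sqrt (fact k)"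
      have uv: "P z k = u\<^sup>2" "P w k = v\<^sup>2" by (simp_all add: P_def u_def v_def power_divide)
      have "cmod (A k) = cmod (herm t a k (cnj w)) * cmod (herm t a k z) / fact k"
        by (simp add: A_def mehler_term_def norm_mult norm_divide)
      also have "cmod (herm t a k (cnj w)) = cmod (herm t a k w)"
        unfolding cnj_herm[symmetric] by simp
      also have "cmod (herm t a k w) * cmod (herm t a k z) / fact k = u * v"
        by (simp add: u_def v_def)
      finally have 1: "cmod (A k) = u * v" .
      have "0 \<le> (u / sqrt (L z) - v / sqrt (L w))\<^sup>2" by simp
      also have "\<dots> = u\<^sup>2 / L z + v\<^sup>2 / L w - 2 * (u * v) / c"
        using L[of z] L[of w] by (simp add: power2_diff power_divide c_def real_sqrt_mult)
      finally have "2 * (u * v) / c \<le> u\<^sup>2 / L z + v\<^sup>2 / L w" by simp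
      then have "c / 2 * (2 * (u * v) / c) \<le> c / 2 * (u\<^sup>2 / L z + v\<^sup>2 / L w)"
        using c by (intro mult_left_mono) auto
      then show ?thesis unfolding 1 uv using c by simp
    qed
    have s1: "summable (\<lambda>k. P z (k + n) / L z)" "summable (\<lambda>k. P w (k + n) / L w)"
      using sums by (auto intro: summable_divide summable_ignore_initial_segment)
    have s2: "summable (\<lambda>k. c / 2 * (P z (k + n) / L z + P w (k + n) / L w))"
      using s1 by (intro summable_mult summable_add)
    have "M - (\<Sum>k<n. A k) = (\<Sum>k. A (k + n))"
      using suminf_split_initial_segment[OF sums_summable[OF sA], of n] sums_unique[OF sA] by simp
    then have "cmod (M - (\<Sum>k<n. A k)) \<le> (\<Sum>k. c / 2 * (P z (k + n) / L z + P w (k + n) / L w))"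
      using norm_suminf_le[OF _ s2, of "\<lambda>k. A (k + n)"] Ab by simp
    also have "\<dots> = c / 2 * ((\<Sum>k. P z (k + n)) / L z + (\<Sum>k. P w (k + n)) / L w)"
    proof -
      have "(\<Sum>k. P z (k + n) / L z) = (\<Sum>k. P z (k + n)) / L z" "(\<Sum>k. P w (k + n) / L w) = (\<Sum>k. P w (k + n)) / L w"
        using sums by (auto intro!: suminf_divide summable_ignore_initial_segment)
      then show ?thesis
        using suminf_mult[OF summable_add[OF s1], of "c / 2"] suminf_add[OF s1] by simp
    qed
    also have "\<dots> \<le> c / 2 * (C * \<theta> ^ n + C * \<theta> ^ n)"
      using tail L[of z] L[of w] c by (intro mult_left_mono add_mono) (auto simp: pos_divide_le_eq mult.commute)
    also have "\<dots> = cmod M * (exp (real n * (cmod (z - w))\<^sup>2 / 2) * (C * \<theta> ^ n))"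
      unfolding c_def L_def cmod_mehler_fun_off_diag[OF t(1) t1 a] M_def by simp
    finally have "cmod (M - (\<Sum>k<n. A k)) / cmod M \<le> exp (real n * (cmod (z - w))\<^sup>2 / 2) * (C * \<theta> ^ n)"
      using M0 by (simp add: pos_divide_le_eq mult.commute)
    moreover have "cmod (kernel_ratio n t w z - 1) = cmod (M - (\<Sum>k<n. A k)) / cmod M"
    proof -
      have "kernel_ratio n t w z - 1 = ((\<Sum>k<n. A k) - M) / M"
        using M0 by (simp add: kernel_ratio_def A_def M_def a_def diff_divide_distrib)
      then show ?thesis by (simp add: norm_divide norm_minus_commute)
    qed
    ultimately show "cmod (kernel_ratio n t w z - 1) \<le> exp (real n * (cmod (z - w))\<^sup>2 / 2) * (C * \<theta> ^ n)"
      by simp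
  qed
qed

section \<open>Correlation functions\<close>

text \<open>The factors come out of rows and columns and their product is 1. This is what makes
  phases of the kernel irrelevant for correlations.\<close>

lemma det_conjugation_invariant:
  fixes A :: "complex ^ 'm ^ 'm" and c :: "'m \<Rightarrow> complex"
  assumes "\<And>k. cmod (c k) = 1"
  shows "det (\<chi> k l. cnj (c k) * c l * A $ k $ l) = det A"
proof -
  have "(\<chi> k l. cnj (c k) * c l * A $ k $ l) = (\<chi> k. cnj (c k) *s (transpose (\<chi> l. c l *s (transpose A $ l)) $ k))"
    by (simp add: vec_eq_iff transpose_def mult_ac)
  then have "det (\<chi> k l. cnj (c k) * c l * A $ k $ l) = prod (\<lambda>k. cnj (c k)) UNIV * det (\<chi> k. transpose (\<chi> l. c l *s (transpose A $ l)) $ k)"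
    by (simp only: det_rows_mul)
  also have "(\<chi> k. transpose (\<chi> l. c l *s (transpose A $ l)) $ k) = transpose (\<chi> l. c l *s (transpose A $ l))"
    by (simp add: vec_eq_iff)
  also have "det (transpose (\<chi> l. c l *s (transpose A $ l))) = prod c UNIV * det (\<chi> l. transpose A $ l)"
    by (simp only: det_transpose det_rows_mul)
  also have "(\<chi> l. transpose A $ l) = transpose A"
    by (simp add: vec_eq_iff)
  also have "prod (\<lambda>k. cnj (c k)) UNIV * (prod c UNIV * det (transpose A)) = (\<Prod>k\<in>UNIV. cnj (c k) * c k) * det A"
    by (simp add: prod.distrib det_transpose)
  also have "(\<Prod>k\<in>UNIV. cnj (c k) * c k) = 1"
    using assms by (intro prod.neutral) (metis complex_norm_square mult.commute of_real_1 one_power2)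
  finally show ?thesis by simp
qed

text \<open>The real part of \<open>t * z\<^sup>2\<close> cancels between the weight and Mehler's
  function, the imaginary part gives a phase in each variable. Up to these phases the kernel is the
  infinite Ginibre kernel times \<open>kernel_ratio\<close>.\<close>

lemma std_kernel_eq:
  assumes t: "0 \<le> t" "t < 1"
  shows "std_kernel n t w z = of_real (real n / pi) * (cnj (cis (- (real n * t * Im (w\<^sup>2) / 2))) * cis (- (real n * t * Im (z\<^sup>2) / 2))
     * exp (of_nat n * (cnj w * z - ((cmod w)\<^sup>2 + (cmod z)\<^sup>2) / 2)) * kernel_ratio n t w z)"
proof -
  define a where "a = sqrt (real n * (1 - t\<^sup>2))"
  have t2: "t\<^sup>2 < 1" using t by (simp add: abs_square_less_1)
  then have a2: "a\<^sup>2 = real n * (1 - t\<^sup>2)" by (simp add: a_def)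
  define M where "M = mehler_fun t a 1 (cnj w) z"
  have M0: "M \<noteq> 0" unfolding M_def using t by (intro mehler_fun_nonzero) auto
  have sum: "(\<Sum>k<n. herm t a k (cnj w) * herm t a k z / fact k) = M * kernel_ratio n t w z"
    using M0 by (simp add: kernel_ratio_def M_def a_def mehler_term_def)
  define E where "E = exp (- (real n / 2) * (std_potential t w + std_potential t z))"
  define F where "F = exp (of_nat n * (cnj w * z - of_real t * ((cnj w)\<^sup>2 + z\<^sup>2) / 2))"
  have M: "M = of_real ((1 - t\<^sup>2) powr (- (1 / 2))) * F"
    unfolding M_def F_def by (rule mehler_fun_one[OF t a2])
  have "sqrt (1 - t\<^sup>2) * (1 - t\<^sup>2) powr (- (1 / 2)) = 1"
    using t2 by (simp add: powr_half_sqrt[symmetric] powr_add[symmetric])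
  then have one: "complex_of_real (sqrt (1 - t\<^sup>2)) * of_real ((1 - t\<^sup>2) powr (- (1 / 2))) = 1"
    by (metis of_real_1 of_real_mult)
  have ex: "of_real E * F = cnj (cis (- (real n * t * Im (w\<^sup>2) / 2))) * cis (- (real n * t * Im (z\<^sup>2) / 2))
     * exp (of_nat n * (cnj w * z - ((cmod w)\<^sup>2 + (cmod z)\<^sup>2) / 2))"
  proof -
    have c: "cnj (u\<^sup>2) = of_real (Re (u\<^sup>2)) - \<i> * of_real (Im (u\<^sup>2))" "u\<^sup>2 = of_real (Re (u\<^sup>2)) + \<i> * of_real (Im (u\<^sup>2))" for u
      by (simp_all add: complex_eq_iff del: complex_cnj_power)
    have cw: "(cnj w)\<^sup>2 = of_real (Re (w\<^sup>2)) - \<i> * of_real (Im (w\<^sup>2))" using c(1)[of w] by simp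
    define rw iw rz iz where "rw = Re (w\<^sup>2)" and "iw = Im (w\<^sup>2)" and "rz = Re (z\<^sup>2)" and "iz = Im (z\<^sup>2)"
    have q: "(cnj w)\<^sup>2 + z\<^sup>2 = (of_real rw - \<i> * of_real iw) + (of_real rz + \<i> * of_real iz)"
      using cw c(2)[of z] by (simp only: rw_def iw_def rz_def iz_def)
    have "of_real (- (real n / 2) * (std_potential t w + std_potential t z)) + of_nat n * (cnj w * z - of_real t * ((cnj w)\<^sup>2 + z\<^sup>2) / 2)
       = - (\<i> * of_real (- (real n * t * iw / 2))) + \<i> * of_real (- (real n * t * iz / 2))
         + of_nat n * (cnj w * z - ((cmod w)\<^sup>2 + (cmod z)\<^sup>2) / 2)"
      unfolding q std_potential_def rw_def[symmetric] rz_def[symmetric] by (simp add: field_simps)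
    then show ?thesis
      unfolding E_def F_def cis_cnj unfolding cis_conv_exp iw_def[symmetric] iz_def[symmetric] exp_of_real[symmetric] exp_add[symmetric]
      by (simp only: of_real_minus mult_minus_right minus_minus)
  qed
  have "std_kernel n t w z = of_real (real n / pi) * of_real (sqrt (1 - t\<^sup>2)) * of_real E * (M * kernel_ratio n t w z)"
    unfolding std_kernel_def a_def[symmetric] sum E_def by simp
  also have "\<dots> = of_real (real n / pi) * (complex_of_real (sqrt (1 - t\<^sup>2)) * of_real ((1 - t\<^sup>2) powr (- (1 / 2)))) * (of_real E * F) * kernel_ratio n t w z"
    unfolding M by (simp only: mult_ac)
  finally show ?thesis
    unfolding one ex by (simp only: mult_1_right mult.assoc)
qed

text \<open>The term \<open>k = 0\<close> of the sum is 1. Positivity permits dividing by the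
  density and identifies \<open>csqrt\<close> with the real square root.\<close>

lemma kernel_ratio_diag_pos:
  assumes t: "0 \<le> t" "t < 1" and n: "0 < n"
  obtains \<rho> where "0 < \<rho>" "kernel_ratio n t z z = of_real \<rho>"
proof -
  define a where "a = sqrt (real n * (1 - t\<^sup>2))"
  have t2: "t\<^sup>2 < 1" using t by (simp add: abs_square_less_1)
  then have a2: "a\<^sup>2 = real n * (1 - t\<^sup>2)" by (simp add: a_def)
  define p where "p = (\<lambda>k. (cmod (herm t a k z))\<^sup>2 / fact k)"
  have P: "mehler_term t a 1 (cnj z) z k = of_real (p k)" for k
    unfolding p_def mehler_term_def cnj_herm[symmetric] by (simp add: complex_norm_square mult.commute flip: of_real_power)
  have "0 < mehler_diag n t z" using t2 by (simp add: mehler_diag_def)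
  moreover have "0 < (\<Sum>k<n. p k)"
    using n by (intro sum_pos2[of _ 0]) (auto simp: p_def)
  ultimately have "0 < (\<Sum>k<n. p k) / mehler_diag n t z" by simp
  moreover have "kernel_ratio n t z z = of_real ((\<Sum>k<n. p k) / mehler_diag n t z)"
    unfolding kernel_ratio_def a_def[symmetric] P mehler_fun_diag[OF t a2] by simp
  ultimately show thesis by (rule that)
qed

lemma cmod_square_diff_expand:
  "cnj a * b - ((cmod a)\<^sup>2 + (cmod b)\<^sup>2) / 2 = of_real (- ((cmod (a - b))\<^sup>2 / 2)) + \<i> * of_real (Im (cnj a * b))"
  by (simp add: complex_eq_iff cmod_power2) (simp add: power2_eq_square field_simps)

text \<open>The normalised correlation with the gauge phases removed. The original parameters enter
  only through \<open>t\<close>, the base point \<open>z\<close> in standard coordinates and the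
  unimodular direction \<open>\<mu>\<close>. Measuring lengths by the kernel at the base point
  produces the factor \<open>pi / R\<close>, whose limit differs between bulk and edge.\<close>

definition scaled_correlation :: "nat \<Rightarrow> real \<Rightarrow> complex \<Rightarrow> complex \<Rightarrow> complex ^ 'm \<Rightarrow> complex" where
  "scaled_correlation n t z \<mu> a =
    (let R = Re (kernel_ratio n t z z); pt = \<lambda>k. z + \<mu> * a $ k * of_real (sqrt (pi / R)) / of_real (sqrt (real n))
     in det (\<chi> k l. exp (of_real (pi / R) * (of_real (- ((cmod (a $ k - a $ l))\<^sup>2 / 2)) + \<i> * of_real (Im (cnj (a $ k) * a $ l))))
       * (kernel_ratio n t (pt k) (pt l) / of_real R)))"

text \<open>The gauge factors \<open>g k\<close> collect the phases of the kernel; they drop out of the determinant.\<close>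

lemma correlation_elliptic_potential:
  fixes a :: "complex ^ 'm" and t1 t2 z0 u :: complex
  assumes n: "0 < n" and t0: "0 < t0" and t2: "2 * cmod t2 < 1" and u: "cmod u = 1"
  defines "t \<equiv> 2 * cmod t2" and "V \<equiv> elliptic_potential t0 t1 t2" and "z' \<equiv> std_point t0 t1 t2 z0"
  defines "K \<equiv> repr_kernel n V z0 z0" and "\<mu> \<equiv> cis (Arg t2 / 2) * u"
  shows "correlation n V (\<chi> k. z0 + a $ k * u / csqrt K) / K ^ CARD('m) = scaled_correlation n t z' \<mu> a"
proof -
  define R where "R = Re (kernel_ratio n t z' z')"
  define pt where "pt = (\<lambda>k. z' + \<mu> * a $ k * of_real (sqrt (pi / R)) / of_real (sqrt (real n)))"
  have t: "0 \<le> t" "t < 1" using t2 by (simp_all add: t_def)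
  obtain R' where R': "0 < R'" "kernel_ratio n t z' z' = of_real R'"
    using kernel_ratio_diag_pos[OF t n] .
  then have R: "0 < R" "kernel_ratio n t z' z' = of_real R" by (simp_all add: R_def)
  have rk: "repr_kernel n V w z = of_real (1 / t0) * std_kernel n t (std_point t0 t1 t2 w) (std_point t0 t1 t2 z)" for w z
    unfolding V_def t_def by (rule repr_kernel_elliptic_potential[OF n t0 t2])
  define K' where "K' = real n / pi * R / t0"
  have K': "0 < K'" using n t0 R by (simp add: K'_def)
  have "std_kernel n t z' z' = of_real (real n / pi * R)"
  proof -
    have "cnj z' * z' - ((cmod z')\<^sup>2 + (cmod z')\<^sup>2) / 2 = 0"
      unfolding cmod_square_diff_expand by simp
    moreover have "cnj (cis x) * cis x = 1" for x by (simp add: cis_cnj cis_mult)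
    ultimately show ?thesis
      unfolding std_kernel_eq[OF t] R by simp
  qed
  then have K: "K = of_real K'"
    unfolding K_def rk z'_def[symmetric] by (simp add: K'_def)
  have cs: "csqrt K = of_real (sqrt K')"
    unfolding K using K' by simp
  define s where "s = sqrt (pi / R) / sqrt (real n)"
  \<comment> \<open>\<open>s\<close> is the length, in standard coordinates, of one unit of the
    variables \<open>a $ k\<close>.\<close>
  have ss: "real n * (s * s) = pi / R"
  proof -
    have "s * s = (sqrt (pi / R) * sqrt (pi / R)) / (sqrt (real n) * sqrt (real n))"
      unfolding s_def by (rule times_divide_times_eq)
    also have "\<dots> = (pi / R) / real n"
      unfolding real_sqrt_mult_self using R by simp
    finally show ?thesis using n by simp
  qed
  define d where "d = (\<lambda>k. \<mu> * a $ k * of_real s)"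
  have ptd: "pt k = z' + d k" for k by (simp add: pt_def d_def s_def)
  have sp: "std_point t0 t1 t2 (z0 + a $ k * u / csqrt K) = pt k" for k
  proof -
    have "std_point t0 t1 t2 (z0 + v) = z' + cis (Arg t2 / 2) * v / of_real (sqrt t0)" for v
      by (simp add: std_point_def z'_def add_divide_distrib diff_divide_distrib ring_distribs)
    moreover have "sqrt K' * sqrt t0 = 1 / s"
      unfolding K'_def s_def using n t0 R by (simp add: real_sqrt_mult real_sqrt_divide)
    then have "complex_of_real (sqrt K') * of_real (sqrt t0) = 1 / of_real s"
      by (metis of_real_1 of_real_divide of_real_mult)
    ultimately show ?thesis
      unfolding cs ptd d_def \<mu>_def by (simp add: mult_ac)
  qed
  define g where "g = (\<lambda>k. cis (- (real n * t * Im ((pt k)\<^sup>2) / 2)) * cis (real n * Im (cnj z' * d k)))"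
  have g: "cmod (g k) = 1" for k by (simp add: g_def norm_mult)
  have mu: "cnj \<mu> * \<mu> = 1"
    using u by (simp add: \<mu>_def cis_cnj cis_mult mult_ac) (metis complex_norm_square mult.commute of_real_1 one_power2)
  have ex: "exp (of_nat n * (cnj (pt k) * pt l - ((cmod (pt k))\<^sup>2 + (cmod (pt l))\<^sup>2) / 2)) =
      cnj (cis (real n * Im (cnj z' * d k))) * cis (real n * Im (cnj z' * d l)) *
      exp (of_real (pi / R) * (of_real (- ((cmod (a $ k - a $ l))\<^sup>2 / 2)) + \<i> * of_real (Im (cnj (a $ k) * a $ l))))" for k l
  proof -
    \<comment> \<open>The Ginibre exponent is translation invariant up to one phase for each point;
      these phases are the second factors of \<open>g\<close>.\<close>
    have 1: "cnj (z' + p) * (z' + q) - ((cmod (z' + p))\<^sup>2 + (cmod (z' + q))\<^sup>2) / 2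
        = - (\<i> * of_real (Im (cnj z' * p))) + \<i> * of_real (Im (cnj z' * q)) + (cnj p * q - ((cmod p)\<^sup>2 + (cmod q)\<^sup>2) / 2)" for p q
      unfolding cmod_square_diff_expand by (simp add: complex_eq_iff) (simp add: algebra_simps)
    have 2: "cnj (d k) * d l - ((cmod (d k))\<^sup>2 + (cmod (d l))\<^sup>2) / 2 = of_real (s * s) * (cnj (a $ k) * a $ l - ((cmod (a $ k))\<^sup>2 + (cmod (a $ l))\<^sup>2) / 2)"
    proof -
      have "cnj (d k) * d l = (cnj \<mu> * \<mu>) * (cnj (a $ k) * a $ l * of_real (s * s))" by (simp add: d_def mult_ac)
      moreover have "cmod \<mu> = 1" using u by (simp add: \<mu>_def norm_mult)
      then have "(cmod (d k))\<^sup>2 = (s * s) * (cmod (a $ k))\<^sup>2" for k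
        by (simp add: d_def norm_mult power_mult_distrib power2_eq_square)
      ultimately show ?thesis
        unfolding mu by (simp add: algebra_simps)
    qed
    have "of_nat n * (cnj (pt k) * pt l - ((cmod (pt k))\<^sup>2 + (cmod (pt l))\<^sup>2) / 2)
        = - (\<i> * of_real (real n * Im (cnj z' * d k))) + \<i> * of_real (real n * Im (cnj z' * d l))
          + of_real (real n * (s * s)) * (cnj (a $ k) * a $ l - ((cmod (a $ k))\<^sup>2 + (cmod (a $ l))\<^sup>2) / 2)"
      unfolding ptd 1 2 by (simp only: distrib_left of_real_mult of_real_of_nat_eq mult_minus_right mult_ac)
    then show ?thesis
      unfolding ss cmod_square_diff_expand cis_cnj unfolding cis_conv_exp exp_add[symmetric]
      by (simp only: of_real_minus mult_minus_right minus_minus)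
  qed
  have entry: "repr_kernel n V (z0 + a $ k * u / csqrt K) (z0 + a $ l * u / csqrt K) =
     K * (cnj (g k) * g l * (exp (of_real (pi / R) * (of_real (- ((cmod (a $ k - a $ l))\<^sup>2 / 2)) + \<i> * of_real (Im (cnj (a $ k) * a $ l))))
       * (kernel_ratio n t (pt k) (pt l) / of_real R)))" for k l
  proof -
    have KR: "K = of_real (1 / t0) * of_real (real n / pi) * of_real R" by (simp add: K K'_def)
    have gen: "x * (y * (c1 * c2 * (d1 * d2 * e) * k)) = x * y * r * (c1 * d1 * (c2 * d2) * (e * (k / r)))"
      if "r \<noteq> 0" for x y c1 c2 d1 d2 e k r :: complex
      using that by simp
    show ?thesis
      unfolding rk sp std_kernel_eq[OF t, of n "pt k" "pt l"] ex g_def complex_cnj_mult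
      unfolding KR by (rule gen) (use R in simp)
  qed
  define A where "A = (\<chi> k l. exp (of_real (pi / R) * (of_real (- ((cmod (a $ k - a $ l))\<^sup>2 / 2)) + \<i> * of_real (Im (cnj (a $ k) * a $ l))))
       * (kernel_ratio n t (pt k) (pt l) / of_real R))"
  have "correlation n V (\<chi> k. z0 + a $ k * u / csqrt K) = det (\<chi> k. K *s (\<chi> l. cnj (g k) * g l * A $ k $ l))"
    unfolding correlation_def by (rule arg_cong[of _ _ det]) (simp add: vec_eq_iff entry A_def)
  also have "\<dots> = K ^ CARD('m) * det (\<chi> k l. cnj (g k) * g l * A $ k $ l)"
    by (simp only: det_rows_mul prod_constant)
  also have "det (\<chi> k l. cnj (g k) * g l * A $ k $ l) = det A"
    by (rule det_conjugation_invariant[OF g])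
  also have "det A = scaled_correlation n t z' \<mu> a"
    unfolding A_def scaled_correlation_def Let_def R_def pt_def ..
  finally show ?thesis
    using K K' by simp
qed

section \<open>Geometry of the droplet\<close>

lemma csqrt_eq_cis: "csqrt z = of_real (sqrt (cmod z)) * cis (Arg z / 2)"
proof (rule csqrt_unique)
  have "(of_real r * w)\<^sup>2 = of_real (r\<^sup>2) * (w * w)" for r and w :: complex
    by (simp add: power2_eq_square)
  then have "(of_real (sqrt (cmod z)) * cis (Arg z / 2))\<^sup>2 = of_real ((sqrt (cmod z))\<^sup>2) * (cis (Arg z / 2) * cis (Arg z / 2))" .
  also have "\<dots> = z"
    using rcis_cmod_Arg[of z] by (simp add: cis_mult rcis_def)
  finally show "(of_real (sqrt (cmod z)) * cis (Arg z / 2))\<^sup>2 = z" .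
  show "0 < Re (of_real (sqrt (cmod z)) * cis (Arg z / 2)) \<or>
      Re (of_real (sqrt (cmod z)) * cis (Arg z / 2)) = 0 \<and> 0 \<le> Im (of_real (sqrt (cmod z)) * cis (Arg z / 2))"
  proof (cases "z = 0")
    case False
    show ?thesis
    \<comment> \<open>For argument \<open>pi\<close> the root lies on the imaginary axis, where the
      choice is made by the sign of the imaginary part.\<close>
    proof (cases "Arg z = pi")
      case True
      then show ?thesis by simp
    next
      case neq: False
      then have "0 < cos (Arg z / 2)"
        using Arg_bounded[of z] by (intro cos_gt_zero_pi) auto
      then show ?thesis using False by simp
    qed
  qed simp
qed

text \<open>\<open>c\<close> is the ratio of the minor to the major semi-axis.\<close>

lemma semi_axes:
  assumes "0 < t0" "2 * cmod t2 < 1"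
  defines "c \<equiv> (1 - 2 * cmod t2) / (1 + 2 * cmod t2)"
  shows "0 < c" "c \<le> 1" "semi_a t0 t2 = sqrt t0 / sqrt c" "semi_b t0 t2 = sqrt t0 * sqrt c"
    "ellipse_form (2 * cmod t2) x y = x\<^sup>2 * c + y\<^sup>2 / c"
    "ellipse_gradient (2 * cmod t2) x y = sqrt (x\<^sup>2 * c\<^sup>2 + y\<^sup>2 / c\<^sup>2)"
proof -
  have n: "0 \<le> cmod t2" by simp
  have p: "0 < 1 + 2 * cmod t2" using n by linarith
  show "0 < c" unfolding c_def using assms(2) p by (intro divide_pos_pos) auto
  show "c \<le> 1" unfolding c_def divide_le_eq_1_pos[OF p] using n by linarith
  have ic: "(1 + 2 * cmod t2) / (1 - 2 * cmod t2) = 1 / c" by (simp add: c_def)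
  show "semi_a t0 t2 = sqrt t0 / sqrt c"
    unfolding semi_a_def ic by (simp add: real_sqrt_divide)
  show "semi_b t0 t2 = sqrt t0 * sqrt c"
    unfolding semi_b_def c_def[symmetric] by (rule real_sqrt_mult)
  show "ellipse_form (2 * cmod t2) x y = x\<^sup>2 * c + y\<^sup>2 / c"
    unfolding ellipse_form_def ic c_def[symmetric] by simp
  show "ellipse_gradient (2 * cmod t2) x y = sqrt (x\<^sup>2 * c\<^sup>2 + y\<^sup>2 / c\<^sup>2)"
    unfolding ellipse_gradient_def ic c_def[symmetric] by (simp add: power_divide)
qed

lemma csqrt_mult_std_point:
  assumes "0 < t0"
  shows "csqrt t2 * (z - centre t1 t2) = of_real (sqrt (cmod t2) * sqrt t0) * std_point t0 t1 t2 z"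
  using assms by (simp add: csqrt_eq_cis[of t2] std_point_def)

lemma cmod_std_point_0:
  assumes "0 < t0"
  shows "(cmod (std_point t0 t1 0 z))\<^sup>2 = (cmod (z - centre t1 0))\<^sup>2 / t0"
  using assms by (simp add: std_point_def norm_mult norm_divide power_divide)

lemma ellipse_boundary_std_point:
  assumes t0: "0 < t0" and t2: "2 * cmod t2 < 1" and z: "z \<in> ellipse_boundary t0 t1 t2"
  shows "ellipse_form (2 * cmod t2) (Re (std_point t0 t1 t2 z)) (Im (std_point t0 t1 t2 z)) = 1"
proof (cases "t2 = 0")
  case True
  then have "(cmod (std_point t0 t1 t2 z))\<^sup>2 = 1"
    using z t0 cmod_std_point_0[OF t0, of t1 z] by (simp add: ellipse_boundary_def)
  then show ?thesis
    using True by (simp add: ellipse_form_def cmod_power2)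
next
  case False
  define c where "c = (1 - 2 * cmod t2) / (1 + 2 * cmod t2)"
  note ax = semi_axes[OF t0 t2, folded c_def]
  define x y where "x = Re (std_point t0 t1 t2 z)" and "y = Im (std_point t0 t1 t2 z)"
  define k where "k = sqrt (cmod t2) * sqrt t0"
  have k2: "k\<^sup>2 = cmod t2 * t0" using t0 by (simp add: k_def power_mult_distrib)
  have "(k * x)\<^sup>2 / (sqrt t0 / sqrt c)\<^sup>2 + (k * y)\<^sup>2 / (sqrt t0 * sqrt c)\<^sup>2 = cmod t2"
    using z False unfolding ellipse_boundary_def if_not_P[OF False] csqrt_mult_std_point[OF t0] ax(3,4) k_def x_def y_def by simp
  then have "cmod t2 * (x\<^sup>2 * c + y\<^sup>2 / c) = cmod t2 * 1"
    using t0 ax(1) by (simp add: power_mult_distrib power_divide k2 distrib_left)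
  then have "x\<^sup>2 * c + y\<^sup>2 / c = 1"
    using False mult_cancel_left[of "cmod t2"] by (metis norm_eq_zero)
  then show ?thesis unfolding ax(5) x_def y_def .
qed

text \<open>Turns the absolute shortening of the axes into a relative one. In units of
  \<open>sqrt t0\<close> the minor semi-axis is \<open>sqrt c\<close>, and
  \<open>sqrt (\<delta>0 / (2 - \<delta>0))\<close> is its smallest possible value; a smaller
  \<open>\<delta>\<close> keeps both shortened axes positive.\<close>

lemma ellipse_region_std_point:
  assumes t0: "0 < t0" and t2: "2 * cmod t2 \<le> 1 - \<delta>0" and \<delta>0: "0 < \<delta>0" "\<delta>0 < 1"
    and \<delta>: "0 < \<delta>" "\<delta> < sqrt (\<delta>0 / (2 - \<delta>0))" and z: "z \<in> ellipse_region t0 t1 t2 (- \<delta>)"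
  shows "ellipse_form (2 * cmod t2) (Re (std_point t0 t1 t2 z)) (Im (std_point t0 t1 t2 z))
     \<le> (1 - \<delta> * sqrt (\<delta>0 / (2 - \<delta>0)))\<^sup>2"
proof -
  define s where "s = sqrt (\<delta>0 / (2 - \<delta>0))"
  have t2': "2 * cmod t2 < 1" using t2 \<delta>0 by simp
  define c where "c = (1 - 2 * cmod t2) / (1 + 2 * cmod t2)"
  note ax = semi_axes[OF t0 t2', folded c_def]
  have s1: "0 < s" "s \<le> 1" using \<delta>0 by (simp_all add: s_def)
  have "\<delta>0 / (2 - \<delta>0) \<le> c"
    unfolding c_def using t2 \<delta>0 norm_ge_zero[of t2] by (intro frac_le) linarith+
  then have sc: "s \<le> sqrt c" by (simp add: s_def)
  have c1: "sqrt c \<le> 1" "0 < sqrt c" using ax by simp_all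
  have ds: "\<delta> < s" unfolding s_def by (rule \<delta>(2))
  have sd: "0 < \<delta> * s" "\<delta> * s < 1"
  proof -
    show "0 < \<delta> * s" using \<delta> s1 by simp
    have "\<delta> * s \<le> \<delta> * 1" using \<delta> s1 by (intro mult_left_mono) auto
    then show "\<delta> * s < 1" using ds s1 by linarith
  qed
  define x y where "x = Re (std_point t0 t1 t2 z)" and "y = Im (std_point t0 t1 t2 z)"
  show ?thesis
  proof (cases "t2 = 0")
    case True
    have "(cmod (std_point t0 t1 t2 z))\<^sup>2 \<le> (1 - \<delta>)\<^sup>2"
      using z t0 True cmod_std_point_0[OF t0, of t1 z] by (simp add: ellipse_region_def divide_le_eq mult.commute)
    also have "\<dots> \<le> (1 - \<delta> * s)\<^sup>2"
      using \<delta> s1 sd by (intro power_mono) (auto simp: mult_left_le s_def[symmetric])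
    finally show ?thesis
      using True by (simp add: ellipse_form_def cmod_power2 s_def)
  next
    case False
    define k where "k = sqrt (cmod t2) * sqrt t0"
    have k2: "k\<^sup>2 = cmod t2 * t0" using t0 by (simp add: k_def power_mult_distrib)
    define A B where "A = 1 / sqrt c - \<delta>" and "B = sqrt c - \<delta>"
    have dc: "\<delta> < sqrt c" using ds sc by linarith
    have ge1: "1 \<le> 1 / sqrt c" using c1 by simp
    have B: "0 < B" using dc by (simp add: B_def)
    have A: "0 < A" unfolding A_def using dc c1 ge1 by linarith
    have "(k * x)\<^sup>2 / (sqrt t0 * A)\<^sup>2 + (k * y)\<^sup>2 / (sqrt t0 * B)\<^sup>2 < cmod t2"
    proof -
      have "sqrt t0 / sqrt c + - \<delta> * sqrt t0 = sqrt t0 * A" "sqrt t0 * sqrt c + - \<delta> * sqrt t0 = sqrt t0 * B"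
        by (simp_all add: A_def B_def algebra_simps)
      then show ?thesis
        using z False unfolding ellipse_region_def if_not_P[OF False] csqrt_mult_std_point[OF t0] ax(3,4) k_def x_def y_def by simp
    qed
    then have "cmod t2 * (x\<^sup>2 / A\<^sup>2 + y\<^sup>2 / B\<^sup>2) < cmod t2 * 1"
      using t0 by (simp add: power_mult_distrib k2 distrib_left)
    then have lt: "x\<^sup>2 / A\<^sup>2 + y\<^sup>2 / B\<^sup>2 < 1"
      using False by simp
    \<comment> \<open>The relative shortenings are \<open>\<delta> * sqrt c\<close> and
      \<open>\<delta> / sqrt c\<close>; both are at least \<open>\<delta> * s\<close>, uniformly in
      the parameters.\<close>
    have "A = 1 / sqrt c * (1 - \<delta> * sqrt c)" "B = sqrt c * (1 - \<delta> * (1 / sqrt c))"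
      using c1 by (simp_all add: A_def B_def right_diff_distrib)
    moreover have "\<delta> * s \<le> \<delta> * sqrt c" "\<delta> * s \<le> \<delta> * (1 / sqrt c)"
      using \<delta> sc s1 ge1 by (intro mult_left_mono; linarith)+
    ultimately have "A \<le> 1 / sqrt c * (1 - \<delta> * s)" "B \<le> sqrt c * (1 - \<delta> * s)"
      using c1 by (simp_all only:) (intro mult_left_mono; simp)+
    then have "A\<^sup>2 \<le> (1 / sqrt c * (1 - \<delta> * s))\<^sup>2" "B\<^sup>2 \<le> (sqrt c * (1 - \<delta> * s))\<^sup>2"
      using A B by (simp_all only: power_mono less_imp_le)
    then have AB: "A\<^sup>2 * c \<le> (1 - \<delta> * s)\<^sup>2" "B\<^sup>2 / c \<le> (1 - \<delta> * s)\<^sup>2"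
      using ax(1) by (simp_all add: power_mult_distrib power_divide pos_le_divide_eq pos_divide_le_eq mult.commute)
    have "x\<^sup>2 * c + y\<^sup>2 / c = (x\<^sup>2 / A\<^sup>2) * (A\<^sup>2 * c) + (y\<^sup>2 / B\<^sup>2) * (B\<^sup>2 / c)"
      using A B by simp
    also have "\<dots> \<le> (x\<^sup>2 / A\<^sup>2) * (1 - \<delta> * s)\<^sup>2 + (y\<^sup>2 / B\<^sup>2) * (1 - \<delta> * s)\<^sup>2"
      using AB by (intro add_mono mult_left_mono) auto
    also have "\<dots> = (x\<^sup>2 / A\<^sup>2 + y\<^sup>2 / B\<^sup>2) * (1 - \<delta> * s)\<^sup>2"
      by (simp only: distrib_right)
    also have "\<dots> \<le> 1 * (1 - \<delta> * s)\<^sup>2"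
      using lt by (intro mult_right_mono) auto
    finally show ?thesis
      unfolding ax(5) x_def[symmetric] y_def[symmetric] s_def by simp
  qed
qed

lemma cis_inj_principal:
  assumes "cis x = cis y" "x \<in> {- pi<..pi}" "y \<in> {- pi<..pi}"
  shows "x = y"
proof -
  have "Arg (cis r) = r" if "r \<in> {- pi<..pi}" for r
    by (rule cis_Arg_unique) (use that in \<open>simp_all add: sgn_eq\<close>)
  then show ?thesis using assms by metis
qed

text \<open>After rotation into standard coordinates the direction given by the case distinction on
  \<open>\<phi>\<close> is the outward unit normal, that is, the gradient of
  \<open>ellipse_form\<close> divided by its length.\<close>

lemma cis_normal_angle:
  assumes t0: "0 < t0" and t2: "2 * cmod t2 < 1" and z: "z \<in> ellipse_boundary t0 t1 t2"
  defines "t \<equiv> 2 * cmod t2" and "x \<equiv> Re (std_point t0 t1 t2 z)" and "y \<equiv> Im (std_point t0 t1 t2 z)"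
  shows "cis (Arg t2 / 2) * cis (normal_angle t0 t1 t2 z) =
    Complex (x * ((1 - t) / (1 + t))) (y * ((1 + t) / (1 - t))) / of_real (ellipse_gradient t x y)"
proof -
  define c where "c = (1 - 2 * cmod t2) / (1 + 2 * cmod t2)"
  note ax = semi_axes[OF t0 t2, folded c_def]
  have ic: "(1 - t) / (1 + t) = c" "(1 + t) / (1 - t) = 1 / c" unfolding t_def c_def divide_divide_eq_right mult_1 by (rule refl)+
  have form: "x\<^sup>2 * c + y\<^sup>2 / c = 1"
    using ellipse_boundary_std_point[OF t0 t2 z] unfolding ax(5) x_def y_def .
  define \<phi> where "\<phi> = Arg (Complex (x * sqrt c) (y / sqrt c))"
  have sc: "0 < sqrt c" "sqrt c * sqrt c = c" using ax(1) by simp_all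
  have nrm: "cmod (Complex (x * sqrt c) (y / sqrt c)) = 1"
    using form ax(1) by (simp add: complex_norm power_mult_distrib power_divide)
  then have "Complex (x * sqrt c) (y / sqrt c) = cis \<phi>"
    using cis_Arg[of "Complex (x * sqrt c) (y / sqrt c)"] unfolding \<phi>_def by (metis div_by_1 norm_zero of_real_1 sgn_eq zero_neq_one)
  then have cs: "x * sqrt c = cos \<phi>" "y / sqrt c = sin \<phi>"
    by (simp_all add: complex_eq_iff)
  have \<phi>: "\<phi> \<in> {- pi<..pi}" using Arg_bounded by (simp add: \<phi>_def)
  have xy: "x = cos \<phi> / sqrt c" "y = sqrt c * sin \<phi>"
    unfolding cs[symmetric] using sc(1) by simp_all
  have sp: "std_point t0 t1 t2 z = Complex x y" by (simp add: x_def y_def)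
  have angle: "ellipse_angle t0 t1 t2 z = \<phi>"
    unfolding ellipse_angle_def
  proof (rule the_equality)
    \<comment> \<open>Both forms of the condition say that \<open>\<psi>\<close> and
      \<open>\<phi>\<close> have the same sine and cosine, so the angle is unique in the half-open
      interval.\<close>
    have key: "(if t2 = 0 then z - centre t1 t2 = complex_of_real (sqrt t0) * cis \<psi>
         else csqrt (t2 / complex_of_real (cmod t2)) * (z - centre t1 t2) =
              Complex (semi_a t0 t2 * cos \<psi>) (semi_b t0 t2 * sin \<psi>)) \<longleftrightarrow> cis \<psi> = cis \<phi>" for \<psi>
    proof (cases "t2 = 0")
      case True
      have c1: "c = 1" using True by (simp add: c_def)
      have "z - centre t1 t2 = of_real (sqrt t0) * Complex x y"
        using t0 True unfolding sp[symmetric] by (simp add: std_point_def Arg_zero)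
      also have "Complex x y = cis \<phi>" using xy c1 by (simp add: complex_eq_iff)
      finally show ?thesis using True t0 by auto
    next
      case False
      have "csqrt (t2 / of_real (cmod t2)) = cis (Arg t2 / 2)"
      proof -
        have "Arg (t2 / of_real (cmod t2)) = Arg t2"
          using False Arg_times_of_real2[of "1 / cmod t2" t2] by (simp add: divide_inverse)
        then show ?thesis
          using False csqrt_eq_cis[of "t2 / of_real (cmod t2)"] by (simp add: norm_divide)
      qed
      then have E: "csqrt (t2 / complex_of_real (cmod t2)) * (z - centre t1 t2) = of_real (sqrt t0) * Complex x y"
        using t0 unfolding sp[symmetric] by (simp add: std_point_def)
      have gen: "of_real k * Complex (C / s) (s * S) = Complex (k / s * C') (k * s * S') \<longleftrightarrow> C' = C \<and> S' = S"
        if "0 < k" "0 < s" for k s C S C' S' :: real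
        using that by (auto simp: complex_eq_iff)
      have "0 < sqrt t0" using t0 by simp
      then show ?thesis
        unfolding if_not_P[OF False] E ax(3,4) xy gen[OF \<open>0 < sqrt t0\<close> sc(1)] by (simp add: complex_eq_iff)
    qed
    show "\<phi> \<in> {- pi<..pi} \<and> (if t2 = 0 then z - centre t1 t2 = complex_of_real (sqrt t0) * cis \<phi>
         else csqrt (t2 / complex_of_real (cmod t2)) * (z - centre t1 t2) =
              Complex (semi_a t0 t2 * cos \<phi>) (semi_b t0 t2 * sin \<phi>))"
      unfolding key using \<phi> by simp
    show "\<psi> = \<phi>" if "\<psi> \<in> {- pi<..pi} \<and> (if t2 = 0 then z - centre t1 t2 = complex_of_real (sqrt t0) * cis \<psi>
         else csqrt (t2 / complex_of_real (cmod t2)) * (z - centre t1 t2) =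
              Complex (semi_a t0 t2 * cos \<psi>) (semi_b t0 t2 * sin \<psi>))" for \<psi>
      using that \<phi> unfolding key by (auto intro: cis_inj_principal)
  qed
  \<comment> \<open>\<open>(cos \<phi>, sin \<phi> / c)\<close> is the gradient direction up to a
    positive factor, and \<open>Q\<close> is its length.\<close>
  define Q where "Q = sqrt ((cos \<phi>)\<^sup>2 + (sin \<phi> / c)\<^sup>2)"
  have Qpos: "0 < Q"
  proof -
    have "(cos \<phi>)\<^sup>2 + (sin \<phi> / c)\<^sup>2 \<noteq> 0"
    proof
      assume "(cos \<phi>)\<^sup>2 + (sin \<phi> / c)\<^sup>2 = 0"
      then have "cos \<phi> = 0" "sin \<phi> = 0" using ax(1) by (auto simp: sum_power2_eq_zero_iff)
      then show False using sin_cos_squared_add[of \<phi>] by simp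
    qed
    then show ?thesis by (simp add: Q_def less_le add_nonneg_nonneg)
  qed
  have D: "ellipse_gradient t x y = sqrt c * Q"
  proof -
    have "x\<^sup>2 * c\<^sup>2 + y\<^sup>2 / c\<^sup>2 = c * ((cos \<phi>)\<^sup>2 + (sin \<phi> / c)\<^sup>2)"
      unfolding xy using ax(1) by (simp add: power_mult_distrib power_divide power2_eq_square[of c] distrib_left)
    then show ?thesis unfolding t_def ax(6) Q_def by (simp add: real_sqrt_mult)
  qed
  have rhs: "Complex (x * ((1 - t) / (1 + t))) (y * ((1 + t) / (1 - t))) / of_real (ellipse_gradient t x y) = Complex (cos \<phi> / Q) (sin \<phi> / c / Q)"
  proof -
    have "C / s * (s * s) = s * C" if "0 < s" for s C :: real using that by simp
    then have "x * (sqrt c * sqrt c) = sqrt c * cos \<phi>" "y * (1 / c) = sqrt c * (sin \<phi> / c)"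
      unfolding xy using sc(1) by (blast, simp)
    then have "x * c = sqrt c * cos \<phi>" "y * (1 / c) = sqrt c * (sin \<phi> / c)"
      unfolding sc(2) .
    then show ?thesis
      unfolding ic D using sc(1) Qpos by (simp add: complex_eq_iff)
  qed
  define \<theta> where "\<theta> = arctan (1 / c * tan \<phi>)"
  have pm: "cos \<phi> = 0 \<longleftrightarrow> \<phi> = pi / 2 \<or> \<phi> = - (pi / 2)"
  proof
    assume "cos \<phi> = 0"
    moreover have "0 < cos \<phi>" if "\<bar>\<phi>\<bar> < pi / 2" using that by (intro cos_gt_zero_pi) auto
    moreover have "cos \<phi> < 0" if "pi / 2 < \<bar>\<phi>\<bar>"
    proof -
      have "0 < cos (pi - \<bar>\<phi>\<bar>)" using that \<phi> by (intro cos_gt_zero_pi) auto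
      then show ?thesis by (simp add: abs_if split: if_splits)
    qed
    ultimately have "\<bar>\<phi>\<bar> = pi / 2" by (metis less_irrefl linorder_neqE_linordered_idom)
    then show "\<phi> = pi / 2 \<or> \<phi> = - (pi / 2)" by linarith
  next
    assume "\<phi> = pi / 2 \<or> \<phi> = - (pi / 2)"
    then show "cos \<phi> = 0" by (elim disjE) (simp_all only: cos_pi_half cos_minus)
  qed
  have neg: "cos \<phi> < 0" if "\<phi> \<notin> {- (pi / 2)<..<pi / 2}" "\<not> (\<phi> = pi / 2 \<or> \<phi> = - (pi / 2))"
  proof -
    have "pi / 2 < \<bar>\<phi>\<bar>" using that by auto
    then have "0 < cos (pi - \<bar>\<phi>\<bar>)" using \<phi> by (intro cos_gt_zero_pi) auto
    then show ?thesis by (simp add: abs_if split: if_splits)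
  qed
  \<comment> \<open>The arctangent sees only the slope of the normal, so it yields the normal up to
    the sign of \<open>cos \<phi>\<close>.\<close>
  have ctheta: "cis \<theta> = of_real (\<bar>cos \<phi>\<bar> / cos \<phi>) * Complex (cos \<phi> / Q) (sin \<phi> / c / Q)" if "cos \<phi> \<noteq> 0"
  proof -
    have "1 + (1 / c * tan \<phi>)\<^sup>2 = ((cos \<phi>)\<^sup>2 + (sin \<phi> / c)\<^sup>2) / (cos \<phi>)\<^sup>2"
      using that by (simp add: tan_def power_mult_distrib power_divide add_divide_distrib)
    then have "sqrt (1 + (1 / c * tan \<phi>)\<^sup>2) = Q / \<bar>cos \<phi>\<bar>"
      by (simp add: Q_def real_sqrt_divide)
    then have "cos \<theta> = \<bar>cos \<phi>\<bar> / Q" "sin \<theta> = 1 / c * tan \<phi> * (\<bar>cos \<phi>\<bar> / Q)"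
      unfolding \<theta>_def cos_arctan sin_arctan by simp_all
    then show ?thesis
      using that by (simp add: complex_eq_iff tan_def mult_ac)
  qed
  have "cis (Arg t2 / 2) * cis (normal_angle t0 t1 t2 z) = Complex (cos \<phi> / Q) (sin \<phi> / c / Q)"
  proof (cases "t2 = 0")
    case True
    then have "c = 1" by (simp add: c_def)
    moreover have "cis (Arg t2 / 2) = 1" using True by (simp add: Arg_zero)
    moreover have "normal_angle t0 t1 t2 z = \<phi>" using True angle by (simp add: normal_angle_def Let_def)
    ultimately show ?thesis by (simp add: Q_def complex_eq_iff)
  next
    case False
    define \<psi> where "\<psi> = (if \<phi> = pi / 2 \<or> \<phi> = - (pi / 2) then \<phi>
            else if \<phi> \<in> {- (pi / 2)<..<pi / 2} then \<theta> else \<theta> + sgn \<phi> * pi)"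
    have na: "normal_angle t0 t1 t2 z = - (Arg t2 / 2) + \<psi>"
      unfolding normal_angle_def angle Let_def if_not_P[OF False] \<psi>_def \<theta>_def
      by (simp add: c_def)
    have "cis (Arg t2 / 2) * cis (normal_angle t0 t1 t2 z) = cis \<psi>"
      unfolding na cis_mult by simp
    also have "cis \<psi> = Complex (cos \<phi> / Q) (sin \<phi> / c / Q)"
    proof (cases "\<phi> = pi / 2 \<or> \<phi> = - (pi / 2)")
      case True
      then have "cos \<phi> = 0" by (simp only: pm)
      moreover then have "(sin \<phi>)\<^sup>2 = 1" using sin_cos_squared_add[of \<phi>] by simp
      ultimately have "Q = sqrt ((1 / c)\<^sup>2)" by (simp only: Q_def power_divide power_zero_numeral add_0 power_one)
      then have Q: "Q = 1 / c" using ax(1) by simp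
      have "\<psi> = \<phi>" unfolding \<psi>_def if_P[OF True] ..
      then show ?thesis unfolding Q using ax(1) \<open>cos \<phi> = 0\<close> by (simp add: complex_eq_iff)
    next
      case ne: False
      show ?thesis
      proof (cases "\<phi> \<in> {- (pi / 2)<..<pi / 2}")
        case True
        then have "0 < cos \<phi>" by (intro cos_gt_zero_pi) auto
        moreover have "\<psi> = \<theta>" unfolding \<psi>_def if_not_P[OF ne] if_P[OF True] ..
        ultimately show ?thesis using ctheta by simp
      next
        case out: False
        have n: "cos \<phi> < 0" by (rule neg[OF out ne])
        have "\<phi> \<noteq> 0" using out by auto
        \<comment> \<open>The added half-turn corrects the sign where \<open>cos \<phi>\<close> is
          negative; either sign of \<open>pi\<close> has the same effect under
          \<open>cis\<close>.\<close>
        then have "cis (sgn \<phi> * pi) = - 1" by (cases "0 < \<phi>") (simp_all add: complex_eq_iff)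
        moreover have "\<psi> = \<theta> + sgn \<phi> * pi" unfolding \<psi>_def if_not_P[OF ne] if_not_P[OF out] ..
        ultimately have "cis \<psi> = - cis \<theta>" by (simp only: cis_mult[symmetric] mult_minus1_right)
        then show ?thesis using ctheta n by (simp add: complex_eq_iff)
      qed
    qed
    finally show ?thesis .
  qed
  then show ?thesis unfolding rhs .
qed

section \<open>Limits along convergent parameters\<close>

lemma erfc_0: "erfc 0 = 1"
proof -
  have "has_bochner_integral lborel (\<lambda>x. complex_of_real (indicator {0..} x *\<^sub>R exp (- x\<^sup>2))) (of_real (sqrt pi / 2))"
    by (rule has_bochner_integral_of_real[OF gaussian_moment_0])
  moreover have "complex_of_real (indicator {0..} x *\<^sub>R exp (- x\<^sup>2)) = indicator {0..} x *\<^sub>R exp (- (0 + complex_of_real x)\<^sup>2)" for x :: real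
  proof -
    have "- (0 + complex_of_real x)\<^sup>2 = of_real (- x\<^sup>2)" by simp
    then show ?thesis by (simp only: exp_of_real) (simp add: scaleR_conv_of_real)
  qed
  ultimately have "(LBINT x:{0..}. exp (- (0 + complex_of_real x)\<^sup>2)) = of_real (sqrt pi / 2)"
    unfolding set_lebesgue_integral_def by (metis (no_types, lifting) has_bochner_integral_cong has_bochner_integral_integral_eq)
  then have "erfc 0 = of_real (2 / sqrt pi * (sqrt pi / 2))"
    unfolding erfc_def of_real_mult by (simp only:)
  then show ?thesis by simp
qed

lemma tendsto_det:
  fixes M :: "nat \<Rightarrow> 'm::finite \<Rightarrow> 'm \<Rightarrow> complex"
  assumes "\<And>k l. (\<lambda>j. M j k l) \<longlonglongrightarrow> M' k l"
  shows "(\<lambda>j. det (\<chi> k l. M j k l)) \<longlonglongrightarrow> det (\<chi> k l. M' k l)"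
  unfolding det_def using assms by (simp add: tendsto_sum tendsto_mult_left tendsto_prod)

lemma tendsto_ellipse_form:
  assumes "t \<longlonglongrightarrow> t0" "x \<longlonglongrightarrow> x0" "y \<longlonglongrightarrow> y0" "0 \<le> t0" "t0 < 1"
  shows "(\<lambda>j::nat. ellipse_form (t j) (x j) (y j)) \<longlonglongrightarrow> ellipse_form t0 x0 y0"
  unfolding ellipse_form_def using assms by (intro tendsto_intros) auto

lemma tendsto_ellipse_gradient:
  assumes "t \<longlonglongrightarrow> t0" "x \<longlonglongrightarrow> x0" "y \<longlonglongrightarrow> y0" "0 \<le> t0" "t0 < 1"
  shows "(\<lambda>j::nat. ellipse_gradient (t j) (x j) (y j)) \<longlonglongrightarrow> ellipse_gradient t0 x0 y0"
  unfolding ellipse_gradient_def using assms by (intro tendsto_intros) auto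

lemma tendsto_inverse_sqrt_nat:
  assumes "filterlim N at_top sequentially"
  shows "(\<lambda>j. 1 / sqrt (real (N j))) \<longlonglongrightarrow> 0"
proof -
  have "filterlim (\<lambda>j. sqrt (real (N j))) at_top sequentially"
    by (rule filterlim_compose[OF sqrt_at_top filterlim_compose[OF filterlim_real_sequentially assms]])
  then show ?thesis
    using tendsto_inverse_0_at_top by (simp add: divide_inverse)
qed

text \<open>The gradient has a positive limit length, so the normals converge and the limiting
  gradient is this length times the limiting normal.\<close>

lemma unit_normal_tendsto:
  assumes t: "t \<longlonglongrightarrow> t0" "0 \<le> t0" "t0 < 1" and x: "x \<longlonglongrightarrow> x0" and y: "y \<longlonglongrightarrow> y0"
    and E: "\<And>j. ellipse_form (t j) (x j) (y j) = 1"
    and \<mu>: "\<And>j. \<mu> j = Complex (x j * ((1 - t j) / (1 + t j))) (y j * ((1 + t j) / (1 - t j))) / of_real (ellipse_gradient (t j) (x j) (y j))"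
    and un: "\<And>j. cmod (\<mu> j) = 1"
  obtains \<mu>0 where "\<mu> \<longlonglongrightarrow> \<mu>0" "cmod \<mu>0 = 1" "0 < ellipse_gradient t0 x0 y0"
    "x0 * ((1 - t0) / (1 + t0)) = ellipse_gradient t0 x0 y0 * Re \<mu>0"
    "y0 * ((1 + t0) / (1 - t0)) = ellipse_gradient t0 x0 y0 * Im \<mu>0"
proof -
  have "(\<lambda>j. 1::real) \<longlonglongrightarrow> ellipse_form t0 x0 y0"
    using tendsto_ellipse_form[OF t(1) x y t(2,3)] unfolding E .
  then have "ellipse_form t0 x0 y0 = 1" using LIMSEQ_unique tendsto_const by blast
  then have D: "0 < ellipse_gradient t0 x0 y0"
    by (rule ellipse_bounds(5)[OF t(2) order_refl t(3)])
  define \<mu>0 where "\<mu>0 = Complex (x0 * ((1 - t0) / (1 + t0))) (y0 * ((1 + t0) / (1 - t0))) / of_real (ellipse_gradient t0 x0 y0)"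
  have lim: "\<mu> \<longlonglongrightarrow> \<mu>0"
    unfolding \<mu> \<mu>0_def using tendsto_ellipse_gradient[OF t(1) x y t(2,3)] t x y D
    by (intro tendsto_divide tendsto_Complex tendsto_of_real tendsto_intros) auto
  have "(\<lambda>j. cmod (\<mu> j)) \<longlonglongrightarrow> cmod \<mu>0" using lim by (rule tendsto_norm)
  then have "cmod \<mu>0 = 1" unfolding un using LIMSEQ_unique tendsto_const by blast
  moreover have "Re \<mu>0 = x0 * ((1 - t0) / (1 + t0)) / ellipse_gradient t0 x0 y0"
    "Im \<mu>0 = y0 * ((1 + t0) / (1 - t0)) / ellipse_gradient t0 x0 y0"
    by (simp_all add: \<mu>0_def)
  ultimately show thesis using lim D by (intro that[of \<mu>0]) simp_all
qed

text \<open>Displacements rotated by the normal direction enter the edge limit through the gradient.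
  Because the gradient is a multiple of that same direction, the rotation cancels and a universal
  argument of \<open>erfc\<close> remains.\<close>

lemma kernel_ratio_edge_scaling:
  assumes N: "filterlim N at_top sequentially" "\<And>j. 0 < N j"
    and t: "\<And>j. 0 \<le> t j" "\<And>j. t j \<le> \<tau>" "\<tau> < 1"
    and E: "\<And>j. ellipse_form (t j) (Re (z j)) (Im (z j)) = 1"
    and lims: "t \<longlonglongrightarrow> t0" "z \<longlonglongrightarrow> z0" "\<zeta> \<longlonglongrightarrow> \<zeta>0" "\<omega> \<longlonglongrightarrow> \<omega>0"
    and \<mu>: "\<And>j. \<mu> j = Complex (Re (z j) * ((1 - t j) / (1 + t j))) (Im (z j) * ((1 + t j) / (1 - t j))) /
        of_real (ellipse_gradient (t j) (Re (z j)) (Im (z j)))"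
    and un: "\<And>j. cmod (\<mu> j) = 1"
  shows "(\<lambda>j. kernel_ratio (N j) (t j) (z j + \<mu> j * \<omega> j / of_real (sqrt (real (N j))))
      (z j + \<mu> j * \<zeta> j / of_real (sqrt (real (N j))))) \<longlonglongrightarrow> erfc ((\<zeta>0 + cnj \<omega>0) / of_real (sqrt 2)) / 2"
proof -
  have t0: "0 \<le> t0" "t0 < 1"
    using LIMSEQ_le_const[OF lims(1)] LIMSEQ_le_const2[OF lims(1)] t by force+
  have re: "(\<lambda>j. Re (z j)) \<longlonglongrightarrow> Re z0" and im: "(\<lambda>j. Im (z j)) \<longlonglongrightarrow> Im z0"
    using lims(2) by (auto intro: tendsto_Re tendsto_Im)
  obtain \<mu>0 where \<mu>0: "\<mu> \<longlonglongrightarrow> \<mu>0" "cmod \<mu>0 = 1" "0 < ellipse_gradient t0 (Re z0) (Im z0)"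
    "Re z0 * ((1 - t0) / (1 + t0)) = ellipse_gradient t0 (Re z0) (Im z0) * Re \<mu>0"
    "Im z0 * ((1 + t0) / (1 - t0)) = ellipse_gradient t0 (Re z0) (Im z0) * Im \<mu>0"
    using unit_normal_tendsto[OF lims(1) t0 re im E \<mu> un] .
  define \<xi> \<upsilon> where "\<xi> = (\<lambda>j. (\<mu> j * \<zeta> j + cnj (\<mu> j * \<omega> j)) / 2)"
    and "\<upsilon> = (\<lambda>j. (\<mu> j * \<zeta> j - cnj (\<mu> j * \<omega> j)) / (2 * \<i>))"
  have \<xi>: "\<xi> \<longlonglongrightarrow> (\<mu>0 * \<zeta>0 + cnj (\<mu>0 * \<omega>0)) / 2"
    unfolding \<xi>_def by (intro tendsto_intros \<mu>0(1) lims tendsto_cnj) simp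
  have \<upsilon>: "\<upsilon> \<longlonglongrightarrow> (\<mu>0 * \<zeta>0 - cnj (\<mu>0 * \<omega>0)) / (2 * \<i>)"
    unfolding \<upsilon>_def by (intro tendsto_intros \<mu>0(1) lims tendsto_cnj) simp
  define D where "D = ellipse_gradient t0 (Re z0) (Im z0)"
  have "\<mu>0 * cnj \<mu>0 = 1" using \<mu>0(2) by (simp add: complex_norm_square[symmetric])
  then have unit: "cnj \<mu>0 * \<mu>0 = 1" by (simp add: mult.commute)
  have \<mu>c: "cnj \<mu>0 = of_real (Re \<mu>0) - \<i> * of_real (Im \<mu>0)" "\<mu>0 = of_real (Re \<mu>0) + \<i> * of_real (Im \<mu>0)"
    by (simp_all add: complex_eq_iff)
  have gen: "2 * (of_real (D * p) * (A / 2) + of_real (D * q) * (B / (2 * \<i>))) / of_real D = of_real p * A - \<i> * of_real q * B"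
    if "D \<noteq> 0" for D p q A B
  proof -
    have "2 * (of_real (D * p) * (A / 2) + of_real (D * q) * (B / (2 * \<i>))) = of_real D * (of_real p * A - \<i> * of_real q * B)"
      by (simp add: right_diff_distrib mult_ac)
    then show ?thesis using that by simp
  qed
  \<comment> \<open>Pairing the gradient with the complexified displacements collects
    \<open>cnj \<mu>0\<close> in front of \<open>\<mu>0 * \<zeta>0\<close> and \<open>\<mu>0\<close>
    in front of the conjugated term, and \<open>\<mu>0\<close> is unimodular.\<close>
  have "2 * (of_real (D * Re \<mu>0) * ((\<mu>0 * \<zeta>0 + cnj (\<mu>0 * \<omega>0)) / 2) + of_real (D * Im \<mu>0) * ((\<mu>0 * \<zeta>0 - cnj (\<mu>0 * \<omega>0)) / (2 * \<i>))) / of_real D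
    = of_real (Re \<mu>0) * (\<mu>0 * \<zeta>0 + cnj (\<mu>0 * \<omega>0)) - \<i> * of_real (Im \<mu>0) * (\<mu>0 * \<zeta>0 - cnj (\<mu>0 * \<omega>0))"
    using \<mu>0(3) by (intro gen) (simp add: D_def)
  also have "\<dots> = (of_real (Re \<mu>0) - \<i> * of_real (Im \<mu>0)) * (\<mu>0 * \<zeta>0) + (of_real (Re \<mu>0) + \<i> * of_real (Im \<mu>0)) * cnj (\<mu>0 * \<omega>0)"
    by (simp only: distrib_left right_diff_distrib distrib_right left_diff_distrib) simp
  also have "\<dots> = (cnj \<mu>0 * \<mu>0) * \<zeta>0 + (cnj \<mu>0 * \<mu>0) * cnj \<omega>0"
    unfolding \<mu>c[symmetric] by simp
  also have "\<dots> = \<zeta>0 + cnj \<omega>0" unfolding unit by simp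
  finally have g: "\<zeta>0 + cnj \<omega>0 = 2 * (of_real (Re z0 * ((1 - t0) / (1 + t0))) * ((\<mu>0 * \<zeta>0 + cnj (\<mu>0 * \<omega>0)) / 2) +
      of_real (Im z0 * ((1 + t0) / (1 - t0))) * ((\<mu>0 * \<zeta>0 - cnj (\<mu>0 * \<omega>0)) / (2 * \<i>))) / of_real (ellipse_gradient t0 (Re z0) (Im z0))"
    unfolding \<mu>0(4,5) D_def[symmetric] by simp
  have X: "((z + \<mu> * \<zeta> / s) + cnj (z + \<mu> * \<omega> / s)) / 2 = of_real (Re z) + (\<mu> * \<zeta> + cnj (\<mu> * \<omega>)) / 2 / s"
    if "cnj s = s" for z \<mu> \<zeta> \<omega> s
  proof -
    have "of_real (Re z) = (z + cnj z) / 2" by (simp add: complex_eq_iff)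
    then show ?thesis using that by (simp add: add_divide_distrib mult.commute)
  qed
  have Y: "((z + \<mu> * \<zeta> / s) - cnj (z + \<mu> * \<omega> / s)) / (2 * \<i>) = of_real (Im z) + (\<mu> * \<zeta> - cnj (\<mu> * \<omega>)) / (2 * \<i>) / s"
    if "cnj s = s" for z \<mu> \<zeta> \<omega> s
  proof -
    have "of_real (Im z) = (z - cnj z) / (2 * \<i>)" by (simp add: complex_eq_iff)
    then show ?thesis using that by (simp add: add_divide_distrib diff_divide_distrib mult.commute)
  qed
  show ?thesis
    by (rule kernel_ratio_edge_tendsto[OF N t E lims(1) re im \<xi> \<upsilon> g])
      (unfold \<xi>_def \<upsilon>_def, (rule X Y, simp)+)
qed

text \<open>Here both the ratio at the base point and those at the displaced points tend to 1, so
  only the Ginibre factor survives, with \<open>pi / R\<close> tending to \<open>pi\<close>.\<close>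

lemma correlation_bulk_limit:
  fixes a :: "nat \<Rightarrow> complex ^ 'm"
  assumes N: "filterlim N at_top sequentially" "\<And>j. 0 < N j"
    and t: "\<And>j. 0 \<le> t j" "\<And>j. t j \<le> \<tau>" "\<tau> < 1" and \<beta>: "0 \<le> \<beta>" "\<beta> < 1"
    and E: "\<And>j. ellipse_form (t j) (Re (z j)) (Im (z j)) \<le> \<beta>"
    and lims: "t \<longlonglongrightarrow> t0" "z \<longlonglongrightarrow> z0" "a \<longlonglongrightarrow> a0"
    and un: "\<And>j. cmod (\<mu> j) = 1"
  shows "(\<lambda>j. scaled_correlation (N j) (t j) (z j) (\<mu> j) (a j)) \<longlonglongrightarrow>
    det (\<chi> k l. exp (complex_of_real (- (pi / 2) * (cmod (a0 $ k - a0 $ l))\<^sup>2) + \<i> * complex_of_real (pi * Im (cnj (a0 $ k) * a0 $ l))))"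
proof -
  define R where "R = (\<lambda>j. Re (kernel_ratio (N j) (t j) (z j) (z j)))"
  define pt where "pt = (\<lambda>j k. z j + \<mu> j * a j $ k * of_real (sqrt (pi / R j)) / of_real (sqrt (real (N j))))"
  have "(\<lambda>j. det (\<chi> k l. exp (of_real (pi / R j) * (of_real (- ((cmod (a j $ k - a j $ l))\<^sup>2 / 2)) + \<i> * of_real (Im (cnj (a j $ k) * a j $ l))))
         * (kernel_ratio (N j) (t j) (pt j k) (pt j l) / of_real (R j)))) \<longlonglongrightarrow>
      det (\<chi> k l. exp (complex_of_real (- (pi / 2) * (cmod (a0 $ k - a0 $ l))\<^sup>2) + \<i> * complex_of_real (pi * Im (cnj (a0 $ k) * a0 $ l))))"
  proof (rule tendsto_det)
    fix k l
    have \<tau>0: "0 \<le> \<tau>" using t(1)[of 0] t(2)[of 0] by simp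
    have t0: "0 \<le> t0" "t0 < 1"
      using LIMSEQ_le_const[OF lims(1)] LIMSEQ_le_const2[OF lims(1)] t by force+
    \<comment> \<open>The displaced points may leave the level set \<open>\<beta>\<close>; a
      slightly larger level below 1 contains them eventually.\<close>
    define \<beta>' where "\<beta>' = (1 + \<beta>) / 2"
    have \<beta>': "0 \<le> \<beta>'" "\<beta>' < 1" "\<beta> < \<beta>'" using \<beta> by (simp_all add: \<beta>'_def)
    obtain C \<theta> where C: "0 \<le> C" "0 < \<theta>" "\<theta> < 1" and bound: "\<And>n t w z. 0 \<le> t \<Longrightarrow> t \<le> \<tau> \<Longrightarrow>
        ellipse_form t (Re z) (Im z) \<le> \<beta>' \<Longrightarrow> ellipse_form t (Re w) (Im w) \<le> \<beta>' \<Longrightarrow>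
        cmod (kernel_ratio n t w z - 1) \<le> exp (real n * (cmod (z - w))\<^sup>2 / 2) * (C * \<theta> ^ n)"
      by (rule kernel_ratio_bulk_bound[OF \<tau>0 t(3) \<beta>'(1,2)]) (rule that; blast)
    have "(\<lambda>j. \<theta> ^ N j) \<longlonglongrightarrow> 0"
      using filterlim_compose[OF LIMSEQ_realpow_zero N(1)] C by simp
    then have C\<theta>: "(\<lambda>j. C * \<theta> ^ N j) \<longlonglongrightarrow> 0"
      using tendsto_mult_right_zero by blast
    have "(\<lambda>j. kernel_ratio (N j) (t j) (z j) (z j) - 1) \<longlonglongrightarrow> 0"
    proof (rule Lim_null_comparison[OF always_eventually C\<theta>], rule allI)
      fix j
      have "ellipse_form (t j) (Re (z j)) (Im (z j)) \<le> \<beta>'" using E[of j] \<beta>'(3) by simp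
      then show "cmod (kernel_ratio (N j) (t j) (z j) (z j) - 1) \<le> C * \<theta> ^ N j"
        using bound[OF t(1,2), of j "z j" "z j" "N j"] by simp
    qed
    then have "(\<lambda>j. kernel_ratio (N j) (t j) (z j) (z j)) \<longlonglongrightarrow> 1" by (rule LIM_zero_cancel)
    then have R: "R \<longlonglongrightarrow> 1"
      unfolding R_def using tendsto_Re by fastforce
    then have Rpos: "\<forall>\<^sub>F j in sequentially. 0 < R j"
      by (rule order_tendstoD) simp
    have av: "(\<lambda>j. a j $ i) \<longlonglongrightarrow> a0 $ i" for i using lims(3) by (rule tendsto_vec_nth)
    have "(\<lambda>j. pt j i - z j) \<longlonglongrightarrow> 0" for i
    proof (rule tendsto_norm_zero_cancel)
      have "(\<lambda>j. cmod (a j $ i) * \<bar>sqrt (pi / R j)\<bar> * (1 / sqrt (real (N j)))) \<longlonglongrightarrow> cmod (a0 $ i) * \<bar>sqrt (pi / 1)\<bar> * 0"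
        using R by (intro tendsto_intros av tendsto_inverse_sqrt_nat[OF N(1)]) auto
      then show "(\<lambda>j. cmod (pt j i - z j)) \<longlonglongrightarrow> 0"
        by (simp add: pt_def norm_mult norm_divide un)
    qed
    then have ptz: "(\<lambda>j. pt j i) \<longlonglongrightarrow> z0" for i
      using tendsto_add[of "\<lambda>j. pt j i - z j" 0 sequentially z z0] lims(2) by simp
    have Ept: "\<forall>\<^sub>F j in sequentially. ellipse_form (t j) (Re (pt j i)) (Im (pt j i)) \<le> \<beta>'" for i
    proof -
      have lim: "(\<lambda>j. ellipse_form (t j) (Re (f j)) (Im (f j))) \<longlonglongrightarrow> ellipse_form t0 (Re z0) (Im z0)"
        if "f \<longlonglongrightarrow> z0" for f
        using that by (intro tendsto_ellipse_form lims t0 tendsto_Re tendsto_Im)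
      have "ellipse_form t0 (Re z0) (Im z0) \<le> \<beta>"
        using LIMSEQ_le_const2[OF lim[OF lims(2)]] E by blast
      then have "ellipse_form t0 (Re z0) (Im z0) < \<beta>'" using \<beta>'(3) by simp
      from order_tendstoD(2)[OF lim[OF ptz[of i]] this] show ?thesis by eventually_elim simp
    qed
    \<comment> \<open>The scaled distance has no dependence on \<open>N\<close> beyond
      \<open>R\<close>, so the Cauchy-Schwarz loss stays bounded while \<open>\<theta> ^ N j\<close>
      tends to 0.\<close>
    have dist: "\<forall>\<^sub>F j in sequentially. real (N j) * (cmod (pt j l - pt j k))\<^sup>2 = (cmod (a j $ l - a j $ k))\<^sup>2 * (pi / R j)"
      using Rpos
    proof eventually_elim
      case (elim j)
      have "pt j l - pt j k = \<mu> j * (a j $ l - a j $ k) * of_real (sqrt (pi / R j)) / of_real (sqrt (real (N j)))"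
        by (simp add: pt_def diff_divide_distrib left_diff_distrib right_diff_distrib)
      then have "(cmod (pt j l - pt j k))\<^sup>2 = (cmod (a j $ l - a j $ k))\<^sup>2 * (pi / R j) / real (N j)"
        using elim by (simp add: norm_mult norm_divide un power_mult_distrib power_divide)
      then show ?case using N(2)[of j] by simp
    qed
    have "(\<lambda>j. exp ((cmod (a j $ l - a j $ k))\<^sup>2 * (pi / R j) / 2) * (C * \<theta> ^ N j)) \<longlonglongrightarrow>
        exp ((cmod (a0 $ l - a0 $ k))\<^sup>2 * (pi / 1) / 2) * 0"
      using R by (intro tendsto_intros av C\<theta>) auto
    then have b0: "(\<lambda>j. exp ((cmod (a j $ l - a j $ k))\<^sup>2 * (pi / R j) / 2) * (C * \<theta> ^ N j)) \<longlonglongrightarrow> 0" by simp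
    have "(\<lambda>j. kernel_ratio (N j) (t j) (pt j k) (pt j l) - 1) \<longlonglongrightarrow> 0"
    proof (rule Lim_null_comparison[OF _ b0])
      show "\<forall>\<^sub>F j in sequentially. cmod (kernel_ratio (N j) (t j) (pt j k) (pt j l) - 1)
          \<le> exp ((cmod (a j $ l - a j $ k))\<^sup>2 * (pi / R j) / 2) * (C * \<theta> ^ N j)"
        using dist Ept[of k] Ept[of l]
      proof eventually_elim
        case (elim j)
        show ?case
          using bound[OF t(1,2) elim(3,2), of "N j"] unfolding elim(1) .
      qed
    qed
    then have kr: "(\<lambda>j. kernel_ratio (N j) (t j) (pt j k) (pt j l)) \<longlonglongrightarrow> 1" by (rule LIM_zero_cancel)
    have "(\<lambda>j. exp (of_real (pi / R j) * (of_real (- ((cmod (a j $ k - a j $ l))\<^sup>2 / 2)) + \<i> * of_real (Im (cnj (a j $ k) * a j $ l))))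
         * (kernel_ratio (N j) (t j) (pt j k) (pt j l) / of_real (R j))) \<longlonglongrightarrow>
        exp (of_real (pi / 1) * (of_real (- ((cmod (a0 $ k - a0 $ l))\<^sup>2 / 2)) + \<i> * of_real (Im (cnj (a0 $ k) * a0 $ l)))) * (1 / of_real 1)"
      using R by (intro tendsto_intros tendsto_Im tendsto_cnj av kr) auto
    also have "exp (of_real (pi / 1) * (of_real (- ((cmod (a0 $ k - a0 $ l))\<^sup>2 / 2)) + \<i> * of_real (Im (cnj (a0 $ k) * a0 $ l)))) * (1 / of_real 1)
        = exp (complex_of_real (- (pi / 2) * (cmod (a0 $ k - a0 $ l))\<^sup>2) + \<i> * complex_of_real (pi * Im (cnj (a0 $ k) * a0 $ l)))"
    proof -
      have *: "of_real p * (of_real (- (d / 2)) + \<i> * of_real e) = of_real (- (p / 2) * d) + \<i> * complex_of_real (p * e)" for p d e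
        by (simp add: distrib_left right_diff_distrib mult_ac)
      then show ?thesis unfolding * by simp
    qed
    finally show "(\<lambda>j. exp (of_real (pi / R j) * (of_real (- ((cmod (a j $ k - a j $ l))\<^sup>2 / 2)) + \<i> * of_real (Im (cnj (a j $ k) * a j $ l))))
         * (kernel_ratio (N j) (t j) (pt j k) (pt j l) / of_real (R j))) \<longlonglongrightarrow>
       exp (complex_of_real (- (pi / 2) * (cmod (a0 $ k - a0 $ l))\<^sup>2) + \<i> * complex_of_real (pi * Im (cnj (a0 $ k) * a0 $ l)))" .
  qed
  then show ?thesis
    unfolding scaled_correlation_def Let_def R_def pt_def .
qed

text \<open>The ratio at the base point tends to \<open>erfc 0 / 2 = 1 / 2\<close>. Hence
  \<open>pi / R\<close> tends to \<open>2 * pi\<close>, and dividing by \<open>R\<close> cancels the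
  1/2 in front of \<open>erfc\<close>.\<close>

lemma correlation_edge_limit:
  fixes a :: "nat \<Rightarrow> complex ^ 'm"
  assumes N: "filterlim N at_top sequentially" "\<And>j. 0 < N j"
    and t: "\<And>j. 0 \<le> t j" "\<And>j. t j \<le> \<tau>" "\<tau> < 1"
    and E: "\<And>j. ellipse_form (t j) (Re (z j)) (Im (z j)) = 1"
    and lims: "t \<longlonglongrightarrow> t0" "z \<longlonglongrightarrow> z0" "a \<longlonglongrightarrow> a0"
    and \<mu>: "\<And>j. \<mu> j = Complex (Re (z j) * ((1 - t j) / (1 + t j))) (Im (z j) * ((1 + t j) / (1 - t j))) /
        of_real (ellipse_gradient (t j) (Re (z j)) (Im (z j)))"
    and un: "\<And>j. cmod (\<mu> j) = 1"
  shows "(\<lambda>j. scaled_correlation (N j) (t j) (z j) (\<mu> j) (a j)) \<longlonglongrightarrow>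
    det (\<chi> k l. erfc (complex_of_real (sqrt pi) * (cnj (a0 $ k) + a0 $ l)) *
       exp (complex_of_real (- pi * (cmod (a0 $ k - a0 $ l))\<^sup>2) + 2 * \<i> * complex_of_real (pi * Im (cnj (a0 $ k) * a0 $ l))))"
proof -
  define R where "R = (\<lambda>j. Re (kernel_ratio (N j) (t j) (z j) (z j)))"
  define pt where "pt = (\<lambda>j k. z j + \<mu> j * a j $ k * of_real (sqrt (pi / R j)) / of_real (sqrt (real (N j))))"
  have "(\<lambda>j. det (\<chi> k l. exp (of_real (pi / R j) * (of_real (- ((cmod (a j $ k - a j $ l))\<^sup>2 / 2)) + \<i> * of_real (Im (cnj (a j $ k) * a j $ l))))
         * (kernel_ratio (N j) (t j) (pt j k) (pt j l) / of_real (R j)))) \<longlonglongrightarrow>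
      det (\<chi> k l. erfc (complex_of_real (sqrt pi) * (cnj (a0 $ k) + a0 $ l)) *
         exp (complex_of_real (- pi * (cmod (a0 $ k - a0 $ l))\<^sup>2) + 2 * \<i> * complex_of_real (pi * Im (cnj (a0 $ k) * a0 $ l))))"
  proof (rule tendsto_det)
    fix k l
    have av: "(\<lambda>j. a j $ i) \<longlonglongrightarrow> a0 $ i" for i using lims(3) by (rule tendsto_vec_nth)
    have "(\<lambda>j. kernel_ratio (N j) (t j) (z j) (z j)) \<longlonglongrightarrow> 1 / 2"
      using kernel_ratio_edge_scaling[OF N t E lims(1,2) tendsto_const[of 0] tendsto_const[of 0] \<mu> un] by (simp add: erfc_0)
    from tendsto_Re[OF this] have R: "R \<longlonglongrightarrow> 1 / 2" unfolding R_def by simp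
    have sc: "(\<lambda>j. a j $ i * of_real (sqrt (pi / R j))) \<longlonglongrightarrow> a0 $ i * of_real (sqrt (pi / (1 / 2)))" for i
      using R by (intro tendsto_intros av) auto
    have kr: "(\<lambda>j. kernel_ratio (N j) (t j) (pt j k) (pt j l)) \<longlonglongrightarrow>
        erfc ((a0 $ l * of_real (sqrt (pi / (1 / 2))) + cnj (a0 $ k * of_real (sqrt (pi / (1 / 2))))) / of_real (sqrt 2)) / 2"
      using kernel_ratio_edge_scaling[OF N t E lims(1,2) sc[of l] sc[of k] \<mu> un] unfolding pt_def mult.assoc .
    \<comment> \<open>The enlarged unit of length compensates the \<open>sqrt 2\<close> in the
      argument of \<open>erfc\<close>.\<close>
    have "sqrt (pi / (1 / 2)) = sqrt pi * sqrt 2" by (simp add: real_sqrt_mult)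
    then have arg: "(a0 $ l * of_real (sqrt (pi / (1 / 2))) + cnj (a0 $ k * of_real (sqrt (pi / (1 / 2))))) / of_real (sqrt 2)
       = complex_of_real (sqrt pi) * (cnj (a0 $ k) + a0 $ l)"
      by (simp add: add_divide_distrib distrib_left mult.commute)
    have "(\<lambda>j. exp (of_real (pi / R j) * (of_real (- ((cmod (a j $ k - a j $ l))\<^sup>2 / 2)) + \<i> * of_real (Im (cnj (a j $ k) * a j $ l))))
         * (kernel_ratio (N j) (t j) (pt j k) (pt j l) / of_real (R j))) \<longlonglongrightarrow>
        exp (of_real (pi / (1 / 2)) * (of_real (- ((cmod (a0 $ k - a0 $ l))\<^sup>2 / 2)) + \<i> * of_real (Im (cnj (a0 $ k) * a0 $ l))))
          * (erfc (complex_of_real (sqrt pi) * (cnj (a0 $ k) + a0 $ l)) / 2 / of_real (1 / 2))"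
      using R by (intro tendsto_intros tendsto_Im tendsto_cnj av kr[unfolded arg]) auto
    also have "exp (of_real (pi / (1 / 2)) * (of_real (- ((cmod (a0 $ k - a0 $ l))\<^sup>2 / 2)) + \<i> * of_real (Im (cnj (a0 $ k) * a0 $ l))))
          * (erfc (complex_of_real (sqrt pi) * (cnj (a0 $ k) + a0 $ l)) / 2 / of_real (1 / 2))
        = erfc (complex_of_real (sqrt pi) * (cnj (a0 $ k) + a0 $ l)) *
         exp (complex_of_real (- pi * (cmod (a0 $ k - a0 $ l))\<^sup>2) + 2 * \<i> * complex_of_real (pi * Im (cnj (a0 $ k) * a0 $ l)))"
    proof -
      have *: "of_real (p / (1 / 2)) * (of_real (- (d / 2)) + \<i> * of_real e) = of_real (- p * d) + 2 * \<i> * complex_of_real (p * e)" for p d e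
        by (simp add: distrib_left right_diff_distrib mult_ac)
      then show ?thesis unfolding * by simp
    qed
    finally show "(\<lambda>j. exp (of_real (pi / R j) * (of_real (- ((cmod (a j $ k - a j $ l))\<^sup>2 / 2)) + \<i> * of_real (Im (cnj (a j $ k) * a j $ l))))
         * (kernel_ratio (N j) (t j) (pt j k) (pt j l) / of_real (R j))) \<longlonglongrightarrow>
       erfc (complex_of_real (sqrt pi) * (cnj (a0 $ k) + a0 $ l)) *
         exp (complex_of_real (- pi * (cmod (a0 $ k - a0 $ l))\<^sup>2) + 2 * \<i> * complex_of_real (pi * Im (cnj (a0 $ k) * a0 $ l)))" .
  qed
  then show ?thesis
    unfolding scaled_correlation_def Let_def R_def pt_def .
qed

section \<open>Uniformity\<close>

text \<open>Failure of uniform convergence supplies parameters with values above some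
  \<open>\<epsilon>\<close> for arbitrarily large \<open>n\<close>; a subsequence along which
  \<open>F\<close> tends to 0 contradicts this.\<close>

lemma SUP_tendsto_zero_by_subsequences:
  fixes F :: "nat \<Rightarrow> 'p \<Rightarrow> 'q \<Rightarrow> real"
  assumes sub: "\<And>N p q. filterlim N at_top sequentially \<Longrightarrow> (\<And>j. 0 < N j) \<Longrightarrow> (\<And>j. p j \<in> P) \<Longrightarrow>
      (\<And>j. q j \<in> Q (p j)) \<Longrightarrow> \<exists>r. strict_mono r \<and> (\<lambda>j. F (N (r j)) (p (r j)) (q (r j))) \<longlonglongrightarrow> 0"
  shows "(\<lambda>n. SUP p\<in>P. SUP q\<in>Q p. ennreal (F n p q)) \<longlonglongrightarrow> 0"
proof -
  have unif: "\<exists>n0. \<forall>n\<ge>n0. \<forall>p\<in>P. \<forall>q\<in>Q p. F n p q \<le> \<epsilon>" if \<epsilon>: "0 < \<epsilon>" for \<epsilon>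
  proof (rule ccontr)
    assume neg: "\<not> (\<exists>n0. \<forall>n\<ge>n0. \<forall>p\<in>P. \<forall>q\<in>Q p. F n p q \<le> \<epsilon>)"
    \<comment> \<open>\<open>Suc j\<close> instead of \<open>j\<close> makes the chosen indices
      positive as well as divergent.\<close>
    have "\<forall>j. \<exists>n p q. Suc j \<le> n \<and> p \<in> P \<and> q \<in> Q p \<and> \<epsilon> < F n p q"
    proof
      fix j
      from neg have "\<not> (\<forall>n\<ge>Suc j. \<forall>p\<in>P. \<forall>q\<in>Q p. F n p q \<le> \<epsilon>)" by blast
      then show "\<exists>n p q. Suc j \<le> n \<and> p \<in> P \<and> q \<in> Q p \<and> \<epsilon> < F n p q" by (meson not_le)
    qed
    then obtain N p q where *: "\<And>j. Suc j \<le> N j" "\<And>j. p j \<in> P" "\<And>j. q j \<in> Q (p j)"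
      "\<And>j. \<epsilon> < F (N j) (p j) (q j)"
      by metis
    have "filterlim N at_top sequentially"
      by (rule filterlim_at_top_mono[OF filterlim_Suc]) (simp add: *(1))
    moreover have "0 < N j" for j using *(1)[of j] by simp
    ultimately obtain r where "strict_mono r" "(\<lambda>j. F (N (r j)) (p (r j)) (q (r j))) \<longlonglongrightarrow> 0"
      using sub[of N p q] *(2,3) by blast
    then have "\<epsilon> \<le> 0" using *(4) by (intro LIMSEQ_le_const) (auto intro: less_imp_le)
    then show False using \<epsilon> by simp
  qed
  show ?thesis
  proof (rule order_tendstoI)
    fix b :: ennreal
    assume "0 < b"
    then obtain c where c: "0 < c" "c < b" using dense by blast
    then obtain \<epsilon> where \<epsilon>: "c = ennreal \<epsilon>" "0 \<le> \<epsilon>"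
      by (cases c) auto
    then have "0 < \<epsilon>" using c by (metis ennreal_0 less_le less_irrefl)
    then obtain n0 where n0: "\<And>n p q. n0 \<le> n \<Longrightarrow> p \<in> P \<Longrightarrow> q \<in> Q p \<Longrightarrow> F n p q \<le> \<epsilon>"
      using unif by blast
    have "(SUP p\<in>P. SUP q\<in>Q p. ennreal (F n p q)) \<le> c" if "n0 \<le> n" for n
      unfolding \<epsilon>(1) using n0 that by (intro SUP_least ennreal_leI) auto
    then show "\<forall>\<^sub>F n in sequentially. (SUP p\<in>P. SUP q\<in>Q p. ennreal (F n p q)) < b"
      using c(2) unfolding eventually_sequentially by (meson le_less_trans)
  qed simp
qed

text \<open>\<open>t0\<close> and \<open>t1\<close> vary over unbounded sets, but after the
  reduction only \<open>t\<close>, the standard point and \<open>a\<close> are left, and these are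
  bounded because \<open>\<tau> < 1\<close> bounds the axes of the ellipse.\<close>

lemma convergent_parameters:
  fixes t :: "nat \<Rightarrow> real" and z :: "nat \<Rightarrow> complex" and a :: "nat \<Rightarrow> complex ^ 'm"
  assumes t: "\<And>j. 0 \<le> t j" "\<And>j. t j \<le> \<tau>" "\<tau> < 1"
    and E: "\<And>j. ellipse_form (t j) (Re (z j)) (Im (z j)) \<le> 1" and a: "\<And>j k. cmod (a j $ k) \<le> A"
  obtains r t0 z0 a0 where "strict_mono r" "(\<lambda>j. t (r j)) \<longlonglongrightarrow> t0" "(\<lambda>j. z (r j)) \<longlonglongrightarrow> z0" "(\<lambda>j. a (r j)) \<longlonglongrightarrow> a0"
proof -
  have "bounded (range t)"
    using t(1,2) by (intro boundedI[where B = \<tau>]) auto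
  moreover have "bounded (range z)"
  proof -
    have "cmod (z j) \<le> sqrt (2 / (1 - \<tau>) + 1)" for j
    proof -
      define c x y where "c = (1 - t j) / (1 + t j)" and "x = Re (z j)" and "y = Im (z j)"
      have tj: "0 \<le> t j" "t j \<le> \<tau>" "t j < 1" using t(1,2)[of j] t(3) by auto
      have c: "(1 - \<tau>) / 2 \<le> c" unfolding c_def using tj t(3) by (intro frac_le) auto
      have c0: "0 < (1 - \<tau>) / 2" using t(3) by simp
      have c1: "0 < c" using c c0 by linarith
      have ic: "1 \<le> 1 / c" unfolding c_def using tj by simp
      have "(1 + t j) / (1 - t j) = 1 / c" unfolding c_def by simp
      then have e: "x\<^sup>2 * c + y\<^sup>2 * (1 / c) \<le> 1"
        using E[of j] unfolding ellipse_form_def c_def x_def y_def by simp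
      have "0 \<le> x\<^sup>2 * c" "0 \<le> y\<^sup>2 * (1 / c)" using c1 by simp_all
      moreover have "x\<^sup>2 * ((1 - \<tau>) / 2) \<le> x\<^sup>2 * c" "y\<^sup>2 * 1 \<le> y\<^sup>2 * (1 / c)"
        using c ic by (intro mult_left_mono; simp)+
      ultimately have "x\<^sup>2 * ((1 - \<tau>) / 2) \<le> 1" "y\<^sup>2 \<le> 1" using e by linarith+
      then have "x\<^sup>2 \<le> 1 / ((1 - \<tau>) / 2)" "y\<^sup>2 \<le> 1" using c0 by (simp_all only: pos_le_divide_eq)
      then have "x\<^sup>2 + y\<^sup>2 \<le> 2 / (1 - \<tau>) + 1" by simp
      then show ?thesis unfolding cmod_def x_def y_def by (rule real_sqrt_le_mono)
    qed
    then show ?thesis by (intro boundedI) auto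
  qed
  moreover have "bounded (range a)"
  proof -
    have "norm (a j) \<le> (\<Sum>k\<in>(UNIV :: 'm set). A)" for j
      unfolding norm_vec_def by (rule order_trans[OF L2_set_le_sum _]) (rule norm_ge_zero, intro sum_mono a)
    then show ?thesis by (intro boundedI) auto
  qed
  ultimately have "bounded (range t \<times> range z \<times> range a)"
    by (intro bounded_Times)
  then have "bounded (range (\<lambda>j. (t j, z j, a j)))"
    by (rule bounded_subset) auto
  then obtain l r where "strict_mono r" "((\<lambda>j. (t j, z j, a j)) \<circ> r) \<longlonglongrightarrow> l"
    using bounded_imp_convergent_subsequence by blast
  then show thesis
    using tendsto_fst[of "(\<lambda>j. (t j, z j, a j)) \<circ> r" l] tendsto_snd[of "(\<lambda>j. (t j, z j, a j)) \<circ> r" l]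
      tendsto_fst[of "\<lambda>j. (z (r j), a (r j))" "snd l"] tendsto_snd[of "\<lambda>j. (z (r j), a (r j))" "snd l"]
    by (intro that[of r "fst l" "fst (snd l)" "snd (snd l)"]) (simp_all add: o_def)
qed

lemma correlation_bulk_subsequence:
  fixes a :: "nat \<Rightarrow> complex ^ 'm" and N :: "nat \<Rightarrow> nat" and t0 :: "nat \<Rightarrow> real" and t1 t2 z0 :: "nat \<Rightarrow> complex"
  assumes N: "filterlim N at_top sequentially" "\<And>j. 0 < N j"
    and \<delta>0: "0 < \<delta>0" "\<delta>0 < 1" and \<delta>: "0 < \<delta>" "\<delta> < sqrt (\<delta>0 / (2 - \<delta>0))"
    and t0: "\<And>j. 0 < t0 j" and t2: "\<And>j. 2 * cmod (t2 j) \<le> 1 - \<delta>0"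
    and z0: "\<And>j. z0 j \<in> ellipse_region (t0 j) (t1 j) (t2 j) (- \<delta>)" and a: "\<And>j k. cmod (a j $ k) \<le> A"
  defines "V \<equiv> \<lambda>j. elliptic_potential (t0 j) (t1 j) (t2 j)"
  defines "K \<equiv> \<lambda>j. repr_kernel (N j) (V j) (z0 j) (z0 j)"
  shows "\<exists>r. strict_mono r \<and> (\<lambda>j. cmod (correlation (N (r j)) (V (r j)) (\<chi> k. z0 (r j) + a (r j) $ k / csqrt (K (r j))) / K (r j) ^ CARD('m)
      - det (\<chi> k l. exp (complex_of_real (- (pi / 2) * (cmod (a (r j) $ k - a (r j) $ l))\<^sup>2)
          + \<i> * complex_of_real (pi * Im (cnj (a (r j) $ k) * a (r j) $ l)))))) \<longlonglongrightarrow> 0"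
proof -
  define \<tau> s \<beta> where "\<tau> = 1 - \<delta>0" and "s = sqrt (\<delta>0 / (2 - \<delta>0))" and "\<beta> = (1 - \<delta> * s)\<^sup>2"
  define t z where "t = (\<lambda>j. 2 * cmod (t2 j))" and "z = (\<lambda>j. std_point (t0 j) (t1 j) (t2 j) (z0 j))"
  have t: "\<And>j. 0 \<le> t j" "\<And>j. t j \<le> \<tau>" "\<tau> < 1" using t2 \<delta>0 by (simp_all add: t_def \<tau>_def)
  have s: "0 < s" "s \<le> 1" using \<delta>0 by (simp_all add: s_def)
  have ds: "0 < \<delta> * s" "\<delta> * s < 1"
  proof -
    show "0 < \<delta> * s" using \<delta> s by simp
    have "\<delta> * s \<le> \<delta> * 1" using \<delta> s by (intro mult_left_mono) auto
    then show "\<delta> * s < 1" using \<delta>(2) s unfolding s_def[symmetric] by linarith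
  qed
  have \<beta>: "0 \<le> \<beta>" "\<beta> < 1"
    unfolding \<beta>_def using ds by (simp_all add: abs_square_less_1)
  have E: "ellipse_form (t j) (Re (z j)) (Im (z j)) \<le> \<beta>" for j
    unfolding t_def z_def \<beta>_def s_def by (rule ellipse_region_std_point[OF t0 t2 \<delta>0 \<delta> z0])
  have E1: "ellipse_form (t j) (Re (z j)) (Im (z j)) \<le> 1" for j using E[of j] \<beta>(2) by simp
  obtain r t' z' a' where r: "strict_mono r" and lims: "(\<lambda>j. t (r j)) \<longlonglongrightarrow> t'" "(\<lambda>j. z (r j)) \<longlonglongrightarrow> z'" "(\<lambda>j. a (r j)) \<longlonglongrightarrow> a'"
    using convergent_parameters[OF t E1 a] .
  have Nr: "filterlim (\<lambda>j. N (r j)) at_top sequentially"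
    by (rule filterlim_compose[OF N(1) filterlim_subseq[OF r]])
  \<comment> \<open>The bulk scaling has no extra rotation, so \<open>u = 1\<close>; the directions
    need not converge, since the limit is the same for all of them.\<close>
  define \<mu> where "\<mu> = (\<lambda>j. cis (Arg (t2 j) / 2) * 1)"
  have "cmod (\<mu> j) = 1" for j by (simp add: \<mu>_def)
  note lim = correlation_bulk_limit[OF Nr N(2) t \<beta> E lims this]
  have corr: "correlation (N j) (V j) (\<chi> k. z0 j + a j $ k / csqrt (K j)) / K j ^ CARD('m) = scaled_correlation (N j) (t j) (z j) (\<mu> j) (a j)" for j
  proof -
    have "2 * cmod (t2 j) < 1" using t2[of j] \<delta>0 by simp
    from correlation_elliptic_potential[OF N(2) t0 this norm_one] show ?thesis
      unfolding V_def K_def z_def t_def \<mu>_def mult_1_right .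
  qed
  have av: "(\<lambda>j. a (r j) $ i) \<longlonglongrightarrow> a' $ i" for i using lims(3) by (rule tendsto_vec_nth)
  \<comment> \<open>The comparison determinant varies with \<open>a (r j)\<close> too; it has the
    same limit as the correlation, so the difference tends to 0.\<close>
  have "(\<lambda>j. det (\<chi> k l. exp (complex_of_real (- (pi / 2) * (cmod (a (r j) $ k - a (r j) $ l))\<^sup>2)
          + \<i> * complex_of_real (pi * Im (cnj (a (r j) $ k) * a (r j) $ l))))) \<longlonglongrightarrow>
     det (\<chi> k l. exp (complex_of_real (- (pi / 2) * (cmod (a' $ k - a' $ l))\<^sup>2)
          + \<i> * complex_of_real (pi * Im (cnj (a' $ k) * a' $ l))))"
    by (intro tendsto_det tendsto_intros tendsto_Im tendsto_cnj av)
  from tendsto_norm[OF tendsto_diff[OF lim this]] show ?thesis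
    unfolding corr by (intro exI[of _ r] conjI r) (simp only: diff_self norm_zero)
qed

lemma correlation_edge_subsequence:
  fixes a :: "nat \<Rightarrow> complex ^ 'm" and N :: "nat \<Rightarrow> nat" and t0 :: "nat \<Rightarrow> real" and t1 t2 z0 :: "nat \<Rightarrow> complex"
  assumes N: "filterlim N at_top sequentially" "\<And>j. 0 < N j" and \<delta>0: "0 < \<delta>0"
    and t0: "\<And>j. 0 < t0 j" and t2: "\<And>j. 2 * cmod (t2 j) \<le> 1 - \<delta>0"
    and z0: "\<And>j. z0 j \<in> ellipse_boundary (t0 j) (t1 j) (t2 j)" and a: "\<And>j k. cmod (a j $ k) \<le> A"
  defines "V \<equiv> \<lambda>j. elliptic_potential (t0 j) (t1 j) (t2 j)" and "\<psi> \<equiv> \<lambda>j. normal_angle (t0 j) (t1 j) (t2 j) (z0 j)"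
  defines "K \<equiv> \<lambda>j. repr_kernel (N j) (V j) (z0 j) (z0 j)"
  shows "\<exists>r. strict_mono r \<and> (\<lambda>j. cmod (correlation (N (r j)) (V (r j)) (\<chi> k. z0 (r j) + a (r j) $ k * cis (\<psi> (r j)) / csqrt (K (r j))) / K (r j) ^ CARD('m)
      - det (\<chi> k l. erfc (complex_of_real (sqrt pi) * (cnj (a (r j) $ k) + a (r j) $ l)) *
          exp (complex_of_real (- pi * (cmod (a (r j) $ k - a (r j) $ l))\<^sup>2)
            + 2 * \<i> * complex_of_real (pi * Im (cnj (a (r j) $ k) * a (r j) $ l)))))) \<longlonglongrightarrow> 0"
proof -
  define \<tau> where "\<tau> = 1 - \<delta>0"
  define t z where "t = (\<lambda>j. 2 * cmod (t2 j))" and "z = (\<lambda>j. std_point (t0 j) (t1 j) (t2 j) (z0 j))"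
  have t: "\<And>j. 0 \<le> t j" "\<And>j. t j \<le> \<tau>" "\<tau> < 1" using t2 \<delta>0 by (simp_all add: t_def \<tau>_def)
  have t2': "2 * cmod (t2 j) < 1" for j using t2[of j] \<delta>0 by simp
  have E: "ellipse_form (t j) (Re (z j)) (Im (z j)) = 1" for j
    unfolding t_def z_def by (rule ellipse_boundary_std_point[OF t0 t2' z0])
  have E1: "ellipse_form (t j) (Re (z j)) (Im (z j)) \<le> 1" for j using E[of j] by simp
  obtain r t' z' a' where r: "strict_mono r" and lims: "(\<lambda>j. t (r j)) \<longlonglongrightarrow> t'" "(\<lambda>j. z (r j)) \<longlonglongrightarrow> z'" "(\<lambda>j. a (r j)) \<longlonglongrightarrow> a'"
    using convergent_parameters[OF t E1 a] .
  have Nr: "filterlim (\<lambda>j. N (r j)) at_top sequentially"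
    by (rule filterlim_compose[OF N(1) filterlim_subseq[OF r]])
  define \<mu> where "\<mu> = (\<lambda>j. cis (Arg (t2 j) / 2) * cis (\<psi> j))"
  have un: "cmod (\<mu> j) = 1" for j by (simp add: \<mu>_def norm_mult)
  \<comment> \<open>Half the argument of \<open>t2\<close> carries \<open>\<psi>\<close> into
    standard coordinates, where it becomes the unit normal required by the edge limit.\<close>
  have \<mu>: "\<mu> j = Complex (Re (z j) * ((1 - t j) / (1 + t j))) (Im (z j) * ((1 + t j) / (1 - t j))) /
      of_real (ellipse_gradient (t j) (Re (z j)) (Im (z j)))" for j
    unfolding \<mu>_def \<psi>_def z_def t_def by (rule cis_normal_angle[OF t0 t2' z0])
  note lim = correlation_edge_limit[OF Nr N(2) t E lims \<mu> un]
  have corr: "correlation (N j) (V j) (\<chi> k. z0 j + a j $ k * cis (\<psi> j) / csqrt (K j)) / K j ^ CARD('m) = scaled_correlation (N j) (t j) (z j) (\<mu> j) (a j)" for j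
    unfolding V_def K_def z_def t_def \<mu>_def by (rule correlation_elliptic_potential[OF N(2) t0 t2' norm_cis])
  have av: "(\<lambda>j. a (r j) $ i) \<longlonglongrightarrow> a' $ i" for i using lims(3) by (rule tendsto_vec_nth)
  have "(\<lambda>j. det (\<chi> k l. erfc (complex_of_real (sqrt pi) * (cnj (a (r j) $ k) + a (r j) $ l)) *
          exp (complex_of_real (- pi * (cmod (a (r j) $ k - a (r j) $ l))\<^sup>2)
            + 2 * \<i> * complex_of_real (pi * Im (cnj (a (r j) $ k) * a (r j) $ l))))) \<longlonglongrightarrow>
     det (\<chi> k l. erfc (complex_of_real (sqrt pi) * (cnj (a' $ k) + a' $ l)) *
          exp (complex_of_real (- pi * (cmod (a' $ k - a' $ l))\<^sup>2) + 2 * \<i> * complex_of_real (pi * Im (cnj (a' $ k) * a' $ l))))"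
    by (intro tendsto_det tendsto_erfc tendsto_intros tendsto_Im tendsto_cnj av)
  from tendsto_norm[OF tendsto_diff[OF lim this]] show ?thesis
    unfolding corr by (intro exI[of _ r] conjI r) (simp only: diff_self norm_zero)
qed

theorem theorem10p9:
  fixes \<delta>0 A \<delta> :: real
  assumes "0 < \<delta>0" and "\<delta>0 < 1" and "0 < A"
    and "0 < \<delta>" and "\<delta> < sqrt (\<delta>0 / (2 - \<delta>0))"
  shows
   "((\<lambda>n. SUP (t0, t1, t2) \<in> {(t0 :: real, t1 :: complex, t2 :: complex).
               0 < t0 \<and> 0 \<le> 2 * cmod t2 \<and> 2 * cmod t2 \<le> 1 - \<delta>0}.
           SUP (z0, a) \<in> ellipse_region t0 t1 t2 (- \<delta>) \<times>
               {a :: complex ^ 'm. \<forall>k. a $ k \<in> cball 0 A}.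
             let K = repr_kernel n (elliptic_potential t0 t1 t2) z0 z0 in
             ennreal (cmod (
               correlation n (elliptic_potential t0 t1 t2) (\<chi> k. z0 + a $ k / csqrt K)
                 / K ^ CARD('m)
               - det (\<chi> k l :: 'm.
                   exp (complex_of_real (- (pi / 2) * (cmod (a $ k - a $ l))\<^sup>2)
                        + \<i> * complex_of_real (pi * Im (cnj (a $ k) * a $ l)))))))
       \<longlonglongrightarrow> 0)
    \<and>
    ((\<lambda>n. SUP (t0, t1, t2) \<in> {(t0 :: real, t1 :: complex, t2 :: complex).
               0 < t0 \<and> 0 \<le> 2 * cmod t2 \<and> 2 * cmod t2 \<le> 1 - \<delta>0}.
           SUP (z0, a) \<in> ellipse_boundary t0 t1 t2 \<times>
               {a :: complex ^ 'm. \<forall>k. a $ k \<in> cball 0 A}.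
             let K = repr_kernel n (elliptic_potential t0 t1 t2) z0 z0;
                 \<psi> = normal_angle t0 t1 t2 z0 in
             ennreal (cmod (
               correlation n (elliptic_potential t0 t1 t2) (\<chi> k. z0 + a $ k * cis \<psi> / csqrt K)
                 / K ^ CARD('m)
               - det (\<chi> k l :: 'm.
                   erfc (complex_of_real (sqrt pi) * (cnj (a $ k) + a $ l)) *
                   exp (complex_of_real (- pi * (cmod (a $ k - a $ l))\<^sup>2)
                        + 2 * \<i> * complex_of_real (pi * Im (cnj (a $ k) * a $ l)))))))
       \<longlonglongrightarrow> 0)"
  unfolding case_prod_unfold Let_def
\<comment> \<open>The outer parameter \<open>p\<close> is the triple of coefficients, the inner one
  \<open>q\<close> pairs the base point with the vector \<open>a\<close>.\<close>
proof (intro conjI SUP_tendsto_zero_by_subsequences, goal_cases)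
  case (1 N p q)
  then show ?case
    using assms by (intro correlation_bulk_subsequence) (auto simp: mem_Times_iff)
next
  case (2 N p q)
  then show ?case
    using assms by (intro correlation_edge_subsequence) (auto simp: mem_Times_iff)
qed

end
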